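(* Let $\mathbb K$ be a field of characteristic zero and $n$ a positive integer. The Lie algebra $\mathfrak{gl}(n,\mathbb K)\ltimes\mathfrak{gl}(n,\mathbb K)_{ab}$, with the associative commutative product $$\begin{aligned} &(a_0I_n+A_0,\;a_1I_n+A_1)\cdot(b_0I_n+B_0,\;b_1I_n+B_1)\\ &\quad=\Big(a_0b_0I_n+a_0B_0+b_0A_0,\\ &\qquad\ \big(a_0b_1+a_1b_0+\mathrm{tr}(A_0B_1+A_1B_0)-\tfrac2n\mathrm{tr}(A_0B_0)\big)I_n+a_0B_1+b_0A_1+A_0B_0+B_0A_0\Big) \end{aligned}$$ (with $a_0,a_1,b_0,b_1\in\mathbb K$ and $A_0,A_1,B_0,B_1\in\mathfrak{sl}(n,\mathbb K)$), is a Poisson algebra. For $n=3$, it is isomorphic, as a Poisson algebra, to $H_E^{\bullet,\bullet}(\mathfrak h)=\bigoplus_{p+q\text{ even}}H^p(\mathfrak h,\bigwedge^q\mathfrak h)$, where $\mathfrak h$ is the 3-dimensional Heisenberg Lie algebra over $\mathbb K$. Moreover, with respect to the decomposition $\big((I_n)_0\oplus\mathfrak{sl}(n)_0\big)\oplus\big((I_n)_{ab}\oplus\mathfrak{sl}(n)_{ab}\big)$, the $\mathrm{GL}(n,\mathbb K)$-tables of the product and of the Lie bracket are $$\begin{array}{c||c|c|c|c} \cdot&(I_n)_0&\mathfrak{sl}(n)_0&\mathfrak{sl}(n)_{ab}&(I_n)_{ab}\\\hline (I_n)_0&(I_n)_0&\mathfrak{sl}(n)_0&\mathfrak{sl}(n)_{ab}&(I_n)_{ab}\\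 \mathfrak{sl}(n)_0&\mathfrak{sl}(n)_0&\mathfrak{sl}(n)_{ab}^{(+)}&(I_n)_{ab}&0\\ \mathfrak{sl}(n)_{ab}&\mathfrak{sl}(n)_{ab}&(I_n)_{ab}&0&0\\ (I_n)_{ab}&(I_n)_{ab}&0&0&0 \end{array}$$ $$\begin{array}{c||c|c|c|c} \{-,-\}&(I_n)_0&\mathfrak{sl}(n)_0&\mathfrak{sl}(n)_{ab}&(I_n)_{ab}\\\hline (I_n)_0&0&0&0&0\\ \mathfrak{sl}(n)_0&0&\mathfrak{sl}(n)_0^{(-)}&\mathfrak{sl}(n)_{ab}^{(-)}&0\\ \mathfrak{sl}(n)_{ab}&0&\mathfrak{sl}(n)_{ab}^{(-)}&0&0\\ (I_n)_{ab}&0&0&0&0 \end{array}$$ where each nonzero entry means that the operation, restricted to the row and column summands, equals exactly (with coefficient 1) the corresponding equivariant map with values in the indicated summand: multiplication by scalars when one of the two summands is a copy of the trivial module; $A\otimes B\mapsto\mathrm{tr}(AB)$ (times the generator $I_n$) for $\mathfrak{sl}(n)\times\mathfrak{sl}(n)\to (I_n)_{ab}$; $A\otimes B\mapsto AB+BA-\frac2n\mathrm{tr}(AB)I_n$ for entries marked $(+)$; and $A\otimes B\mapsto AB-BA$ for entries marked $(-)$.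
   Context: $\mathfrak{gl}(n,\mathbb K)_{ab}$ is the vector space $\mathfrak{gl}(n,\mathbb K)$ viewed as an abelian Lie algebra on which $\mathfrak{gl}(n,\mathbb K)$ acts by the adjoint representation; thus the bracket on the semidirect product is $\{(X_0,X_1),(Y_0,Y_1)\}=([X_0,Y_0],[X_0,Y_1]-[Y_0,X_1])$. $\mathfrak{sl}(n,\mathbb K)$ is the space of traceless matrices, $I_n$ the identity matrix; every element of $\mathfrak{gl}(n,\mathbb K)\ltimes\mathfrak{gl}(n,\mathbb K)_{ab}$ is uniquely of the form $(x_0I_n+X_0,x_1I_n+X_1)$ with $x_0,x_1\in\mathbb K$, $X_0,X_1\in\mathfrak{sl}(n,\mathbb K)$. $(I_n)_0$, $\mathfrak{sl}(n)_0$ denote $\mathbb KI_n$ and $\mathfrak{sl}(n,\mathbb K)$ inside the first factor; $(I_n)_{ab}$, $\mathfrak{sl}(n)_{ab}$ the copies inside the second (abelian) factor. $\mathrm{GL}(n,\mathbb K)$ acts by conjugation on each factor. A Poisson algebra is a commutative associative algebra with a Lie bracket such that $\{c,ab\}=\{c,a\}b+a\{c,b\}$. $\mathfrak h$ has basis $x_1,x_{-1},h_0$ with only nonzero bracket $[x_1,x_{-1}]=h_0$ (up to skew-symmetry). Let $C^{p,q}=\bigwedge^p\mathfrak h^*\otimes\bigwedge^q\mathfrak h$, with product $(\phi\otimes v)\vee(\psi\otimes w)=(-1)^{p_2q_1}\,\phi\wedge\psi\otimes v\wedge w$ for $\phi\otimes v\in C^{p_1,q_1}$, $\psi\otimes w\in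 C^{p_2,q_2}$. $C^{\bullet,\bullet}$ is a Poisson superalgebra (parity of $C^{p,q}$ is $p+q$) with super-bracket $\{-,-\}:C^{p_1,q_1}\times C^{p_2,q_2}\to C^{p_1+p_2-1,q_1+q_2-1}$ determined by: $\{\mathfrak h,\mathfrak h\}=\{\mathfrak h^*,\mathfrak h^*\}=0$; $\{\phi,v\}=\{v,\phi\}=\phi(v)$ for $\phi\in\mathfrak h^*$, $v\in\mathfrak h$; $\{a,b\}=-(-1)^{(p_1+q_1)(p_2+q_2)}\{b,a\}$; and $\{a\vee b,c\}=a\vee\{b,c\}+(-1)^{(p_1+q_1)(p_2+q_2)}b\vee\{a,c\}$, for $a\in C^{p_1,q_1}$, $b\in C^{p_2,q_2}$. Let $\mu\in C^{2,1}=\bigwedge^2\mathfrak h^*\otimes\mathfrak h$ be the Lie bracket of $\mathfrak h$; the Chevalley–Eilenberg differential computing $H^p(\mathfrak h,\bigwedge^q\mathfrak h)$ is $d=\{\mu,-\}:C^{p,q}\to C^{p+1,q}$. The product $\vee$ and the bracket descend to cohomology, and $H_E^{\bullet,\bullet}(\mathfrak h)$ is a Poisson algebra with the induced operations. *)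

theory Defs
  imports "HOL-Analysis.Analysis"
begin

section \<open>Poisson algebras over a field\<close>

text \<open>
  Carriers are sets, so that quotients (whose elements are cosets) are covered. The
  product is only required to be commutative and associative; no unit is part of the structure.
\<close>

record ('k, 'a) poisson_struct =
  carrier :: "'a set"
  zero :: 'a
  add :: "'a \<Rightarrow> 'a \<Rightarrow> 'a"
  smult :: "'k \<Rightarrow> 'a \<Rightarrow> 'a"
  mult :: "'a \<Rightarrow> 'a \<Rightarrow> 'a"
  bracket :: "'a \<Rightarrow> 'a \<Rightarrow> 'a"

locale vector_space_struct =
  fixes P :: "('k::field, 'a) poisson_struct"
  assumes zero_closed: "zero P \<in> carrier P"
    and add_closed: "\<lbrakk>x \<in> carrier P; y \<in> carrier P\<rbrakk> \<Longrightarrow> add P x y \<in> carrier P"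
    and smult_closed: "x \<in> carrier P \<Longrightarrow> smult P c x \<in> carrier P"
    and add_assoc: "\<lbrakk>x \<in> carrier P; y \<in> carrier P; z \<in> carrier P\<rbrakk>
      \<Longrightarrow> add P (add P x y) z = add P x (add P y z)"
    and add_comm: "\<lbrakk>x \<in> carrier P; y \<in> carrier P\<rbrakk> \<Longrightarrow> add P x y = add P y x"
    and add_zero: "x \<in> carrier P \<Longrightarrow> add P x (zero P) = x"
    and add_inverse: "x \<in> carrier P \<Longrightarrow> \<exists>y \<in> carrier P. add P x y = zero P"
    and smult_add_right: "\<lbrakk>x \<in> carrier P; y \<in> carrier P\<rbrakk>
      \<Longrightarrow> smult P c (add P x y) = add P (smult P c x) (smult P c y)"
    and smult_add_left: "x \<in> carrier P \<Longrightarrow> smult P (c + d) x = add P (smult P c x) (smult P d x)"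
    and smult_smult: "x \<in> carrier P \<Longrightarrow> smult P c (smult P d x) = smult P (c * d) x"
    and smult_one: "x \<in> carrier P \<Longrightarrow> smult P 1 x = x"

locale comm_assoc_algebra_struct = vector_space_struct P for P :: "('k::field, 'a) poisson_struct" +
  assumes mult_closed: "\<lbrakk>x \<in> carrier P; y \<in> carrier P\<rbrakk> \<Longrightarrow> mult P x y \<in> carrier P"
    and mult_assoc: "\<lbrakk>x \<in> carrier P; y \<in> carrier P; z \<in> carrier P\<rbrakk>
      \<Longrightarrow> mult P (mult P x y) z = mult P x (mult P y z)"
    and mult_comm: "\<lbrakk>x \<in> carrier P; y \<in> carrier P\<rbrakk> \<Longrightarrow> mult P x y = mult P y x"
    and mult_add: "\<lbrakk>x \<in> carrier P; y \<in> carrier P; z \<in> carrier P\<rbrakk>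
      \<Longrightarrow> mult P x (add P y z) = add P (mult P x y) (mult P x z)"
    and mult_smult: "\<lbrakk>x \<in> carrier P; y \<in> carrier P\<rbrakk>
      \<Longrightarrow> mult P x (smult P c y) = smult P c (mult P x y)"

locale lie_algebra_struct = vector_space_struct P for P :: "('k::field, 'a) poisson_struct" +
  assumes bracket_closed: "\<lbrakk>x \<in> carrier P; y \<in> carrier P\<rbrakk> \<Longrightarrow> bracket P x y \<in> carrier P"
    and bracket_add_left: "\<lbrakk>x \<in> carrier P; y \<in> carrier P; z \<in> carrier P\<rbrakk>
      \<Longrightarrow> bracket P (add P x y) z = add P (bracket P x z) (bracket P y z)"
    and bracket_add_right: "\<lbrakk>x \<in> carrier P; y \<in> carrier P; z \<in> carrier P\<rbrakk>
      \<Longrightarrow> bracket P x (add P y z) = add P (bracket P x y) (bracket P x z)"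
    and bracket_smult_left: "\<lbrakk>x \<in> carrier P; y \<in> carrier P\<rbrakk>
      \<Longrightarrow> bracket P (smult P c x) y = smult P c (bracket P x y)"
    and bracket_smult_right: "\<lbrakk>x \<in> carrier P; y \<in> carrier P\<rbrakk>
      \<Longrightarrow> bracket P x (smult P c y) = smult P c (bracket P x y)"
    and bracket_self: "x \<in> carrier P \<Longrightarrow> bracket P x x = zero P"
    and jacobi: "\<lbrakk>x \<in> carrier P; y \<in> carrier P; z \<in> carrier P\<rbrakk>
      \<Longrightarrow> add P (bracket P x (bracket P y z))
            (add P (bracket P y (bracket P z x)) (bracket P z (bracket P x y))) = zero P"

locale poisson_algebra = comm_assoc_algebra_struct P + lie_algebra_struct P
  for P :: "('k::field, 'a) poisson_struct" +
  assumes leibniz: "\<lbrakk>a \<in> carrier P; b \<in> carrier P; c \<in> carrier P\<rbrakk>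
      \<Longrightarrow> bracket P c (mult P a b) = add P (mult P (bracket P c a) b) (mult P a (bracket P c b))"

definition poisson_isomorphic ::
  "('k::field, 'a) poisson_struct \<Rightarrow> ('k, 'b) poisson_struct \<Rightarrow> bool" where
  "poisson_isomorphic P Q \<longleftrightarrow>
    (\<exists>f. bij_betw f (carrier P) (carrier Q) \<and>
      (\<forall>x \<in> carrier P. \<forall>y \<in> carrier P. f (add P x y) = add Q (f x) (f y)) \<and>
      (\<forall>c. \<forall>x \<in> carrier P. f (smult P c x) = smult Q c (f x)) \<and>
      (\<forall>x \<in> carrier P. \<forall>y \<in> carrier P. f (mult P x y) = mult Q (f x) (f y)) \<and>
      (\<forall>x \<in> carrier P. \<forall>y \<in> carrier P. f (bracket P x y) = bracket Q (f x) (f y)))"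


section \<open>The Poisson structure on the semidirect product of gl(n) and its abelian copy\<close>

type_synonym ('k, 'n) sqmat = "'k^'n^'n"

definition mat_smult :: "'k::field \<Rightarrow> ('k, 'n::finite) sqmat \<Rightarrow> ('k, 'n) sqmat"  (infixr "*\<^sub>m" 75)
  where "c *\<^sub>m X = (\<chi> i j. c * X $ i $ j)"

definition commutator :: "('k::field, 'n::finite) sqmat \<Rightarrow> ('k, 'n) sqmat \<Rightarrow> ('k, 'n) sqmat" where
  "commutator X Y = X ** Y - Y ** X"

text \<open>
  \<open>mat c\<close> is \<open>c\<close> times the identity matrix. In characteristic zero \<open>scal_part X\<close> and
  \<open>sl_part X\<close> are the unique \<open>x\<^sub>0\<close> and traceless \<open>X\<^sub>0\<close> with \<open>X = x\<^sub>0 I\<^sub>n + X\<^sub>0\<close>.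
\<close>

definition scal_part :: "('k::field, 'n::finite) sqmat \<Rightarrow> 'k" where
  "scal_part X = trace X / of_nat CARD('n)"

definition sl_part :: "('k::field, 'n::finite) sqmat \<Rightarrow> ('k, 'n) sqmat" where
  "sl_part X = X - mat (scal_part X)"

definition gl_bracket ::
  "('k::field, 'n::finite) sqmat \<times> ('k, 'n) sqmat \<Rightarrow> ('k, 'n) sqmat \<times> ('k, 'n) sqmat
    \<Rightarrow> ('k, 'n) sqmat \<times> ('k, 'n) sqmat" where
  "gl_bracket x y = (case (x, y) of ((X0, X1), (Y0, Y1)) \<Rightarrow>
    (commutator X0 Y0, commutator X0 Y1 - commutator Y0 X1))"

definition gl_mult ::
  "('k::field, 'n::finite) sqmat \<times> ('k, 'n) sqmat \<Rightarrow> ('k, 'n) sqmat \<times> ('k, 'n) sqmat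
    \<Rightarrow> ('k, 'n) sqmat \<times> ('k, 'n) sqmat" where
  "gl_mult x y =
    (let a0 = scal_part (fst x); A0 = sl_part (fst x);
         a1 = scal_part (snd x); A1 = sl_part (snd x);
         b0 = scal_part (fst y); B0 = sl_part (fst y);
         b1 = scal_part (snd y); B1 = sl_part (snd y)
     in (mat (a0 * b0) + a0 *\<^sub>m B0 + b0 *\<^sub>m A0,
         mat (a0 * b1 + a1 * b0 + trace (A0 ** B1 + A1 ** B0)
              - 2 / of_nat CARD('n) * trace (A0 ** B0))
         + a0 *\<^sub>m B1 + b0 *\<^sub>m A1 + A0 ** B0 + B0 ** A0))"

lemma trace_mat_scalar: "trace (mat c :: ('k::field, 'n::finite) sqmat) = of_nat CARD('n) * c"
  by (simp add: trace_def mat_def)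

lemma scal_sl_part_decomp:
  fixes A :: "('k::field_char_0, 'n::finite) sqmat"
  assumes "trace A = 0"
  shows "scal_part (mat a + A) = a" "sl_part (mat a + A) = A"
  using assms by (simp_all add: scal_part_def sl_part_def trace_add trace_mat_scalar)

lemma gl_mult_decomp:
  fixes A0 A1 B0 B1 :: "('k::field_char_0, 'n::finite) sqmat"
  assumes "trace A0 = 0" "trace A1 = 0" "trace B0 = 0" "trace B1 = 0"
  shows "gl_mult (mat a0 + A0, mat a1 + A1) (mat b0 + B0, mat b1 + B1) =
    (mat (a0 * b0) + a0 *\<^sub>m B0 + b0 *\<^sub>m A0,
     mat (a0 * b1 + a1 * b0 + trace (A0 ** B1 + A1 ** B0)
          - 2 / of_nat CARD('n) * trace (A0 ** B0))
     + a0 *\<^sub>m B1 + b0 *\<^sub>m A1 + A0 ** B0 + B0 ** A0)"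
  using assms by (simp add: gl_mult_def scal_sl_part_decomp)

definition gl_poisson :: "('k::field, ('k, 'n::finite) sqmat \<times> ('k, 'n) sqmat) poisson_struct" where
  "gl_poisson = \<lparr> carrier = UNIV, zero = 0, add = (+),
     smult = (\<lambda>c (X0, X1). (c *\<^sub>m X0, c *\<^sub>m X1)), mult = gl_mult, bracket = gl_bracket \<rparr>"

text \<open>The four summands; \<open>in_sl_0\<close> and \<open>in_sl_ab\<close> are meant for traceless arguments.\<close>

definition in_I_0 :: "'k::field \<Rightarrow> ('k, 'n::finite) sqmat \<times> ('k, 'n) sqmat" where
  "in_I_0 a = (mat a, 0)"

definition in_sl_0 :: "('k::field, 'n::finite) sqmat \<Rightarrow> ('k, 'n) sqmat \<times> ('k, 'n) sqmat" where
  "in_sl_0 A = (A, 0)"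

definition in_I_ab :: "'k::field \<Rightarrow> ('k, 'n::finite) sqmat \<times> ('k, 'n) sqmat" where
  "in_I_ab a = (0, mat a)"

definition in_sl_ab :: "('k::field, 'n::finite) sqmat \<Rightarrow> ('k, 'n) sqmat \<times> ('k, 'n) sqmat" where
  "in_sl_ab A = (0, A)"

definition sl :: "('k::field, 'n::finite) sqmat set" where
  "sl = {A. trace A = 0}"

definition sl_plus :: "('k::field, 'n::finite) sqmat \<Rightarrow> ('k, 'n) sqmat \<Rightarrow> ('k, 'n) sqmat" where
  "sl_plus A B = A ** B + B ** A - mat (2 / of_nat CARD('n) * trace (A ** B))"

definition conj_by :: "('k::field, 'n::finite) sqmat \<Rightarrow> ('k, 'n) sqmat \<Rightarrow> ('k, 'n) sqmat" where
  "conj_by g X = g ** X ** matrix_inv g"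

definition gl_act :: "('k::field, 'n::finite) sqmat
    \<Rightarrow> ('k, 'n) sqmat \<times> ('k, 'n) sqmat \<Rightarrow> ('k, 'n) sqmat \<times> ('k, 'n) sqmat" where
  "gl_act g x = (conj_by g (fst x), conj_by g (snd x))"


section \<open>Cochains of a Lie algebra with values in its exterior algebra\<close>

text \<open>
  Let the Lie algebra be \<open>'k^'b\<close>, with standard basis \<open>e\<^sub>i\<close> indexed by the finite linear order
  \<open>'b\<close> and dual basis \<open>e\<^sup>i\<close>. The exterior algebra (of the space or of its dual) is
  \<open>'k^('b set)\<close>: the coordinate at \<open>S = {i\<^sub>1 < \<dots> < i\<^sub>p}\<close> belongs to the basis element
  \<open>e\<^sub>S = e\<^sub>i\<^sub>1 \<and> \<dots> \<and> e\<^sub>i\<^sub>p\<close> (with \<open>e\<^sub>S = 1\<close> for empty \<open>S\<close>). For disjoint \<open>S\<close> and \<open>T\<close>, sorting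
  \<open>e\<^sub>S \<and> e\<^sub>T\<close> produces the sign \<open>shuffle_sign S T\<close>.
\<close>

definition shuffle_sign :: "'b::{finite,linorder} set \<Rightarrow> 'b set \<Rightarrow> 'k::field" where
  "shuffle_sign S T = (- 1) ^ card {(s, t). s \<in> S \<and> t \<in> T \<and> t < s}"

type_synonym ('k, 'b) ext = "'k^('b set)"

definition wedge :: "('k::field, 'b::{finite,linorder}) ext \<Rightarrow> ('k, 'b) ext \<Rightarrow> ('k, 'b) ext" where
  "wedge v w = (\<Sum>S\<in>UNIV. \<Sum>T\<in>UNIV.
     if S \<inter> T = {} then (v $ S * w $ T * shuffle_sign S T) *s axis (S \<union> T) 1 else 0)"

text \<open>
  The total cochain space (tensor product of the exterior algebra of the dual with the exterior
  algebra): the coordinate at \<open>(S, T)\<close> belongs to \<open>e\<^sup>S \<otimes> e\<^sub>T\<close>.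
\<close>

type_synonym ('k, 'b) cochain = "'k^('b set \<times> 'b set)"

definition tensor :: "('k::field, 'b::{finite,linorder}) ext \<Rightarrow> ('k, 'b) ext \<Rightarrow> ('k, 'b) cochain" where
  "tensor v w = (\<chi> i. v $ fst i * w $ snd i)"

text \<open>Bidegrees are integers, so that the components of degree \<open>-1\<close> exist and vanish.\<close>

definition cochains :: "int \<Rightarrow> int \<Rightarrow> ('k::field, 'b::{finite,linorder}) cochain set" where
  "cochains p q = {a. \<forall>S T. a $ (S, T) \<noteq> 0 \<longrightarrow> int (card S) = p \<and> int (card T) = q}"

definition vee :: "('k::field, 'b::{finite,linorder}) cochain \<Rightarrow> ('k, 'b) cochain \<Rightarrow> ('k, 'b) cochain"
    (infixl "\<or>\<^sub>C" 70) where
  "a \<or>\<^sub>C b = (\<Sum>(S1, T1)\<in>UNIV. \<Sum>(S2, T2)\<in>UNIV.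
     (a $ (S1, T1) * b $ (S2, T2) * (- 1) ^ (card S2 * card T1)) *s
       tensor (wedge (axis S1 1) (axis S2 1)) (wedge (axis T1 1) (axis T2 1)))"

definition of_vector :: "'k::field^'b::{finite,linorder} \<Rightarrow> ('k, 'b) cochain" where
  "of_vector v = (\<Sum>i\<in>UNIV. v $ i *s axis ({}, {i}) 1)"

definition of_covector :: "'k::field^'b::{finite,linorder} \<Rightarrow> ('k, 'b) cochain" where
  "of_covector \<phi> = (\<Sum>i\<in>UNIV. \<phi> $ i *s axis ({i}, {}) 1)"

definition of_scalar :: "'k::field \<Rightarrow> ('k, 'b::{finite,linorder}) cochain" where
  "of_scalar c = c *s axis ({}, {}) 1"

definition is_super_bracket ::
  "(('k::field, 'b::{finite,linorder}) cochain \<Rightarrow> ('k, 'b) cochain \<Rightarrow> ('k, 'b) cochain) \<Rightarrow> bool" where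
  "is_super_bracket br \<longleftrightarrow>
    (\<forall>a. Vector_Spaces.linear (*s) (*s) (br a)) \<and>
    (\<forall>b. Vector_Spaces.linear (*s) (*s) (\<lambda>a. br a b)) \<and>
    (\<forall>p1 q1 p2 q2. \<forall>a \<in> cochains p1 q1. \<forall>b \<in> cochains p2 q2.
       br a b \<in> cochains (p1 + p2 - 1) (q1 + q2 - 1)) \<and>
    (\<forall>v w. br (of_vector v) (of_vector w) = 0) \<and>
    (\<forall>\<phi> \<psi>. br (of_covector \<phi>) (of_covector \<psi>) = 0) \<and>
    (\<forall>\<phi> v. br (of_covector \<phi>) (of_vector v) = of_scalar (\<Sum>i\<in>UNIV. \<phi> $ i * v $ i) \<and>
            br (of_vector v) (of_covector \<phi>) = of_scalar (\<Sum>i\<in>UNIV. \<phi> $ i * v $ i)) \<and>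
    (\<forall>p1 q1 p2 q2 :: nat. \<forall>a \<in> cochains p1 q1. \<forall>b \<in> cochains p2 q2.
       br a b = (- ((- 1) ^ ((p1 + q1) * (p2 + q2)))) *s br b a) \<and>
    (\<forall>p1 q1 p2 q2 :: nat. \<forall>a \<in> cochains p1 q1. \<forall>b \<in> cochains p2 q2. \<forall>c.
       br (a \<or>\<^sub>C b) c = a \<or>\<^sub>C br b c + (- 1) ^ ((p1 + q1) * (p2 + q2)) *s (b \<or>\<^sub>C br a c))"

definition super_bracket ::
  "('k::field, 'b::{finite,linorder}) cochain \<Rightarrow> ('k, 'b) cochain \<Rightarrow> ('k, 'b) cochain" where
  "super_bracket = (THE br. is_super_bracket br)"

text \<open>
  The Lie bracket \<open>lb\<close> as an element of bidegree \<open>(2,1)\<close>, where \<open>\<phi> \<and> \<psi>\<close> is the alternating form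
  \<open>(x, y) \<mapsto> \<phi>(x) \<psi>(y) - \<phi>(y) \<psi>(x)\<close>.
\<close>

definition lie_cochain ::
  "(('k::field, 'b::{finite,linorder}) vec \<Rightarrow> ('k, 'b) vec \<Rightarrow> ('k, 'b) vec) \<Rightarrow> ('k, 'b) cochain" where
  "lie_cochain lb = (\<Sum>(i, j) \<in> {(i, j). i < j}. \<Sum>k\<in>UNIV. lb (axis i 1) (axis j 1) $ k *s axis ({i, j}, {k}) 1)"

definition ce_diff :: "(('k::field, 'b::{finite,linorder}) vec \<Rightarrow> ('k, 'b) vec \<Rightarrow> ('k, 'b) vec)
    \<Rightarrow> ('k, 'b) cochain \<Rightarrow> ('k, 'b) cochain" where
  "ce_diff lb = super_bracket (lie_cochain lb)"

definition cocycles :: "(('k::field, 'b::{finite,linorder}) vec \<Rightarrow> ('k, 'b) vec \<Rightarrow> ('k, 'b) vec)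
    \<Rightarrow> int \<Rightarrow> int \<Rightarrow> ('k, 'b) cochain set" where
  "cocycles lb p q = {a \<in> cochains p q. ce_diff lb a = 0}"

definition coboundaries :: "(('k::field, 'b::{finite,linorder}) vec \<Rightarrow> ('k, 'b) vec \<Rightarrow> ('k, 'b) vec)
    \<Rightarrow> int \<Rightarrow> int \<Rightarrow> ('k, 'b) cochain set" where
  "coboundaries lb p q = ce_diff lb ` cochains (p - 1) q"

text \<open>The (internal direct) sum of a family of subspaces \<open>F p q\<close> over the bidegrees with \<open>p + q\<close> even.\<close>

definition even_sum ::
  "(int \<Rightarrow> int \<Rightarrow> ('k::field, 'b::{finite,linorder}) cochain set) \<Rightarrow> ('k, 'b) cochain set" where
  "even_sum F =
    {(\<Sum>(p, q) \<in> {(p, q) \<in> {0..int CARD('b)} \<times> {0..int CARD('b)}. even (p + q)}. f p q)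
      | f. \<forall>p q. f p q \<in> F p q}"

text \<open>
  The even cohomology, the direct sum of all \<open>cocycles lb p q / coboundaries lb p q\<close> with \<open>p + q\<close>
  even, realised as the quotient of the sum of the cocycle spaces by the sum of the coboundary
  spaces. Elements are cosets; each operation is defined by applying the operation on
  cochains to all representatives, so that the result is a single coset exactly if the operation
  descends.
\<close>

definition HE :: "(('k::field, 'b::{finite,linorder}) vec \<Rightarrow> ('k, 'b) vec \<Rightarrow> ('k, 'b) vec)
    \<Rightarrow> ('k, ('k, 'b) cochain set) poisson_struct" where
  "HE lb =
    (let Z = even_sum (cocycles lb);
         B = even_sum (coboundaries lb);
         coset = (\<lambda>a. (\<lambda>b. a + b) ` B)
     in \<lparr> carrier = coset ` Z,
          zero = B,
          add = (\<lambda>X Y. \<Union>x\<in>X. \<Union>y\<in>Y. coset (x + y)),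
          smult = (\<lambda>c X. \<Union>x\<in>X. coset (c *s x)),
          mult = (\<lambda>X Y. \<Union>x\<in>X. \<Union>y\<in>Y. coset (x \<or>\<^sub>C y)),
          bracket = (\<lambda>X Y. \<Union>x\<in>X. \<Union>y\<in>Y. coset (super_bracket x y)) \<rparr>)"


section \<open>The three-dimensional Heisenberg Lie algebra\<close>

datatype heis = X1 | Xm1 | H0

lemma UNIV_heis: "UNIV = {X1, Xm1, H0}"
  using heis.exhaust by blast

instance heis :: finite
  by standard (simp add: UNIV_heis)

fun heis_pos :: "heis \<Rightarrow> nat" where
  "heis_pos X1 = 0" | "heis_pos Xm1 = 1" | "heis_pos H0 = 2"

lemma inj_heis_pos: "heis_pos x = heis_pos y \<Longrightarrow> x = y"
  by (cases x; cases y) simp_all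

instantiation heis :: linorder
begin
definition "x \<le> y \<longleftrightarrow> heis_pos x \<le> heis_pos y"
definition "x < y \<longleftrightarrow> heis_pos x < heis_pos y"
instance
  by standard (auto simp: less_eq_heis_def less_heis_def intro: inj_heis_pos)
end

definition heis_bracket :: "'k::field^heis \<Rightarrow> 'k^heis \<Rightarrow> 'k^heis" where
  "heis_bracket x y = axis H0 (x $ X1 * y $ Xm1 - x $ Xm1 * y $ X1)"

end

theory Submission
  imports Defs
begin

text \<open>
  The two halves of the theorem meet in the trace form and the symmetric product \<open>sl_plus\<close> on traceless
  matrices. Write each of the two matrices of an element of the semidirect product as a scalar plus a
  traceless matrix. The product then consists of scalar multiplications, of \<open>sl_plus\<close> from the first
  traceless summand to the second one, and of the trace form. Both operations are invariant under
  commutators and under conjugation, and \<open>tr (sl_plus A B ** C)\<close> is symmetric in \<open>A\<close>, \<open>B\<close> and \<open>C\<close>. This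
  gives associativity, the Leibniz rule, equivariance and the two tables (\<open>poisson_algebra_gl\<close>,
  \<open>gl_act_equivariant\<close>, \<open>gl_mult_table\<close>, \<open>gl_bracket_table\<close>).

  On the cohomological side, the algebra of cochains is the exterior algebra on the covectors and
  vectors together, and the super-bracket is the Poisson bracket that contracts each generator with
  its dual (\<open>contr_bracket\<close>). It satisfies the defining rules and the Jacobi identity, and the rules
  determine it since they reduce every bracket to generators (\<open>super_bracket_eq\<close>). The differential is
  the bracket with an odd element, hence a derivation of both operations, which is why they descend to
  cohomology (\<open>coboundary_ideal\<close>).

  For the Heisenberg algebra the bracket, as a cochain, is a volume element \<open>e\<^sup>X\<^sup>1 \<and> e\<^sup>X\<^sup>m\<^sup>1 \<and> e\<^sub>H\<^sub>0\<close> of the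
  3-dimensional space \<open>L\<close> spanned by these three generators. This space is isotropic, and the other
  three generators span its dual \<open>L\<^sup>*\<close>. So the cochains are \<open>\<Lambda>L \<otimes> \<Lambda>L\<^sup>*\<close>, and the differential
  \<open>\<Lambda>\<^sup>iL \<otimes> \<Lambda>\<^sup>jL\<^sup>* \<rightarrow> \<Lambda>\<^sup>i\<^sup>+\<^sup>2L \<otimes> \<Lambda>\<^sup>j\<^sup>-\<^sup>1L\<^sup>*\<close> replaces a vector of \<open>L\<^sup>*\<close> by the corresponding element of
  \<open>\<Lambda>\<^sup>2L\<close>. This hidden symmetry produces the matrices: \<open>quad\<close> maps \<open>gl(L)\<close> to \<open>L \<otimes> L\<^sup>*\<close>, and the bracket
  of two such elements is the commutator (\<open>bracket_quad\<close>). The even cohomology is concentrated in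
  \<open>i = j\<close>: scalars for \<open>i = 0\<close>, the traceless matrices for \<open>i = 1\<close>, all matrices modulo the identity
  for \<open>i = 2\<close>, and again scalars for \<open>i = 3\<close> (\<open>even_cocycle_normal_form\<close>, \<open>heis_embed_injective\<close>).

  The invariant element \<open>euler = quad (mat 1)\<close> commutes with all \<open>quad A\<close>, so multiplication by it is an
  equivariant map from \<open>i = 1\<close> to \<open>i = 2\<close>. That the product of two traceless matrices in \<open>i = 1\<close>
  is \<open>sl_plus\<close> in \<open>i = 2\<close>, up to the exact element \<open>euler \<or>\<^sub>C euler\<close>, is the polarised Cayley-Hamilton
  identity for 3 by 3 matrices (\<open>quad_square\<close>); multiplying once more by \<open>euler\<close> gives the trace form.
\<close>

section \<open>The exterior algebra of cochains\<close>

text \<open>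
  The generators of the algebra of cochains are the covectors \<open>e\<^sup>i\<close>, written \<open>Inl i\<close>, and the
  vectors \<open>e\<^sub>i\<close>, written \<open>Inr i\<close>. In the basis element \<open>e\<^sup>S \<otimes> e\<^sub>T\<close> all covectors precede all vectors,
  which fixes the order of the generators.
\<close>

fun gen_less :: "'b::linorder + 'b \<Rightarrow> 'b + 'b \<Rightarrow> bool" where
  "gen_less (Inl i) (Inl j) = (i < j)"
| "gen_less (Inl i) (Inr j) = True"
| "gen_less (Inr i) (Inl j) = False"
| "gen_less (Inr i) (Inr j) = (i < j)"

lemma gen_less_total: "g \<noteq> h \<Longrightarrow> gen_less g h \<longleftrightarrow> \<not> gen_less h g"
  by (cases g; cases h) auto

text \<open>
  The sign that sorts the concatenation of two sorted monomials. As a product over pairs, rather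
  than a power with the number of inversions as exponent, it is visibly multiplicative in both
  arguments, which is what associativity and the derivation rules below come down to.
\<close>

definition reorder_sign :: "('b::{finite,linorder} + 'b) set \<Rightarrow> ('b + 'b) set \<Rightarrow> 'k::field" where
  "reorder_sign U V = (\<Prod>u\<in>U. \<Prod>v\<in>V. if gen_less v u then - 1 else 1)"

text \<open>
  A basis element is indexed by one set of generators instead of a pair of sets; \<open>index_of\<close> and
  \<open>gens_of\<close> translate between the two.
\<close>

definition index_of :: "('b + 'b) set \<Rightarrow> 'b set \<times> 'b set" where
  "index_of U = (Inl -` U, Inr -` U)"

definition gens_of :: "'b set \<times> 'b set \<Rightarrow> ('b + 'b) set" where
  "gens_of I = fst I <+> snd I"

definition basis :: "('b::{finite,linorder} + 'b) set \<Rightarrow> ('k::field, 'b) cochain" where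
  "basis U = axis (index_of U) 1"

lemma index_of_gens_of [simp]: "index_of (gens_of I) = I"
  by (cases I) (auto simp: index_of_def gens_of_def)

lemma gens_of_index_of [simp]: "gens_of (index_of U) = U"
proof -
  have "x \<in> gens_of (index_of U) \<longleftrightarrow> x \<in> U" for x
    by (cases x) (auto simp: index_of_def gens_of_def)
  then show ?thesis by blast
qed

lemma index_of_eq_iff [simp]: "index_of U = index_of V \<longleftrightarrow> U = V"
  by (metis gens_of_index_of)

lemma card_gens_of: "card (gens_of (I :: 'b::finite set \<times> 'b set)) = card (fst I) + card (snd I)"
  by (simp add: gens_of_def card_Plus)

lemma basis_nth: "basis U $ I = (if gens_of I = U then 1 else 0)"
  by (auto simp: basis_def axis_def)

lemma axis_basis: "axis I 1 = basis (gens_of I)"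
  by (simp add: basis_def)

text \<open>
  A multilinear identity need only be checked on basis vectors; knowing that the basis vector occurs
  in the given vector lets the same induction serve for homogeneous cochains.
\<close>

lemma supported_induct [case_names zero axis add scale]:
  fixes a :: "'k::field^'n"
  assumes "P 0" "\<And>I. a $ I \<noteq> 0 \<Longrightarrow> P (axis I 1)"
    "\<And>a b. P a \<Longrightarrow> P b \<Longrightarrow> P (a + b)" "\<And>c a. P a \<Longrightarrow> P (c *s a)"
  shows "P a"
proof -
  have "P (\<Sum>I\<in>A. a $ I *s axis I 1)" if "finite A" for A
    using that
  proof (induction A)
    case (insert I A)
    have "P (a $ I *s axis I 1)"
      by (cases "a $ I = 0") (simp_all add: assms)
    then show ?case using insert by (simp add: assms)
  qed (simp add: assms)
  from this[of UNIV] show ?thesis by (simp add: basis_expansion)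
qed

lemma cochain_induct [case_names basis add scale]:
  fixes a :: "('k::field, 'b::{finite,linorder}) cochain"
  assumes "\<And>U. P (basis U)" "\<And>a b. P a \<Longrightarrow> P b \<Longrightarrow> P (a + b)" "\<And>c a. P a \<Longrightarrow> P (c *s a)"
  shows "P a"
proof (induction a rule: supported_induct)
  case zero
  have "P (0 *s basis {})" by (intro assms)
  then show ?case by simp
qed (simp_all add: assms axis_basis)

lemma reorder_sign_Un_left:
  "U \<inter> U' = {} \<Longrightarrow> reorder_sign (U \<union> U') V = reorder_sign U V * reorder_sign U' V"
  by (simp add: reorder_sign_def prod.union_disjoint)

lemma reorder_sign_Un_right:
  "V \<inter> V' = {} \<Longrightarrow> reorder_sign U (V \<union> V') = reorder_sign U V * reorder_sign U V'"
  by (simp add: reorder_sign_def prod.union_disjoint prod.distrib)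

lemma reorder_sign_insert_left:
  "g \<notin> U \<Longrightarrow> reorder_sign (insert g U) V = reorder_sign {g} V * reorder_sign U V"
  using reorder_sign_Un_left[of "{g}" U V] by simp

lemma reorder_sign_insert_right:
  "g \<notin> V \<Longrightarrow> reorder_sign U (insert g V) = reorder_sign U {g} * reorder_sign U V"
  using reorder_sign_Un_right[of "{g}" V U] by simp

lemma reorder_sign_empty [simp]: "reorder_sign {} V = 1" "reorder_sign U {} = 1"
  by (simp_all add: reorder_sign_def)

text \<open>
  Of two distinct generators exactly one order is an inversion, so every pair contributes \<open>-1\<close>
  to the product of the two signs.
\<close>

lemma reorder_sign_swap:
  assumes "U \<inter> V = {}"
  shows "reorder_sign U V * reorder_sign V U = (- 1 :: 'k::field) ^ (card U * card V)"
proof -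
  have swap: "(reorder_sign V U :: 'k) = (\<Prod>u\<in>U. \<Prod>v\<in>V. if gen_less u v then - 1 else 1)"
    unfolding reorder_sign_def by (rule prod.swap)
  have "(reorder_sign U V * reorder_sign V U :: 'k) =
      (\<Prod>u\<in>U. \<Prod>v\<in>V. (if gen_less v u then - 1 else 1) * (if gen_less u v then - 1 else 1))"
    unfolding swap unfolding reorder_sign_def by (simp only: prod.distrib)
  also have "\<dots> = (\<Prod>u\<in>U. \<Prod>v\<in>V. - 1)"
  proof (intro prod.cong refl)
    fix u v assume "u \<in> U" "v \<in> V"
    with assms have "u \<noteq> v" by blast
    then show "(if gen_less v u then - 1 else 1) * (if gen_less u v then - 1 else 1) = (- 1 :: 'k)"
      using gen_less_total[of u v] by simp
  qed
  also have "\<dots> = (- 1) ^ (card U * card V)"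
    by (simp add: mult.commute flip: power_mult)
  finally show ?thesis .
qed

lemma reorder_sign_square: "reorder_sign U V * reorder_sign U V = (1 :: 'k::field)"
proof -
  have "(reorder_sign U V * reorder_sign U V :: 'k) =
     (\<Prod>u\<in>U. \<Prod>v\<in>V. (if gen_less v u then - 1 else 1) * (if gen_less v u then - 1 else 1))"
    by (simp only: reorder_sign_def prod.distrib)
  also have "\<dots> = 1" by (intro prod.neutral ballI) auto
  finally show ?thesis .
qed

lemma shuffle_sign_eq_prod:
  "(shuffle_sign S T :: 'k::field) = (\<Prod>s\<in>S. \<Prod>t\<in>T. if t < s then - 1 else 1)"
proof -
  have "(\<Prod>s\<in>S. \<Prod>t\<in>T. if t < s then - 1 else 1) =
      (\<Prod>(s, t)\<in>S \<times> T. if t < s then - 1 else 1 :: 'k)"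
    by (rule prod.cartesian_product)
  also have "\<dots> = (\<Prod>p\<in>{p \<in> S \<times> T. snd p < fst p}. - 1)"
    by (subst prod.inter_filter) (auto simp: case_prod_beta)
  also have "{p \<in> S \<times> T. snd p < fst p} = {(s, t). s \<in> S \<and> t \<in> T \<and> t < s}"
    by auto
  finally show ?thesis by (simp add: shuffle_sign_def)
qed

text \<open>
  The third factor comes from moving the covectors of the second monomial to the left of the vectors
  of the first one; it is the sign in the definition of the product of cochains. Hence the cochains
  form the exterior algebra on all generators.
\<close>

lemma reorder_sign_gens_of:
  fixes S1 T1 S2 T2 :: "'b::{finite,linorder} set"
  shows "(reorder_sign (gens_of (S1, T1)) (gens_of (S2, T2)) :: 'k::field) =
    shuffle_sign S1 S2 * shuffle_sign T1 T2 * (- 1) ^ (card S2 * card T1)"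
proof -
  have Plus: "(\<Prod>u\<in>S <+> T. f u) = (\<Prod>i\<in>S. f (Inl i)) * (\<Prod>i\<in>T. f (Inr i))"
    for f :: "'b + 'b \<Rightarrow> 'k" and S T :: "'b set"
    by (simp add: prod.Plus)
  show ?thesis
    by (simp add: reorder_sign_def gens_of_def Plus shuffle_sign_eq_prod prod.distrib power_mult)
qed

lemma vee_add_left: "(a + b) \<or>\<^sub>C c = a \<or>\<^sub>C c + b \<or>\<^sub>C c"
  by (simp add: vee_def case_prod_beta algebra_simps vector_sadd_rdistrib sum.distrib)

lemma vee_add_right: "a \<or>\<^sub>C (b + c) = a \<or>\<^sub>C b + a \<or>\<^sub>C c"
  by (simp add: vee_def case_prod_beta algebra_simps vector_sadd_rdistrib sum.distrib)

lemma vector_scale_sum: "c *s (\<Sum>i\<in>A. f i) = (\<Sum>i\<in>A. c *s f i)" for f :: "_ \<Rightarrow> 'k::field^'n"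
  by (induction A rule: infinite_finite_induct) (simp_all add: vector_add_ldistrib)

lemma vee_scale_left: "(x *s a) \<or>\<^sub>C b = x *s (a \<or>\<^sub>C b)"
  by (simp add: vee_def case_prod_beta vector_scale_sum vector_smult_assoc mult.assoc)

lemma vee_scale_right: "a \<or>\<^sub>C (x *s b) = x *s (a \<or>\<^sub>C b)"
  by (simp add: vee_def case_prod_beta vector_scale_sum vector_smult_assoc mult_ac)

lemmas vee_linear = vee_add_left vee_add_right vee_scale_left vee_scale_right

lemma vee_zero [simp]: "0 \<or>\<^sub>C a = 0" "a \<or>\<^sub>C 0 = 0"
  using vee_scale_left[of 0 0 a] vee_scale_right[of a 0 0] by simp_all

lemma vee_minus: "(- a) \<or>\<^sub>C b = - (a \<or>\<^sub>C b)" "a \<or>\<^sub>C (- b) = - (a \<or>\<^sub>C b)"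
  using vee_scale_left[of "- 1" a b] vee_scale_right[of a "- 1" b] by simp_all

lemma vee_diff: "(a - b) \<or>\<^sub>C c = a \<or>\<^sub>C c - b \<or>\<^sub>C c" "a \<or>\<^sub>C (b - c) = a \<or>\<^sub>C b - a \<or>\<^sub>C c"
  using vee_add_left[of a "- b" c] vee_add_right[of a b "- c"] by (simp_all add: vee_minus)

lemma vee_sum: "(\<Sum>i\<in>A. f i) \<or>\<^sub>C b = (\<Sum>i\<in>A. f i \<or>\<^sub>C b)" "b \<or>\<^sub>C (\<Sum>i\<in>A. f i) = (\<Sum>i\<in>A. b \<or>\<^sub>C f i)"
  by (induction A rule: infinite_finite_induct) (simp_all add: vee_linear)

lemma sum_axis_scale:
  fixes f :: "'i::finite \<Rightarrow> 'k::field^'n"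
  shows "(\<Sum>i\<in>UNIV. (axis j 1 $ i * c i) *s f i) = c j *s f j"
proof -
  have "(\<Sum>i\<in>UNIV. (axis j 1 $ i * c i) *s f i) = (\<Sum>i\<in>UNIV. if i = j then c i *s f i else 0)"
    by (intro sum.cong) (auto simp: axis_def)
  then show ?thesis by simp
qed

lemma wedge_axis:
  "wedge (axis S 1) (axis T 1) =
    (if S \<inter> T = {} then shuffle_sign S T *s axis (S \<union> T) 1 else 0)"
proof -
  have "wedge (axis S 1) (axis T 1 :: ('a, 'b) ext) =
     (\<Sum>S'\<in>UNIV. \<Sum>T'\<in>UNIV. (axis S 1 $ S' * 1) *s ((axis T 1 $ T' * 1) *s
       (if S' \<inter> T' = {} then shuffle_sign S' T' *s axis (S' \<union> T') 1 else 0)))"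
    unfolding wedge_def by (intro sum.cong refl) (auto simp: vector_smult_assoc)
  also have "\<dots> = (\<Sum>S'\<in>UNIV. (axis S 1 $ S' * 1) *s (\<Sum>T'\<in>UNIV. (axis T 1 $ T' * 1) *s
       (if S' \<inter> T' = {} then shuffle_sign S' T' *s axis (S' \<union> T') 1 else 0)))"
    by (simp only: vector_scale_sum)
  finally show ?thesis by (simp only: sum_axis_scale) simp
qed

lemma tensor_axis: "tensor (c *s axis S 1) (d *s axis T 1) = (c * d) *s axis (S, T) 1"
  by (auto simp: tensor_def vec_eq_iff axis_def)

lemma vee_axis:
  "axis (S1, T1) 1 \<or>\<^sub>C axis (S2, T2) 1 =
    (if S1 \<inter> S2 = {} \<and> T1 \<inter> T2 = {}
     then (shuffle_sign S1 S2 * shuffle_sign T1 T2 * (- 1) ^ (card S2 * card T1))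
        *s axis (S1 \<union> S2, T1 \<union> T2) 1 else 0)"
proof -
  let ?f = "\<lambda>I J. (- 1) ^ (card (fst J) * card (snd I)) *s
    tensor (wedge (axis (fst I) 1) (axis (fst J) 1)) (wedge (axis (snd I) 1) (axis (snd J) 1))
     :: ('a, 'b) cochain"
  have "axis (S1, T1) 1 \<or>\<^sub>C axis (S2, T2) 1 =
     (\<Sum>I\<in>UNIV. (axis (S1, T1) 1 $ I * 1) *s (\<Sum>J\<in>UNIV. (axis (S2, T2) 1 $ J * 1) *s ?f I J))"
    unfolding vee_def case_prod_beta vector_scale_sum
    by (intro sum.cong refl) (simp add: vector_smult_assoc mult_ac)
  also have "\<dots> = ?f (S1, T1) (S2, T2)"
    by (simp only: sum_axis_scale) simp
  also have "\<dots> = (if S1 \<inter> S2 = {} \<and> T1 \<inter> T2 = {}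
     then (shuffle_sign S1 S2 * shuffle_sign T1 T2 * (- 1) ^ (card S2 * card T1))
        *s axis (S1 \<union> S2, T1 \<union> T2) 1 else 0)"
    by (auto simp: wedge_axis tensor_axis vector_smult_assoc mult_ac) (auto simp: tensor_def vec_eq_iff)
  finally show ?thesis .
qed

lemma vee_basis:
  "(basis U :: ('k::field, 'b::{finite,linorder}) cochain) \<or>\<^sub>C basis V = (if U \<inter> V = {} then reorder_sign U V *s basis (U \<union> V) else 0)"
proof -
  have "U \<inter> V = {} \<longleftrightarrow> Inl -` U \<inter> Inl -` V = {} \<and> Inr -` U \<inter> Inr -` V = {}"
    by (metis (no_types) vimage_Int vimage_empty Un_empty gens_of_index_of index_of_def gens_of_def
        Plus_def image_is_empty fst_conv snd_conv)
  moreover have "(reorder_sign U V :: 'k) = shuffle_sign (Inl -` U) (Inl -` V) * shuffle_sign (Inr -` U) (Inr -` V) *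
      (- 1) ^ (card (Inl -` V) * card (Inr -` U))"
    using reorder_sign_gens_of[of "Inl -` U" "Inr -` U" "Inl -` V" "Inr -` V"]
    by (metis gens_of_index_of index_of_def)
  ultimately show ?thesis
    by (simp add: basis_def index_of_def vee_axis)
qed

lemma vee_assoc: "(a \<or>\<^sub>C b) \<or>\<^sub>C c = a \<or>\<^sub>C (b \<or>\<^sub>C c)"
proof (induction a rule: cochain_induct)
  case (basis U)
  show ?case
  proof (induction b rule: cochain_induct)
    case (basis V)
    show ?case
    proof (induction c rule: cochain_induct)
      case (basis W)
      show ?case
        by (auto simp: vee_basis vee_linear vector_smult_assoc Un_assoc Int_Un_distrib Int_Un_distrib2
            reorder_sign_Un_left reorder_sign_Un_right)
    qed (simp_all add: vee_linear)
  qed (simp_all add: vee_linear)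
qed (simp_all add: vee_linear)

text \<open>
  Parity with respect to the total degree. A numerical \<open>n\<close> instead of a truth value allows it to be
  used directly in exponents of signs.
\<close>

definition has_parity :: "nat \<Rightarrow> ('k::field, 'b::{finite,linorder}) cochain \<Rightarrow> bool" where
  "has_parity n a \<longleftrightarrow> (\<forall>I. a $ I \<noteq> 0 \<longrightarrow> even (card (gens_of I) + n))"

lemma homogeneous_induct [consumes 1, case_names zero basis add scale]:
  fixes a :: "('k::field, 'b::{finite,linorder}) cochain"
  assumes "has_parity n a" "P 0" "\<And>U. even (card U + n) \<Longrightarrow> P (basis U)"
    "\<And>a b. P a \<Longrightarrow> P b \<Longrightarrow> P (a + b)" "\<And>c a. P a \<Longrightarrow> P (c *s a)"
  shows "P a"
proof (induction a rule: supported_induct)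
  case (axis I)
  with assms(1) have "even (card (gens_of I) + n)" unfolding has_parity_def by blast
  then show ?case by (simp add: assms axis_basis)
qed (simp_all add: assms)

lemma neg_one_power_cong: "even (m + n) \<Longrightarrow> (- 1 :: 'k::field) ^ m = (- 1) ^ n"
  by (metis even_add neg_one_even_power neg_one_odd_power)

text \<open>
  On basis elements the two products differ by \<open>reorder_sign_swap\<close>, whose exponent has the same
  parity for all basis elements that occur in \<open>a\<close> and \<open>b\<close>.
\<close>

lemma vee_supercommute:
  assumes "has_parity p a" "has_parity q b"
  shows "a \<or>\<^sub>C b = (- 1) ^ (p * q) *s (b \<or>\<^sub>C a)"
  using assms(1)
proof (induction a rule: homogeneous_induct)
  case (basis U)
  show ?case using assms(2)
  proof (induction b rule: homogeneous_induct)
    case (basis V)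
    have "reorder_sign U V = (- 1) ^ (p * q) * (reorder_sign V U :: 'a)" if "U \<inter> V = {}"
    proof -
      have "reorder_sign U V = reorder_sign U V * (reorder_sign V U * reorder_sign V U :: 'a)"
        by (simp add: reorder_sign_square)
      also have "\<dots> = (- 1) ^ (card U * card V) * reorder_sign V U"
        using reorder_sign_swap[OF that] by (metis mult.assoc)
      also have "(- 1 :: 'a) ^ (card U * card V) = (- 1) ^ (p * q)"
        using \<open>even (card U + p)\<close> \<open>even (card V + q)\<close> by (intro neg_one_power_cong) auto
      finally show ?thesis .
    qed
    then show ?case
      by (auto simp: vee_basis vector_smult_assoc Un_commute Int_commute)
  qed (simp_all add: vee_linear vector_add_ldistrib vector_smult_assoc mult.commute)
qed (simp_all add: vee_linear vector_add_ldistrib vector_smult_assoc mult.commute)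

text \<open>
  The algebra automorphism that is \<open>-1\<close> on generators. It carries the signs of an odd derivation
  passing an arbitrary, not necessarily homogeneous, element.
\<close>

definition parity_inv :: "('k::field, 'b::{finite,linorder}) cochain \<Rightarrow> ('k, 'b) cochain" where
  "parity_inv a = (\<chi> I. (- 1) ^ card (gens_of I) * a $ I)"

text \<open>
  The left derivative with respect to a generator: it moves the generator to the front of a monomial
  and deletes it.
\<close>

definition contract :: "'b + 'b \<Rightarrow> ('k::field, 'b::{finite,linorder}) cochain \<Rightarrow> ('k, 'b) cochain" where
  "contract g a = (\<chi> I. if g \<in> gens_of I then 0
     else reorder_sign {g} (gens_of I) * a $ index_of (insert g (gens_of I)))"

lemma parity_inv_linear:
  "parity_inv (a + b) = parity_inv a + parity_inv b" "parity_inv (c *s a) = c *s parity_inv a"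
  "parity_inv (- a) = - parity_inv a" "parity_inv 0 = 0"
  by (simp_all add: parity_inv_def vec_eq_iff algebra_simps)

lemma contract_linear:
  "contract g (a + b) = contract g a + contract g b" "contract g (c *s a) = c *s contract g a"
  "contract g (- a) = - contract g a" "contract g 0 = 0"
  by (simp_all add: contract_def vec_eq_iff algebra_simps)

lemma parity_inv_basis: "parity_inv (basis U) = (- 1) ^ card U *s basis U"
  by (auto simp: parity_inv_def vec_eq_iff basis_nth)

lemma contract_basis:
  "contract g (basis U) = (if g \<in> U then reorder_sign {g} (U - {g}) *s basis (U - {g}) else 0)"
  by (auto simp: contract_def vec_eq_iff basis_nth insert_Diff)

lemma parity_inv_homogeneous: "has_parity p a \<Longrightarrow> parity_inv a = (- 1) ^ p *s a"
  by (induction a rule: homogeneous_induct)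
     (auto simp: parity_inv_basis parity_inv_linear vector_add_ldistrib vector_smult_assoc mult.commute
        intro: arg_cong[OF neg_one_power_cong])

lemma parity_inv_inv [simp]: "parity_inv (parity_inv a) = a"
  by (simp add: parity_inv_def vec_eq_iff flip: mult.assoc power_mult_distrib)

lemma parity_inv_vee: "parity_inv (a \<or>\<^sub>C b) = parity_inv a \<or>\<^sub>C parity_inv b"
proof (induction a rule: cochain_induct)
  case (basis U)
  show ?case
  proof (induction b rule: cochain_induct)
    case (basis V)
    show ?case
      by (auto simp: vee_basis parity_inv_basis parity_inv_linear vee_linear vector_smult_assoc
          card_Un_disjoint power_add mult_ac)
  qed (simp_all add: vee_linear parity_inv_linear)
qed (simp_all add: vee_linear parity_inv_linear)

lemma parity_inv_contract: "parity_inv (contract g a) = - contract g (parity_inv a)"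
proof (induction a rule: cochain_induct)
  case (basis U)
  show ?case
  proof (cases "g \<in> U")
    case True
    then obtain V where "U = insert g V" "g \<notin> V" by (meson mk_disjoint_insert)
    then show ?thesis
      by (simp add: contract_basis parity_inv_basis parity_inv_linear contract_linear
          vector_smult_assoc mult.commute)
  qed (simp add: contract_basis parity_inv_basis parity_inv_linear contract_linear)
qed (simp_all add: parity_inv_linear contract_linear vec_eq_iff)

lemma contract_anticommute: "contract g (contract h a) = - contract h (contract g a)"
proof (induction a rule: cochain_induct)
  case (basis U)
  consider "g = h" | "g \<notin> U" | "h \<notin> U" | "g \<noteq> h" "g \<in> U" "h \<in> U" by blast
  then show ?case
  proof cases
    case 4
    define V where "V = U - {g, h}"
    have U: "U = insert g (insert h V)" "g \<notin> V" "h \<notin> V" using 4 by (auto simp: V_def)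
    have "reorder_sign {h} {g} = - (reorder_sign {g} {h} :: 'a)"
      using gen_less_total[OF 4(1)] by (auto simp: reorder_sign_def)
    moreover have "U - {h} = insert g V" "U - {g} = insert h V" "insert g V - {g} = V" "insert h V - {h} = V"
      using U 4(1) by auto
    ultimately show ?thesis
      using 4 by (simp add: contract_basis contract_linear vector_smult_assoc mult_ac
          reorder_sign_insert_right[OF U(2)] reorder_sign_insert_right[OF U(3)])
  qed (auto simp: contract_basis contract_linear)
qed (simp_all add: contract_linear vector_smult_rneg)

text \<open>
  The case in which \<open>g\<close> occurs in both factors is the delicate one: the product is zero, and the two
  terms on the right cancel because removing \<open>g\<close> from the first factor changes its degree by one.
\<close>

lemma contract_vee: "contract g (a \<or>\<^sub>C b) = contract g a \<or>\<^sub>C b + parity_inv a \<or>\<^sub>C contract g b"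
proof (induction a rule: cochain_induct)
  case (basis U)
  show ?case
  proof (induction b rule: cochain_induct)
    case (basis V)
    have swap: "reorder_sign W {g} * reorder_sign {g} W = ((- 1) ^ card W :: 'a)" if "g \<notin> W" for W
      using reorder_sign_swap[of W "{g}"] that by simp
    consider "g \<in> U" "g \<notin> V" | "g \<notin> U" "g \<in> V" | "g \<in> U" "g \<in> V" | "g \<notin> U" "g \<notin> V" by blast
    then show ?case
    proof cases
      case 1
      then obtain U' where U: "U = insert g U'" "g \<notin> U'" by (meson mk_disjoint_insert)
      have "reorder_sign {g} (U' \<union> V) = reorder_sign {g} U' * (reorder_sign {g} V :: 'a)"
        if "U' \<inter> V = {}" by (rule reorder_sign_Un_right[OF that])
      then show ?thesis using 1 U
        by (auto simp: vee_basis contract_basis contract_linear vee_linear vector_smult_assoc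
            reorder_sign_insert_left[OF U(2)] reorder_sign_square mult_ac)
    next
      case 2
      then obtain V' where V: "V = insert g V'" "g \<notin> V'" by (meson mk_disjoint_insert)
      have "reorder_sign U {g} * reorder_sign {g} (U \<union> V') =
          (- 1) ^ card U * (reorder_sign {g} V' :: 'a)" if "U \<inter> V' = {}"
        using swap[OF 2(1)] by (simp add: reorder_sign_Un_right[OF that] flip: mult.assoc)
      then show ?thesis using 2 V
        by (auto simp: vee_basis contract_basis contract_linear vee_linear vector_smult_assoc
            parity_inv_basis reorder_sign_insert_right[OF V(2), of U] mult_ac)
    next
      case 3
      then obtain U' where U: "U = insert g U'" "g \<notin> U'" by (meson mk_disjoint_insert)
      from 3 obtain V' where V: "V = insert g V'" "g \<notin> V'" by (meson mk_disjoint_insert)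
      have "reorder_sign {g} U' * reorder_sign U' (insert g V') =
          (reorder_sign U' {g} * reorder_sign {g} U') * (reorder_sign U' V' :: 'a)"
        by (simp add: reorder_sign_insert_right[OF V(2), of U'])
      then have left: "reorder_sign {g} U' * reorder_sign U' (insert g V') =
          (- 1) ^ card U' * (reorder_sign U' V' :: 'a)"
        by (simp only: swap[OF U(2)])
      have right: "reorder_sign {g} V' * reorder_sign (insert g U') V' = (reorder_sign U' V' :: 'a)"
        by (simp add: reorder_sign_insert_left[OF U(2)] reorder_sign_square flip: mult.assoc)
      have right': "reorder_sign {g} V' * (x * reorder_sign (insert g U') V') = x * (reorder_sign U' V' :: 'a)" for x
        by (metis right mult.left_commute)
      have "(insert g U' \<inter> V' = {}) = (U' \<inter> V' = {})" "(U' \<inter> insert g V' = {}) = (U' \<inter> V' = {})"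
        using U V by auto
      then show ?thesis using U V
        by (simp add: vee_basis contract_basis contract_linear vee_linear vector_smult_assoc
            parity_inv_basis left right' vee_minus vector_smult_rneg mult.assoc)
    qed (auto simp: vee_basis contract_basis contract_linear)
  qed (simp_all add: vee_linear contract_linear parity_inv_linear vector_add_ldistrib)
qed (simp_all add: vee_linear contract_linear parity_inv_linear vector_add_ldistrib)

section \<open>The super-bracket\<close>

definition dual_gen :: "'b + 'b \<Rightarrow> 'b + 'b" where
  "dual_gen g = (case g of Inl i \<Rightarrow> Inr i | Inr i \<Rightarrow> Inl i)"

lemma dual_gen_simps [simp]: "dual_gen (Inl i) = Inr i" "dual_gen (Inr i) = Inl i"
  by (simp_all add: dual_gen_def)

lemma dual_gen_dual_gen [simp]: "dual_gen (dual_gen g) = g"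
  by (cases g) simp_all

lemma sum_dual_gen: "(\<Sum>g\<in>UNIV. f (dual_gen g)) = (\<Sum>g\<in>UNIV. f g)"
  by (rule sum.reindex_bij_witness[of _ dual_gen dual_gen]) simp_all

text \<open>
  The Poisson bracket of the exterior algebra, for the symmetric pairing of each generator with its
  dual: a sum of right derivatives of the first argument times left derivatives of the second one,
  since \<open>parity_inv (contract g a)\<close> is the right derivative of \<open>a\<close>.
\<close>

definition contr_bracket ::
  "('k::field, 'b::{finite,linorder}) cochain \<Rightarrow> ('k, 'b) cochain \<Rightarrow> ('k, 'b) cochain" where
  "contr_bracket a b = (\<Sum>g\<in>UNIV. parity_inv (contract g a) \<or>\<^sub>C contract (dual_gen g) b)"

lemma contr_bracket_add:
  "contr_bracket (a + b) c = contr_bracket a c + contr_bracket b c"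
  "contr_bracket a (b + c) = contr_bracket a b + contr_bracket a c"
  by (simp_all add: contr_bracket_def contract_linear parity_inv_linear vee_linear sum.distrib)

lemma contr_bracket_scale:
  "contr_bracket (x *s a) b = x *s contr_bracket a b"
  "contr_bracket a (x *s b) = x *s contr_bracket a b"
  by (simp_all add: contr_bracket_def contract_linear parity_inv_linear vee_linear vector_scale_sum)

lemma contr_bracket_zero [simp]: "contr_bracket 0 a = 0" "contr_bracket a 0 = 0"
  using contr_bracket_scale(1)[of 0 0 a] contr_bracket_scale(2)[of a 0 0] by simp_all

lemma contr_bracket_minus: "contr_bracket (- a) b = - contr_bracket a b" "contr_bracket a (- b) = - contr_bracket a b"
  using contr_bracket_scale(1)[of "- 1" a b] contr_bracket_scale(2)[of a "- 1" b] by simp_all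

lemma contr_bracket_sum:
  "contr_bracket (\<Sum>i\<in>A. f i) b = (\<Sum>i\<in>A. contr_bracket (f i) b)"
  "contr_bracket b (\<Sum>i\<in>A. f i) = (\<Sum>i\<in>A. contr_bracket b (f i))"
  by (induction A rule: infinite_finite_induct) (simp_all add: contr_bracket_add)

lemma has_parity_linear:
  "has_parity n 0" "has_parity n a \<Longrightarrow> has_parity n b \<Longrightarrow> has_parity n (a + b)"
  "has_parity n a \<Longrightarrow> has_parity n (c *s a)"
  by (auto simp: has_parity_def) (metis add_0 add_cancel_right_right)+

lemma has_parity_sum: "(\<And>i. i \<in> A \<Longrightarrow> has_parity n (f i)) \<Longrightarrow> has_parity n (\<Sum>i\<in>A. f i)"
  by (induction A rule: infinite_finite_induct) (simp_all add: has_parity_linear)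

lemma has_parity_basis: "even (card U + n) \<Longrightarrow> has_parity n (basis U)"
  by (auto simp: has_parity_def basis_nth split: if_splits)

lemma has_parity_cong: "has_parity m a \<Longrightarrow> even (m + n) \<Longrightarrow> has_parity n a"
  unfolding has_parity_def by fastforce

lemma has_parity_contract: "has_parity n a \<Longrightarrow> has_parity (n + 1) (contract g a)"
proof (induction a rule: homogeneous_induct)
  case (basis U)
  show ?case
  proof (cases "g \<in> U")
    case True
    then obtain V where "U = insert g V" "g \<notin> V" by (meson mk_disjoint_insert)
    then show ?thesis
      using basis by (auto simp: contract_basis intro!: has_parity_linear has_parity_basis)
  qed (simp add: contract_basis has_parity_linear)
qed (simp_all add: contract_linear has_parity_linear)

lemma has_parity_parity_inv: "has_parity n a \<Longrightarrow> has_parity n (parity_inv a)"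
  by (auto simp: has_parity_def parity_inv_def)

lemma has_parity_vee:
  assumes "has_parity p a" "has_parity q b"
  shows "has_parity (p + q) (a \<or>\<^sub>C b)"
  using assms(1)
proof (induction a rule: homogeneous_induct)
  case (basis U)
  show ?case using assms(2)
  proof (induction b rule: homogeneous_induct)
    case (basis V)
    show ?case
      using basis \<open>even (card U + p)\<close>
      by (auto simp: vee_basis card_Un_disjoint has_parity_linear intro!: has_parity_linear(3) has_parity_basis)
  qed (simp_all add: vee_linear has_parity_linear)
qed (simp_all add: vee_linear has_parity_linear)

lemma has_parity_contr_bracket:
  assumes "has_parity p a" "has_parity q b"
  shows "has_parity (p + q) (contr_bracket a b)"
  unfolding contr_bracket_def
proof (rule has_parity_sum)
  fix g
  have "has_parity ((p + 1) + (q + 1)) (parity_inv (contract g a) \<or>\<^sub>C contract (dual_gen g) b)"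
    by (intro has_parity_vee has_parity_parity_inv has_parity_contract assms)
  then show "has_parity (p + q) (parity_inv (contract g a) \<or>\<^sub>C contract (dual_gen g) b)"
    by (rule has_parity_cong) simp
qed

text \<open>
  The right derivatives of a product satisfy a Leibniz rule, and the factor \<open>b\<close> is then moved to the
  left by supercommutativity.
\<close>

lemma contr_bracket_vee_left:
  assumes "has_parity p a" "has_parity q b"
  shows "contr_bracket (a \<or>\<^sub>C b) c =
    a \<or>\<^sub>C contr_bracket b c + (- 1) ^ (p * q) *s (b \<or>\<^sub>C contr_bracket a c)"
proof -
  have "parity_inv (contract g (a \<or>\<^sub>C b)) =
      a \<or>\<^sub>C parity_inv (contract g b) + (- 1) ^ (p * q) *s (b \<or>\<^sub>C parity_inv (contract g a))" for g
  proof -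
    have "has_parity (p + 1) (parity_inv (contract g a))"
      by (intro has_parity_parity_inv has_parity_contract assms)
    from vee_supercommute[OF this assms(2)]
    have "parity_inv (contract g a) \<or>\<^sub>C parity_inv b =
        ((- 1) ^ q * (- 1) ^ ((p + 1) * q)) *s (b \<or>\<^sub>C parity_inv (contract g a))"
      by (simp only: parity_inv_homogeneous[OF assms(2)] vee_linear vector_smult_assoc)
    also have "(- 1 :: 'a) ^ q * (- 1) ^ ((p + 1) * q) = (- 1) ^ (p * q)"
      unfolding power_add[symmetric] by (rule neg_one_power_cong) auto
    finally show ?thesis
      by (simp add: contract_vee parity_inv_linear parity_inv_vee add.commute)
  qed
  then show ?thesis
    by (simp add: contr_bracket_def vee_linear vee_assoc vee_sum sum.distrib vector_scale_sum)
qed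

lemma contr_bracket_vee_right:
  assumes "has_parity p c" "has_parity q a"
  shows "contr_bracket c (a \<or>\<^sub>C b) =
    contr_bracket c a \<or>\<^sub>C b + (- 1) ^ (p * q) *s (a \<or>\<^sub>C contr_bracket c b)"
proof -
  have "parity_inv (contract g c) \<or>\<^sub>C contract h (a \<or>\<^sub>C b) =
      (parity_inv (contract g c) \<or>\<^sub>C contract h a) \<or>\<^sub>C b +
      (- 1) ^ (p * q) *s (a \<or>\<^sub>C (parity_inv (contract g c) \<or>\<^sub>C contract h b))" for g h
  proof -
    have "has_parity (p + 1) (parity_inv (contract g c))"
      by (intro has_parity_parity_inv has_parity_contract assms)
    from vee_supercommute[OF this assms(2)]
    have "parity_inv (contract g c) \<or>\<^sub>C parity_inv a =
        ((- 1) ^ q * (- 1) ^ ((p + 1) * q)) *s (a \<or>\<^sub>C parity_inv (contract g c))"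
      by (simp only: parity_inv_homogeneous[OF assms(2)] vee_linear vector_smult_assoc)
    also have "(- 1 :: 'a) ^ q * (- 1) ^ ((p + 1) * q) = (- 1) ^ (p * q)"
      unfolding power_add[symmetric] by (rule neg_one_power_cong) auto
    finally have "(parity_inv (contract g c) \<or>\<^sub>C parity_inv a) \<or>\<^sub>C contract h b =
        (- 1) ^ (p * q) *s (a \<or>\<^sub>C (parity_inv (contract g c) \<or>\<^sub>C contract h b))"
      by (simp add: vee_linear vee_assoc)
    then show ?thesis
      by (simp add: contract_vee vee_linear vee_assoc)
  qed
  then show ?thesis
    by (simp add: contr_bracket_def vee_linear vee_assoc vee_sum sum.distrib vector_scale_sum)
qed

text \<open>
  Exchanging the two derivatives in each summand gives the sign; the sum is then reindexed along
  \<open>dual_gen\<close>, which is where the symmetry of the pairing enters.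
\<close>

lemma contr_bracket_skew:
  assumes "has_parity p a" "has_parity q b"
  shows "contr_bracket a b = (- ((- 1) ^ (p * q))) *s contr_bracket b a"
proof -
  have "parity_inv (contract (dual_gen g) a) \<or>\<^sub>C contract g b =
      (- ((- 1) ^ (p * q))) *s (parity_inv (contract g b) \<or>\<^sub>C contract (dual_gen g) a)" for g
  proof -
    have a: "has_parity (p + 1) (contract (dual_gen g) a)" and b: "has_parity (q + 1) (contract g b)"
      by (intro has_parity_contract assms)+
    have "parity_inv (contract (dual_gen g) a) \<or>\<^sub>C contract g b =
        ((- 1) ^ (p + 1) * (- 1) ^ ((p + 1) * (q + 1))) *s (contract g b \<or>\<^sub>C contract (dual_gen g) a)"
      by (simp only: parity_inv_homogeneous[OF a] vee_linear vee_supercommute[OF a b] vector_smult_assoc)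
    also have "contract g b \<or>\<^sub>C contract (dual_gen g) a =
        (- 1) ^ (q + 1) *s (parity_inv (contract g b) \<or>\<^sub>C contract (dual_gen g) a)"
      by (simp add: parity_inv_homogeneous[OF b] vee_linear vee_minus vector_smult_rneg vector_smult_assoc flip: power_mult_distrib)
    also have "((- 1) ^ (p + 1) * (- 1) ^ ((p + 1) * (q + 1))) *s \<dots> =
       (- 1) ^ ((p + 1) + (p + 1) * (q + 1) + (q + 1)) *s
        (parity_inv (contract g b) \<or>\<^sub>C contract (dual_gen g) a)"
      by (simp only: vector_smult_assoc power_add)
    also have "(- 1 :: 'a) ^ ((p + 1) + (p + 1) * (q + 1) + (q + 1)) = (- 1) ^ (p * q + 1)"
      by (rule neg_one_power_cong) auto
    finally show ?thesis by simp
  qed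
  then have "(\<Sum>g\<in>UNIV. parity_inv (contract (dual_gen g) a) \<or>\<^sub>C contract (dual_gen (dual_gen g)) b) =
      (- ((- 1) ^ (p * q))) *s contr_bracket b a"
    by (simp only: contr_bracket_def vector_scale_sum dual_gen_dual_gen)
  with sum_dual_gen[of "\<lambda>g. parity_inv (contract g a) \<or>\<^sub>C contract (dual_gen g) b"]
  show ?thesis by (simp only: contr_bracket_def[of a b])
qed

lemma parity_inv_contract_inv: "parity_inv (contract g (parity_inv a)) = - contract g a"
  by (simp add: parity_inv_contract)

text \<open>
  Derivatives anticommute with one another, so a further derivative acts on the bracket as an odd
  derivation.
\<close>

lemma contract_contr_bracket:
  "contract h (contr_bracket a b) =
    contr_bracket (contract h a) b + contr_bracket (parity_inv a) (contract h b)"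
proof -
  have sum: "contract h (\<Sum>g\<in>A. f g) = (\<Sum>g\<in>A. contract h (f g))" for A :: "('b + 'b) set" and f
    by (induction A rule: infinite_finite_induct) (simp_all add: contract_linear)
  have "contract h (parity_inv (contract g a) \<or>\<^sub>C contract k b) =
     parity_inv (contract g (contract h a)) \<or>\<^sub>C contract k b +
     parity_inv (contract g (parity_inv a)) \<or>\<^sub>C contract k (contract h b)" for g k
  proof -
    have "contract h (parity_inv (contract g a)) = parity_inv (contract g (contract h a))"
      by (metis contract_anticommute minus_minus parity_inv_contract parity_inv_linear(3))
    moreover have "contract h (contract k b) = - contract k (contract h b)"
      by (rule contract_anticommute)
    ultimately show ?thesis
      by (simp only: contract_vee parity_inv_inv parity_inv_contract_inv vee_minus)
  qed
  then show ?thesis by (simp add: contr_bracket_def sum sum.distrib)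
qed

text \<open>
  Expanding by \<open>contract_contr_bracket\<close> produces only three kinds of sums: derivatives of one argument
  against a bracket with a derivative of another one (\<open>X\<close> and \<open>Y\<close>), and first derivatives of \<open>a\<close> and
  \<open>b\<close> against a second derivative of \<open>c\<close> (\<open>Z\<close>). Up to sign, \<open>Z\<close> is the same for both iterated brackets
  with \<open>c\<close>, because derivatives anticommute.
\<close>

lemma contr_bracket_jacobi:
  assumes a: "has_parity p a" and b: "has_parity q b"
  shows "contr_bracket a (contr_bracket b c) =
    contr_bracket (contr_bracket a b) c + (- 1) ^ (p * q) *s contr_bracket b (contr_bracket a c)"
proof -
  let ?s = "\<lambda>n. (- 1 :: 'a) ^ n"
  let ?d = dual_gen
  have ca: "has_parity (p + 1) (contract g a)" and cb: "has_parity (q + 1) (contract g b)" for g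
    by (intro has_parity_contract assms)+
  have ia: "parity_inv (contract g a) = ?s (p + 1) *s contract g a"
    and ib: "parity_inv (contract g b) = ?s (q + 1) *s contract g b" for g
    by (intro parity_inv_homogeneous ca cb)+
  \<comment> \<open>The signs of \<open>parity_inv\<close> are pulled out of the three kinds of sums.\<close>
  define X where "X = (\<Sum>g\<in>UNIV. contract g a \<or>\<^sub>C contr_bracket (contract (?d g) b) c)"
  define Y where "Y = (\<Sum>g\<in>UNIV. contract g b \<or>\<^sub>C contr_bracket (contract (?d g) a) c)"
  define Z where "Z = (\<Sum>g\<in>UNIV. \<Sum>h\<in>UNIV.
      contract g a \<or>\<^sub>C contract h b \<or>\<^sub>C contract (?d h) (contract (?d g) c))"
  have expand: "contr_bracket u (contr_bracket v c) =
      ?s (m + 1) *s (\<Sum>g\<in>UNIV. contract g u \<or>\<^sub>C contr_bracket (contract (?d g) v) c) +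
      ?s m *s (\<Sum>g\<in>UNIV. \<Sum>h\<in>UNIV.
        contract g u \<or>\<^sub>C contract h v \<or>\<^sub>C contract (?d h) (contract (?d g) c))"
    if "has_parity m u" for m u v
  proof -
    have u: "parity_inv (contract g u) = ?s (m + 1) *s contract g u" for g
      using parity_inv_homogeneous[OF has_parity_contract[OF that]] .
    have "contr_bracket (parity_inv v) w = - (\<Sum>h\<in>UNIV. contract h v \<or>\<^sub>C contract (?d h) w)" for w
      by (simp add: contr_bracket_def parity_inv_contract_inv vee_minus sum_negf)
    then have "contr_bracket u (contr_bracket v c) = (\<Sum>g\<in>UNIV.
        ?s (m + 1) *s (contract g u \<or>\<^sub>C contr_bracket (contract (?d g) v) c) +
        ?s m *s (\<Sum>h\<in>UNIV. contract g u \<or>\<^sub>C contract h v \<or>\<^sub>C contract (?d h) (contract (?d g) c)))"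
      unfolding contr_bracket_def[of u] contract_contr_bracket u
      by (simp add: vee_linear vee_minus vee_sum vee_assoc vector_smult_rneg vee_diff vector_ssub_ldistrib
          vector_scale_sum sum_negf)
    then show ?thesis by (simp only: sum.distrib vector_scale_sum)
  qed
  have "contr_bracket (contr_bracket a b) c =
      (\<Sum>g\<in>UNIV. ?s (p + 1) *s contr_bracket (contract g a \<or>\<^sub>C contract (?d g) b) c)"
    by (simp only: contr_bracket_def[of a] ia contr_bracket_sum vee_linear contr_bracket_scale)
  also have "\<dots> = (\<Sum>g\<in>UNIV. ?s (p + 1) *s (contract g a \<or>\<^sub>C contr_bracket (contract (?d g) b) c) +
      ?s (p * q + q) *s (contract (?d g) b \<or>\<^sub>C contr_bracket (contract (?d (?d g)) a) c))"
  proof (intro sum.cong refl)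
    fix g
    have "?s (p + 1) * ?s ((p + 1) * (q + 1)) = ?s (p * q + q)"
      unfolding power_add[symmetric] by (rule neg_one_power_cong) auto
    then show "?s (p + 1) *s contr_bracket (contract g a \<or>\<^sub>C contract (?d g) b) c =
      ?s (p + 1) *s (contract g a \<or>\<^sub>C contr_bracket (contract (?d g) b) c) +
      ?s (p * q + q) *s (contract (?d g) b \<or>\<^sub>C contr_bracket (contract (?d (?d g)) a) c)"
      by (simp only: contr_bracket_vee_left[OF ca cb] vector_add_ldistrib vector_smult_assoc dual_gen_dual_gen)
  qed
  also have "\<dots> = ?s (p + 1) *s X + ?s (p * q + q) *s Y"
    unfolding sum.distrib X_def Y_def vector_scale_sum
    using sum_dual_gen[of "\<lambda>g. ?s (p * q + q) *s (contract g b \<or>\<^sub>C contr_bracket (contract (?d g) a) c)"]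
    by simp
  finally have 1: "contr_bracket (contr_bracket a b) c = ?s (p + 1) *s X + ?s (p * q + q) *s Y" .
  have "(\<Sum>g\<in>UNIV. \<Sum>h\<in>UNIV. contract g b \<or>\<^sub>C contract h a \<or>\<^sub>C contract (?d h) (contract (?d g) c)) =
      (\<Sum>h\<in>UNIV. \<Sum>g\<in>UNIV. contract g b \<or>\<^sub>C contract h a \<or>\<^sub>C contract (?d h) (contract (?d g) c))"
    by (rule sum.swap)
  also have "\<dots> = ?s (p * q + p + q) *s Z"
    unfolding Z_def vector_scale_sum
  proof (intro sum.cong refl)
    fix g h
    have "contract h b \<or>\<^sub>C contract g a = ?s ((q + 1) * (p + 1)) *s (contract g a \<or>\<^sub>C contract h b)"
      by (rule vee_supercommute[OF cb ca])
    moreover have "?s ((q + 1) * (p + 1)) = ?s (p * q + p + q + 1)"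
      by (rule neg_one_power_cong) auto
    ultimately show "contract h b \<or>\<^sub>C contract g a \<or>\<^sub>C contract (?d g) (contract (?d h) c) =
       ?s (p * q + p + q) *s (contract g a \<or>\<^sub>C contract h b \<or>\<^sub>C contract (?d h) (contract (?d g) c))"
      by (simp add: vee_linear vee_minus contract_anticommute[of "?d g" "?d h"])
  qed
  finally have 2: "contr_bracket b (contr_bracket a c) = ?s (q + 1) *s Y + ?s q *s (?s (p * q + p + q) *s Z)"
    unfolding expand[OF b] Y_def by simp
  have 3: "contr_bracket a (contr_bracket b c) = ?s (p + 1) *s X + ?s p *s Z"
    unfolding expand[OF a] X_def Z_def ..
  have "?s (p * q) * ?s (q + 1) = - ?s (p * q + q)"
    by (simp add: power_add)
  moreover have "?s (p * q) * (?s q * ?s (p * q + p + q)) = ?s p"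
    unfolding power_add[symmetric] by (rule neg_one_power_cong) auto
  ultimately show ?thesis
    by (simp add: 1 2 3 vector_add_ldistrib vector_smult_assoc)
qed

lemma basis_cochains:
  "int (card (Inl -` U)) = p \<Longrightarrow> int (card (Inr -` U)) = q \<Longrightarrow> basis U \<in> cochains p q"
  by (auto simp: cochains_def basis_def index_of_def axis_def)

lemma cochains_linear:
  "0 \<in> cochains p q" "a \<in> cochains p q \<Longrightarrow> b \<in> cochains p q \<Longrightarrow> a + b \<in> cochains p q"
  "a \<in> cochains p q \<Longrightarrow> c *s a \<in> cochains p q"
  by (auto simp: cochains_def) (metis add_0)+

lemma cochains_sum: "(\<And>i. i \<in> A \<Longrightarrow> f i \<in> cochains p q) \<Longrightarrow> (\<Sum>i\<in>A. f i) \<in> cochains p q"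
  by (induction A rule: infinite_finite_induct) (simp_all add: cochains_linear)

lemma cochains_induct [consumes 1, case_names zero basis add scale]:
  fixes a :: "('k::field, 'b::{finite,linorder}) cochain"
  assumes "a \<in> cochains p q" "P 0"
    "\<And>U. int (card (Inl -` U)) = p \<Longrightarrow> int (card (Inr -` U)) = q \<Longrightarrow> P (basis U)"
    "\<And>a b. P a \<Longrightarrow> P b \<Longrightarrow> P (a + b)" "\<And>c a. P a \<Longrightarrow> P (c *s a)"
  shows "P a"
proof (induction a rule: supported_induct)
  case (axis I)
  obtain S T where I: "I = (S, T)" by (cases I)
  with axis assms(1) have "int (card S) = p" "int (card T) = q" by (auto simp: cochains_def)
  moreover have "Inl -` gens_of I = S" "Inr -` gens_of I = T"
    using index_of_gens_of[of I] I by (auto simp: index_of_def)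
  ultimately show ?case using assms(3) by (simp add: axis_basis)
qed (simp_all add: assms)

lemma card_vimage_Inl_Inr: "card (Inl -` U) + card (Inr -` U) = card (U :: ('b::finite + 'b) set)"
  by (metis card_gens_of fst_conv snd_conv gens_of_index_of index_of_def)

lemma cochains_has_parity:
  assumes "a \<in> cochains (int p) (int q)"
  shows "has_parity (p + q) a"
  using assms
proof (induction a rule: cochains_induct)
  case (basis U)
  then show ?case using card_vimage_Inl_Inr[of U] by (intro has_parity_basis) simp
qed (simp_all add: has_parity_linear)

lemma vimage_remove_gen:
  fixes U :: "('b::finite + 'b) set"
  assumes "g \<in> U"
  shows "int (card (Inl -` (U - {g}))) = int (card (Inl -` U)) - (case g of Inl _ \<Rightarrow> 1 | Inr _ \<Rightarrow> 0)"
    and "int (card (Inr -` (U - {g}))) = int (card (Inr -` U)) - (case g of Inl _ \<Rightarrow> 0 | Inr _ \<Rightarrow> 1)"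
proof -
  have "Inl -` (U - {Inl i}) = Inl -` U - {i}" "Inr -` (U - {Inl i}) = Inr -` U"
    "Inl -` (U - {Inr i}) = Inl -` U" "Inr -` (U - {Inr i}) = Inr -` U - {i}" for i
    by auto
  moreover have "card S \<ge> 1" if "i \<in> S" for i and S :: "'b set"
    using that by (metis One_nat_def Suc_leI card_gt_0_iff empty_iff finite)
  ultimately show "int (card (Inl -` (U - {g}))) = int (card (Inl -` U)) - (case g of Inl _ \<Rightarrow> 1 | Inr _ \<Rightarrow> 0)"
    "int (card (Inr -` (U - {g}))) = int (card (Inr -` U)) - (case g of Inl _ \<Rightarrow> 0 | Inr _ \<Rightarrow> 1)"
    using assms by (cases g; fastforce simp: of_nat_diff)+
qed

text \<open>
  A generator and its dual are one covector and one vector, so each summand loses one of each.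
\<close>

lemma contr_bracket_cochains:
  assumes "a \<in> cochains p1 q1" "b \<in> cochains p2 q2"
  shows "contr_bracket a b \<in> cochains (p1 + p2 - 1) (q1 + q2 - 1)"
  using assms(1)
proof (induction a rule: cochains_induct)
  case (basis U)
  note U = basis
  show ?case using assms(2)
  proof (induction b rule: cochains_induct)
    case (basis V)
    show ?case unfolding contr_bracket_def
    proof (rule cochains_sum)
      fix g
      let ?W = "(U - {g}) \<union> (V - {dual_gen g})"
      have "basis ?W \<in> cochains (p1 + p2 - 1) (q1 + q2 - 1)"
        if "g \<in> U" "dual_gen g \<in> V" "(U - {g}) \<inter> (V - {dual_gen g}) = {}"
      proof (rule basis_cochains)
        have "card (Inl -` ?W) = card (Inl -` (U - {g})) + card (Inl -` (V - {dual_gen g}))"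
          "card (Inr -` ?W) = card (Inr -` (U - {g})) + card (Inr -` (V - {dual_gen g}))"
          unfolding vimage_Un using that(3) by (intro card_Un_disjoint; force)+
        then show "int (card (Inl -` ?W)) = p1 + p2 - 1" "int (card (Inr -` ?W)) = q1 + q2 - 1"
          using vimage_remove_gen[OF that(1)] vimage_remove_gen[OF that(2)] U basis
          by (cases g; simp)+
      qed
      then show "parity_inv (contract g (basis U)) \<or>\<^sub>C contract (dual_gen g) (basis V)
          \<in> cochains (p1 + p2 - 1) (q1 + q2 - 1)"
        by (auto simp: contract_basis parity_inv_linear parity_inv_basis vee_linear vee_basis
            cochains_linear(1) intro!: cochains_linear(3))
    qed
  qed (simp_all add: contr_bracket_add contr_bracket_scale cochains_linear)
qed (simp_all add: contr_bracket_add contr_bracket_scale cochains_linear)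

lemma vee_unit [simp]: "basis {} \<or>\<^sub>C a = a" "a \<or>\<^sub>C basis {} = a"
  by (induction a rule: cochain_induct) (simp_all add: vee_basis vee_linear)

lemma vee_gen_basis:
  "g \<notin> U \<Longrightarrow> basis (insert g U) = reorder_sign {g} U *s (basis {g} \<or>\<^sub>C basis U)"
  by (simp add: vee_basis vector_smult_assoc reorder_sign_square)

lemma contr_bracket_gen: "contr_bracket (basis {g}) a = contract (dual_gen g) a"
proof -
  have "contr_bracket (basis {g}) a = (\<Sum>h\<in>UNIV. if h = g then contract (dual_gen g) a else 0)"
    unfolding contr_bracket_def
    by (intro sum.cong) (auto simp: contract_basis parity_inv_linear parity_inv_basis)
  then show ?thesis by simp
qed

lemma contr_bracket_gen_gen:
  "contr_bracket (basis {g}) (basis {h}) = (if h = dual_gen g then basis {} else 0)"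
  by (auto simp: contr_bracket_gen contract_basis)

lemma of_vector_basis: "of_vector v = (\<Sum>i\<in>UNIV. v $ i *s basis {Inr i})"
  and of_covector_basis: "of_covector \<phi> = (\<Sum>i\<in>UNIV. \<phi> $ i *s basis {Inl i})"
  and of_scalar_basis: "of_scalar c = c *s basis {}"
  by (simp_all add: of_vector_def of_covector_def of_scalar_def axis_basis gens_of_def Plus_def)

lemma linear_smult_iff:
  fixes f :: "'k::field^'m \<Rightarrow> 'k^'n"
  shows "Vector_Spaces.linear (*s) (*s) f \<longleftrightarrow>
    (\<forall>x y. f (x + y) = f x + f y) \<and> (\<forall>c x. f (c *s x) = c *s f x)"
  by (simp add: Vector_Spaces.linear_iff vec.vector_space_axioms)

lemma is_super_bracket_contr_bracket:
  "is_super_bracket (contr_bracket :: ('k::field, 'b::{finite,linorder}) cochain \<Rightarrow> _)"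
proof -
  have gens: "contr_bracket (\<Sum>i\<in>UNIV. x i *s basis {f i}) (\<Sum>j\<in>UNIV. y j *s basis {f' j}) =
      (\<Sum>i\<in>UNIV. \<Sum>j\<in>UNIV. if f' j = dual_gen (f i) then (x i * y j) *s basis {} else 0)"
    for x y and f f' :: "'b \<Rightarrow> 'b + 'b"
    unfolding contr_bracket_sum(1) contr_bracket_scale(1)
    unfolding contr_bracket_sum(2) contr_bracket_scale(2) contr_bracket_gen_gen vector_scale_sum
    by (intro sum.cong refl) (simp add: vector_smult_assoc)
  have pairing: "(\<Sum>i\<in>UNIV. (x i * y i) *s basis {}) =
      (of_scalar (\<Sum>i\<in>UNIV. x i * y i) :: ('k, 'b) cochain)" for x y :: "'b \<Rightarrow> 'k"
    by (simp add: of_scalar_basis vec.scale_sum_left)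
  show ?thesis
    unfolding is_super_bracket_def linear_smult_iff of_vector_basis of_covector_basis
  proof (intro conjI allI ballI)
    fix \<phi> v :: "('k, 'b) vec"
    show "contr_bracket (\<Sum>i\<in>UNIV. \<phi> $ i *s basis {Inl i}) (\<Sum>i\<in>UNIV. v $ i *s basis {Inr i}) =
        of_scalar (\<Sum>i\<in>UNIV. \<phi> $ i * v $ i)"
      by (simp add: gens pairing)
    show "contr_bracket (\<Sum>i\<in>UNIV. v $ i *s basis {Inr i}) (\<Sum>i\<in>UNIV. \<phi> $ i *s basis {Inl i}) =
        of_scalar (\<Sum>i\<in>UNIV. \<phi> $ i * v $ i)"
      by (simp add: gens pairing) (simp add: mult.commute)
  next
    fix p1 q1 p2 q2 :: nat and a b :: "('k, 'b) cochain"
    assume "a \<in> cochains (int p1) (int q1)" "b \<in> cochains (int p2) (int q2)"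
    then show "contr_bracket a b = (- ((- 1) ^ ((p1 + q1) * (p2 + q2)))) *s contr_bracket b a"
      by (intro contr_bracket_skew cochains_has_parity)
  next
    fix p1 q1 p2 q2 :: nat and a b c :: "('k, 'b) cochain"
    assume "a \<in> cochains (int p1) (int q1)" "b \<in> cochains (int p2) (int q2)"
    then show "contr_bracket (a \<or>\<^sub>C b) c =
        a \<or>\<^sub>C contr_bracket b c + (- 1) ^ ((p1 + q1) * (p2 + q2)) *s (b \<or>\<^sub>C contr_bracket a c)"
      by (intro contr_bracket_vee_left cochains_has_parity)
  qed (simp_all add: contr_bracket_add contr_bracket_scale contr_bracket_cochains gens)
qed

text \<open>
  The Leibniz rule in the first argument together with skew-symmetry reduces every bracket to brackets
  of generators. Since the Leibniz rule is only given on the left, generators are first treated in the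
  second argument, then moved to the first one, and only then is the first argument built up.
\<close>

lemma is_super_bracket_unique:
  fixes br br' :: "('k::field, 'b::{finite,linorder}) cochain \<Rightarrow> ('k, 'b) cochain \<Rightarrow> ('k, 'b) cochain"
  assumes "is_super_bracket br" "is_super_bracket br'"
  shows "br = br'"
proof -
  have add: "br (a + b) c = br a c + br b c" "br c (a + b) = br c a + br c b"
    and scale: "br (x *s a) b = x *s br a b" "br a (x *s b) = x *s br a b"
    and skew: "br (basis U) (basis V) = (- ((- 1) ^ (card U * card V))) *s br (basis V) (basis U)"
    and leib: "br (basis U \<or>\<^sub>C basis V) c =
       basis U \<or>\<^sub>C br (basis V) c + (- 1) ^ (card U * card V) *s (basis V \<or>\<^sub>C br (basis U) c)"
    and gens: "br (basis {g}) (basis {h}) = (if h = dual_gen g then basis {} else 0)"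
    if br: "is_super_bracket br"
    for br :: "('k, 'b) cochain \<Rightarrow> ('k, 'b) cochain \<Rightarrow> ('k, 'b) cochain" and a b c x U V g h
  proof -
    show "br (a + b) c = br a c + br b c" "br c (a + b) = br c a + br c b"
      "br (x *s a) b = x *s br a b" "br a (x *s b) = x *s br a b"
      using br by (simp_all add: is_super_bracket_def linear_smult_iff)
    have U: "basis U \<in> cochains (int (card (Inl -` U))) (int (card (Inr -` U)))"
      for U :: "('b + 'b) set"
      by (simp add: basis_cochains)
    show "br (basis U) (basis V) = (- ((- 1) ^ (card U * card V))) *s br (basis V) (basis U)"
      using br U[of U] U[of V] unfolding is_super_bracket_def card_vimage_Inl_Inr[symmetric] by blast
    show "br (basis U \<or>\<^sub>C basis V) c =
       basis U \<or>\<^sub>C br (basis V) c + (- 1) ^ (card U * card V) *s (basis V \<or>\<^sub>C br (basis U) c)"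
      using br U[of U] U[of V] unfolding is_super_bracket_def card_vimage_Inl_Inr[symmetric] by blast
    have vec: "(basis {Inr i} :: ('k, 'b) cochain) = of_vector (axis i 1)"
      and cov: "(basis {Inl i} :: ('k, 'b) cochain) = of_covector (axis i 1)"
      for i :: 'b
      using sum_axis_scale[of i "\<lambda>_. 1" "\<lambda>i. basis {Inr i} :: ('k, 'b) cochain"]
        sum_axis_scale[of i "\<lambda>_. 1" "\<lambda>i. basis {Inl i} :: ('k, 'b) cochain"]
      by (simp_all add: of_vector_basis of_covector_basis)
    have pair: "(\<Sum>i\<in>UNIV. axis j 1 $ i * axis k 1 $ i) = (if j = k then 1 else 0 :: 'k)" for j k :: 'b
    proof -
      have "(\<Sum>i\<in>UNIV. axis j 1 $ i * axis k 1 $ i) = (\<Sum>i\<in>UNIV. if i = j then axis k 1 $ i else 0 :: 'k)"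
        by (intro sum.cong) (auto simp: axis_def)
      then show ?thesis by (simp add: axis_def)
    qed
    show "br (basis {g}) (basis {h}) = (if h = dual_gen g then basis {} else 0)"
    proof -
      have "br (of_vector v) (of_vector w) = 0" "br (of_covector v) (of_covector w) = 0"
        "br (of_covector v) (of_vector w) = of_scalar (\<Sum>i\<in>UNIV. v $ i * w $ i)"
        "br (of_vector w) (of_covector v) = of_scalar (\<Sum>i\<in>UNIV. v $ i * w $ i)" for v w
        using br unfolding is_super_bracket_def by blast+
      then show ?thesis
        by (cases g; cases h) (simp_all add: vec cov pair of_scalar_basis)
    qed
  qed
  have unit: "br (basis {}) c = 0" if "is_super_bracket br"
    for br :: "('k, 'b) cochain \<Rightarrow> ('k, 'b) cochain \<Rightarrow> ('k, 'b) cochain" and c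
    using leib[OF that, of "{}" "{}" c] by simp
  have gen_right: "br (basis U) (basis {g}) = br' (basis U) (basis {g})" for U g
  proof (induction U rule: finite_induct[OF finite])
    case (2 h U)
    then show ?case by (simp add: vee_gen_basis[OF 2(2)] leib scale gens assms)
  qed (simp add: unit assms)
  have gen_left: "br (basis {g}) b = br' (basis {g}) b" for g b
  proof (induction b rule: cochain_induct)
    case (basis U)
    show ?case by (simp only: skew[OF assms(1), of "{g}"] skew[OF assms(2), of "{g}"] gen_right)
  qed (simp_all add: add scale assms)
  have basis: "br (basis U) b = br' (basis U) b" for U b
  proof (induction U rule: finite_induct[OF finite])
    case (2 h U)
    then show ?case by (simp add: vee_gen_basis[OF 2(2)] leib scale gen_left assms)
  qed (simp add: unit assms)
  have "br a b = br' a b" for a b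
    by (induction a rule: cochain_induct) (simp_all add: basis add scale assms)
  then show ?thesis by (intro ext)
qed

lemma super_bracket_eq: "super_bracket = contr_bracket"
  unfolding super_bracket_def
  by (rule the_equality) (rule is_super_bracket_contr_bracket, rule is_super_bracket_unique[OF _ is_super_bracket_contr_bracket])

section \<open>Even cohomology\<close>

definition component :: "int \<Rightarrow> int \<Rightarrow> ('k::field, 'b::{finite,linorder}) cochain \<Rightarrow> ('k, 'b) cochain" where
  "component p q a = (\<chi> I. if int (card (fst I)) = p \<and> int (card (snd I)) = q then a $ I else 0)"

lemma component_linear:
  "component p q (a + b) = component p q a + component p q b" "component p q (c *s a) = c *s component p q a"
  "component p q 0 = 0"
  by (simp_all add: component_def vec_eq_iff)

lemma component_cochains: "component p q a \<in> cochains p q"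
  by (simp add: component_def cochains_def)

lemma component_of_cochains:
  assumes "a \<in> cochains p q"
  shows "component p' q' a = (if p' = p \<and> q' = q then a else 0)"
proof -
  have "a $ I = 0" if "\<not> (int (card (fst I)) = p \<and> int (card (snd I)) = q)" for I
    using assms that by (cases I) (auto simp: cochains_def)
  then show ?thesis by (auto simp: component_def vec_eq_iff)
qed

text \<open>
  A map of bidegree \<open>(1,0)\<close> commutes with taking homogeneous components. This turns the sums over
  bidegrees that define the even cohomology into conditions on the total parity.
\<close>

lemma component_graded_map:
  fixes D :: "('k::field, 'b::{finite,linorder}) cochain \<Rightarrow> ('k, 'b) cochain"
  assumes "Vector_Spaces.linear (*s) (*s) D" "\<And>p q a. a \<in> cochains p q \<Longrightarrow> D a \<in> cochains (p + 1) q"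
  shows "component (p + 1) q (D a) = D (component p q a)"
proof -
  have D: "D (a + b) = D a + D b" "D (c *s a) = c *s D a" for a b c
    using assms(1) by (simp_all add: linear_smult_iff)
  have "D 0 = 0" using D(2)[of 0 0] by simp
  then show ?thesis
  proof (induction a rule: cochain_induct)
    case (basis U)
    have "(basis U :: ('k, 'b) cochain) \<in> cochains (int (card (Inl -` U))) (int (card (Inr -` U)))"
      by (simp add: basis_cochains)
    from component_of_cochains[OF this] component_of_cochains[OF assms(2)[OF this]] \<open>D 0 = 0\<close>
    show ?case by auto
  qed (simp_all add: D component_linear)
qed

lemma sum_components:
  fixes a :: "('k::field, 'b::{finite,linorder}) cochain"
  assumes "has_parity 0 a"
  shows "(\<Sum>(p, q) \<in> {(p, q) \<in> {0..int CARD('b)} \<times> {0..int CARD('b)}. even (p + q)}. component p q a) = a"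
proof (rule vec_eq_iff[THEN iffD2], rule allI)
  fix I :: "'b set \<times> 'b set"
  let ?R = "{(p, q) \<in> {0..int CARD('b)} \<times> {0..int CARD('b)}. even (p + q)}"
  let ?i = "(int (card (fst I)), int (card (snd I)))"
  have R: "finite ?R"
    by (rule finite_subset[of _ "{0..int CARD('b)} \<times> {0..int CARD('b)}"]) auto
  have "(\<Sum>(p, q) \<in> ?R. component p q a) $ I = (\<Sum>r\<in>?R. if r = ?i then a $ I else 0)"
    unfolding sum_component by (intro sum.cong) (auto simp: component_def split: if_splits)
  also have "\<dots> = (if ?i \<in> ?R then a $ I else 0)"
    using R by simp
  also have "\<dots> = a $ I"
    using assms by (cases I) (auto simp: has_parity_def card_gens_of card_mono)
  finally show "(\<Sum>(p, q) \<in> ?R. component p q a) $ I = a $ I" .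
qed

lemma has_parity_of_bidegree:
  assumes "a \<in> cochains p q" "even (p + q + int n)"
  shows "has_parity n a"
  unfolding has_parity_def
proof (intro allI impI)
  fix I assume "a $ I \<noteq> 0"
  with assms(1) have "int (card (fst I)) = p" "int (card (snd I)) = q"
    by (cases I; auto simp: cochains_def)+
  with assms(2) have "even (int (card (gens_of I) + n))"
    by (simp add: card_gens_of)
  then show "even (card (gens_of I) + n)" by presburger
qed

context
  fixes lb :: "('k::field, 'b::{finite,linorder}) vec \<Rightarrow> ('k, 'b) vec \<Rightarrow> ('k, 'b) vec"
begin

lemma lie_cochain_degree: "lie_cochain lb \<in> cochains 2 1"
proof -
  have "axis ({i, j}, {k}) 1 \<in> cochains 2 1" if "i < j" for i j k :: 'b
    using that by (auto simp: cochains_def axis_def)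
  then show ?thesis
    unfolding lie_cochain_def by (auto intro!: cochains_sum cochains_linear)
qed

lemma ce_diff_eq: "ce_diff lb = contr_bracket (lie_cochain lb)"
  by (simp add: ce_diff_def super_bracket_eq)

lemma lie_cochain_parity: "has_parity 1 (lie_cochain lb)"
  by (rule has_parity_of_bidegree[OF lie_cochain_degree]) simp

lemma ce_diff_linear:
  "ce_diff lb (a + b) = ce_diff lb a + ce_diff lb b" "ce_diff lb (c *s a) = c *s ce_diff lb a"
  "ce_diff lb 0 = 0" "ce_diff lb (- a) = - ce_diff lb a" "ce_diff lb (a - b) = ce_diff lb a - ce_diff lb b"
  using contr_bracket_add(2)[of "lie_cochain lb" a "- b"]
  by (simp_all add: ce_diff_eq contr_bracket_add contr_bracket_scale contr_bracket_minus)

lemma ce_diff_sum: "ce_diff lb (\<Sum>i\<in>A. f i) = (\<Sum>i\<in>A. ce_diff lb (f i))"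
  by (simp add: ce_diff_eq contr_bracket_sum)

lemma ce_diff_degree: "a \<in> cochains p q \<Longrightarrow> ce_diff lb a \<in> cochains (p + 1) q"
  using contr_bracket_cochains[OF lie_cochain_degree, of a p q] by (simp add: ce_diff_eq add.commute)

lemma ce_diff_parity: "has_parity n a \<Longrightarrow> has_parity (n + 1) (ce_diff lb a)"
  using has_parity_contr_bracket[OF lie_cochain_parity, of n a] by (simp add: ce_diff_eq)

lemma component_ce_diff: "component (p + 1) q (ce_diff lb a) = ce_diff lb (component p q a)"
  by (rule component_graded_map) (simp_all add: linear_smult_iff ce_diff_linear ce_diff_degree)

text \<open>
  The differential is bracketing with an odd element: the Leibniz rule makes it a derivation of the
  product, and the Jacobi identity makes it one of the bracket.
\<close>

lemma ce_diff_vee: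
  assumes "has_parity p a"
  shows "ce_diff lb (a \<or>\<^sub>C b) = ce_diff lb a \<or>\<^sub>C b + (- 1) ^ p *s (a \<or>\<^sub>C ce_diff lb b)"
  using contr_bracket_vee_right[OF lie_cochain_parity assms] by (simp add: ce_diff_eq)

lemma ce_diff_bracket:
  assumes "has_parity p a"
  shows "ce_diff lb (contr_bracket a b) = contr_bracket (ce_diff lb a) b + (- 1) ^ p *s contr_bracket a (ce_diff lb b)"
  using contr_bracket_jacobi[OF lie_cochain_parity assms] by (simp add: ce_diff_eq)

definition even_cocycles :: "('k, 'b) cochain set" where
  "even_cocycles = {a. has_parity 0 a \<and> ce_diff lb a = 0}"

definition even_coboundaries :: "('k, 'b) cochain set" where
  "even_coboundaries = ce_diff lb ` {c. has_parity 1 c}"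

lemma even_sum_cocycles: "even_sum (cocycles lb) = even_cocycles"
proof (intro equalityI subsetI)
  fix a assume "a \<in> even_sum (cocycles lb)"
  then obtain f where f: "\<forall>p q. f p q \<in> cocycles lb p q"
    and a: "a = (\<Sum>(p, q) \<in> {(p, q) \<in> {0..int CARD('b)} \<times> {0..int CARD('b)}. even (p + q)}. f p q)"
    by (auto simp: even_sum_def)
  have f: "f p q \<in> cochains p q" "ce_diff lb (f p q) = 0" for p q
    using f by (auto simp: cocycles_def)
  have "has_parity 0 a"
    unfolding a by (intro has_parity_sum) (auto intro: has_parity_of_bidegree[OF f(1)])
  moreover have "ce_diff lb a = 0"
    unfolding a ce_diff_sum by (intro sum.neutral) (auto simp: f)
  ultimately show "a \<in> even_cocycles" by (simp add: even_cocycles_def)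
next
  fix a assume a: "a \<in> even_cocycles"
  have "component p q a \<in> cocycles lb p q" for p q
    using a component_ce_diff[of p q a]
    by (simp add: cocycles_def component_cochains even_cocycles_def component_linear)
  then show "a \<in> even_sum (cocycles lb)"
    using a sum_components[of a] unfolding even_sum_def even_cocycles_def
    by (auto intro!: exI[of _ "\<lambda>p q. component p q a"])
qed

lemma even_sum_coboundaries: "even_sum (coboundaries lb) = even_coboundaries"
proof (intro equalityI subsetI)
  fix a assume "a \<in> even_sum (coboundaries lb)"
  then obtain f where f: "\<forall>p q. f p q \<in> coboundaries lb p q"
    and a: "a = (\<Sum>(p, q) \<in> {(p, q) \<in> {0..int CARD('b)} \<times> {0..int CARD('b)}. even (p + q)}. f p q)"
    by (auto simp: even_sum_def)
  from f have "\<forall>p q. \<exists>c. c \<in> cochains (p - 1) q \<and> f p q = ce_diff lb c"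
    by (auto simp: coboundaries_def)
  then obtain c where c: "\<And>p q. c p q \<in> cochains (p - 1) q" "\<And>p q. f p q = ce_diff lb (c p q)"
    by metis
  let ?c = "\<Sum>(p, q) \<in> {(p, q) \<in> {0..int CARD('b)} \<times> {0..int CARD('b)}. even (p + q)}. c p q"
  have "has_parity 1 ?c"
    by (intro has_parity_sum) (auto intro: has_parity_of_bidegree[OF c(1)])
  moreover have "ce_diff lb ?c = a"
    unfolding a ce_diff_sum by (intro sum.cong) (auto simp: c(2))
  ultimately show "a \<in> even_coboundaries" by (auto simp: even_coboundaries_def)
next
  fix a assume "a \<in> even_coboundaries"
  then obtain c where c: "has_parity 1 c" "a = ce_diff lb c" by (auto simp: even_coboundaries_def)
  have "component p q a \<in> coboundaries lb p q" for p q
    using component_ce_diff[of "p - 1" q c] c(2) component_cochains[of "p - 1" q c]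
    by (auto simp: coboundaries_def)
  moreover have "has_parity 0 a"
    using has_parity_cong[OF ce_diff_parity[OF c(1)], of 0] c(2) by simp
  ultimately show "a \<in> even_sum (coboundaries lb)"
    using sum_components[of a] unfolding even_sum_def
    by (auto intro!: exI[of _ "\<lambda>p q. component p q a"])
qed

definition coset :: "('k, 'b) cochain \<Rightarrow> ('k, 'b) cochain set" where
  "coset a = (\<lambda>b. a + b) ` even_coboundaries"

lemma even_coboundaries_linear:
  "0 \<in> even_coboundaries"
  "a \<in> even_coboundaries \<Longrightarrow> b \<in> even_coboundaries \<Longrightarrow> a + b \<in> even_coboundaries"
  "a \<in> even_coboundaries \<Longrightarrow> x *s a \<in> even_coboundaries"
  "a \<in> even_coboundaries \<Longrightarrow> b \<in> even_coboundaries \<Longrightarrow> a - b \<in> even_coboundaries"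
proof -
  have neg: "has_parity n (- c)" if "has_parity n c" for n and c :: "('k, 'b) cochain"
    using that by (simp add: has_parity_def)
  show "0 \<in> even_coboundaries"
    unfolding even_coboundaries_def
    by (rule image_eqI[where x = 0]) (simp_all add: ce_diff_linear has_parity_linear)
  show "a + b \<in> even_coboundaries" if "a \<in> even_coboundaries" "b \<in> even_coboundaries" for a b
    using that unfolding even_coboundaries_def
    by (auto simp: has_parity_linear simp flip: ce_diff_linear)
  show "x *s a \<in> even_coboundaries" if "a \<in> even_coboundaries" for a
    using that unfolding even_coboundaries_def
    by (auto simp: has_parity_linear simp flip: ce_diff_linear)
  show "a - b \<in> even_coboundaries" if "a \<in> even_coboundaries" "b \<in> even_coboundaries" for a b
    using that unfolding even_coboundaries_def
    by (auto simp: has_parity_linear neg diff_conv_add_uminus simp flip: ce_diff_linear simp del: add_uminus_conv_diff)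
qed

lemma mem_coset: "x \<in> coset a \<longleftrightarrow> x - a \<in> even_coboundaries"
  unfolding coset_def by (auto intro!: image_eqI[where x = "x - a"])

lemma coset_eq_iff: "coset a = coset b \<longleftrightarrow> a - b \<in> even_coboundaries"
proof
  assume "coset a = coset b"
  moreover have "a \<in> coset a" by (simp add: mem_coset even_coboundaries_linear)
  ultimately show "a - b \<in> even_coboundaries" by (simp add: mem_coset)
next
  assume ab: "a - b \<in> even_coboundaries"
  show "coset a = coset b"
  proof (intro set_eqI)
    fix x
    have "(x - a) + (a - b) = x - b" "(x - b) - (a - b) = x - a" by simp_all
    then show "x \<in> coset a \<longleftrightarrow> x \<in> coset b"
      unfolding mem_coset using ab even_coboundaries_linear(2,4) by metis
  qed
qed

lemma union_cosets1:
  assumes "\<And>x. x \<in> coset a \<Longrightarrow> f x - f a \<in> even_coboundaries"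
  shows "(\<Union>x\<in>coset a. coset (f x)) = coset (f a)"
proof -
  have "a \<in> coset a" by (simp add: mem_coset even_coboundaries_linear)
  moreover have "coset (f x) = coset (f a)" if "x \<in> coset a" for x
    using assms[OF that] by (simp add: coset_eq_iff)
  ultimately show ?thesis by blast
qed

lemma union_cosets2:
  assumes "\<And>x y. x \<in> coset a \<Longrightarrow> y \<in> coset b \<Longrightarrow> f x y - f a b \<in> even_coboundaries"
  shows "(\<Union>x\<in>coset a. \<Union>y\<in>coset b. coset (f x y)) = coset (f a b)"
proof -
  have "a \<in> coset a" "b \<in> coset b" by (simp_all add: mem_coset even_coboundaries_linear)
  moreover have "coset (f x y) = coset (f a b)" if "x \<in> coset a" "y \<in> coset b" for x y
    using assms[OF that] by (simp add: coset_eq_iff)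
  ultimately show ?thesis by blast
qed

text \<open>
  For a cocycle \<open>z\<close>, both \<open>d c \<or> z = d (c \<or> z)\<close> and \<open>{d c, z} = d {c, z}\<close> by the derivation rules.
\<close>

lemma coboundary_ideal:
  assumes b: "b \<in> even_coboundaries" and z: "z \<in> even_cocycles"
  shows "b \<or>\<^sub>C z \<in> even_coboundaries" "z \<or>\<^sub>C b \<in> even_coboundaries"
    "contr_bracket b z \<in> even_coboundaries" "contr_bracket z b \<in> even_coboundaries"
proof -
  from b obtain c where c: "has_parity 1 c" "b = ce_diff lb c" by (auto simp: even_coboundaries_def)
  from z have z: "has_parity 0 z" "ce_diff lb z = 0" by (auto simp: even_cocycles_def)
  have odd: "has_parity 1 (c \<or>\<^sub>C z)" "has_parity 1 (z \<or>\<^sub>C c)"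
    "has_parity 1 (contr_bracket c z)" "has_parity 1 (contr_bracket z c)"
    using has_parity_vee[OF c(1) z(1)] has_parity_vee[OF z(1) c(1)]
      has_parity_contr_bracket[OF c(1) z(1)] has_parity_contr_bracket[OF z(1) c(1)] by simp_all
  have "b \<or>\<^sub>C z = ce_diff lb (c \<or>\<^sub>C z)" "z \<or>\<^sub>C b = ce_diff lb (z \<or>\<^sub>C c)"
    "contr_bracket b z = ce_diff lb (contr_bracket c z)"
    "contr_bracket z b = ce_diff lb (contr_bracket z c)"
    using c z by (simp_all add: ce_diff_vee[OF c(1)] ce_diff_vee[OF z(1)] ce_diff_bracket[OF c(1)]
        ce_diff_bracket[OF z(1)])
  with odd show "b \<or>\<^sub>C z \<in> even_coboundaries" "z \<or>\<^sub>C b \<in> even_coboundaries"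
    "contr_bracket b z \<in> even_coboundaries" "contr_bracket z b \<in> even_coboundaries"
    unfolding even_coboundaries_def by blast+
qed

lemma HE_carrier: "carrier (HE lb) = coset ` even_cocycles"
  and HE_zero: "zero (HE lb) = coset 0"
  by (simp_all add: HE_def Let_def even_sum_cocycles even_sum_coboundaries coset_def)

lemma HE_add: "add (HE lb) (coset a) (coset b) = coset (a + b)"
proof -
  have "add (HE lb) (coset a) (coset b) = (\<Union>x\<in>coset a. \<Union>y\<in>coset b. coset (x + y))"
    by (simp add: HE_def Let_def even_sum_coboundaries coset_def)
  also have "\<dots> = coset (a + b)"
  proof (rule union_cosets2)
    fix x y assume "x \<in> coset a" "y \<in> coset b"
    then show "x + y - (a + b) \<in> even_coboundaries"
      using even_coboundaries_linear(2)[of "x - a" "y - b"] by (simp add: mem_coset algebra_simps)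
  qed
  finally show ?thesis .
qed

lemma HE_smult: "smult (HE lb) c (coset a) = coset (c *s a)"
proof -
  have "smult (HE lb) c (coset a) = (\<Union>x\<in>coset a. coset (c *s x))"
    by (simp add: HE_def Let_def even_sum_coboundaries coset_def)
  also have "\<dots> = coset (c *s a)"
    by (rule union_cosets1)
       (use even_coboundaries_linear(3) in \<open>fastforce simp: mem_coset simp flip: vector_ssub_ldistrib\<close>)
  finally show ?thesis .
qed

text \<open>
  Changing both representatives produces a term with two coboundaries; it is covered by
  \<open>coboundary_ideal\<close> once coboundaries are cocycles.
\<close>

lemma HE_mult_bracket:
  assumes sub: "even_coboundaries \<subseteq> even_cocycles"
    and a: "a \<in> even_cocycles" and b: "b \<in> even_cocycles"
  shows "mult (HE lb) (coset a) (coset b) = coset (a \<or>\<^sub>C b)"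
    and "bracket (HE lb) (coset a) (coset b) = coset (contr_bracket a b)"
proof -
  have mult: "x \<or>\<^sub>C y - a \<or>\<^sub>C b \<in> even_coboundaries"
    and bracket: "contr_bracket x y - contr_bracket a b \<in> even_coboundaries"
    if "x \<in> coset a" "y \<in> coset b" for x y
  proof -
    define u v where "u = x - a" and "v = y - b"
    have uv: "u \<in> even_coboundaries" "v \<in> even_coboundaries"
      using that by (simp_all add: mem_coset u_def v_def)
    have xy: "x = a + u" "y = b + v" by (simp_all add: u_def v_def)
    have v: "v \<in> even_cocycles" using uv sub by blast
    have "x \<or>\<^sub>C y - a \<or>\<^sub>C b = a \<or>\<^sub>C v + (u \<or>\<^sub>C b + u \<or>\<^sub>C v)"
      by (simp add: xy vee_linear algebra_simps)
    then show "x \<or>\<^sub>C y - a \<or>\<^sub>C b \<in> even_coboundaries"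
      using coboundary_ideal[OF uv(2) a] coboundary_ideal[OF uv(1) b] coboundary_ideal[OF uv(1) v]
      by (simp add: even_coboundaries_linear)
    have "contr_bracket x y - contr_bracket a b =
        contr_bracket a v + (contr_bracket u b + contr_bracket u v)"
      by (simp add: xy contr_bracket_add algebra_simps)
    then show "contr_bracket x y - contr_bracket a b \<in> even_coboundaries"
      using coboundary_ideal[OF uv(2) a] coboundary_ideal[OF uv(1) b] coboundary_ideal[OF uv(1) v]
      by (simp add: even_coboundaries_linear)
  qed
  have "mult (HE lb) (coset a) (coset b) = (\<Union>x\<in>coset a. \<Union>y\<in>coset b. coset (x \<or>\<^sub>C y))"
    by (simp add: HE_def Let_def even_sum_coboundaries coset_def)
  also have "\<dots> = coset (a \<or>\<^sub>C b)" by (rule union_cosets2) (rule mult)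
  finally show "mult (HE lb) (coset a) (coset b) = coset (a \<or>\<^sub>C b)" .
  have "bracket (HE lb) (coset a) (coset b) = (\<Union>x\<in>coset a. \<Union>y\<in>coset b. coset (contr_bracket x y))"
    by (simp add: HE_def Let_def even_sum_coboundaries coset_def super_bracket_eq)
  also have "\<dots> = coset (contr_bracket a b)" by (rule union_cosets2) (rule bracket)
  finally show "bracket (HE lb) (coset a) (coset b) = coset (contr_bracket a b)" .
qed

end

text \<open>
  Elements of the target are images, so each axiom there is the image of the same axiom in the source.
  Applied to the even cohomology this avoids proving the axioms there separately.
\<close>

lemma poisson_algebra_transport:
  fixes P :: "('k::field, 'a) poisson_struct" and Q :: "('k, 'b) poisson_struct"
  assumes "poisson_algebra P" and carrier: "carrier Q = f ` carrier P" and zero: "zero Q = f (zero P)"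
    and hom: "\<And>x y. x \<in> carrier P \<Longrightarrow> y \<in> carrier P \<Longrightarrow> add Q (f x) (f y) = f (add P x y)"
      "\<And>c x. x \<in> carrier P \<Longrightarrow> smult Q c (f x) = f (smult P c x)"
      "\<And>x y. x \<in> carrier P \<Longrightarrow> y \<in> carrier P \<Longrightarrow> mult Q (f x) (f y) = f (mult P x y)"
      "\<And>x y. x \<in> carrier P \<Longrightarrow> y \<in> carrier P \<Longrightarrow> bracket Q (f x) (f y) = f (bracket P x y)"
  shows "poisson_algebra Q"
proof -
  interpret P: poisson_algebra P by fact
  note closed = P.zero_closed P.add_closed P.smult_closed P.mult_closed P.bracket_closed
  show ?thesis
  proof (unfold_locales, unfold carrier zero, goal_cases)
    case (5 x y)
    then show ?case by (auto simp: hom P.add_comm)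
  next
    case (7 x)
    then obtain u v where "x = f u" "u \<in> carrier P" "v \<in> carrier P" "add P u v = zero P"
      using P.add_inverse by blast
    then show ?case by (auto simp: hom intro!: bexI[of _ v])
  next
    case (14 x y)
    then show ?case by (auto simp: hom P.mult_comm)
  qed ((elim imageE)?, simp add: hom closed P.add_assoc P.add_zero P.smult_add_right
      P.smult_add_left P.smult_smult P.smult_one P.mult_assoc P.mult_add P.mult_smult
      P.bracket_add_left P.bracket_add_right P.bracket_smult_left P.bracket_smult_right
      P.bracket_self P.jacobi P.leibniz)+
qed

text \<open>
  To identify the even cohomology it suffices to choose representatives linearly and to compare
  products and brackets of representatives up to coboundaries.
\<close>

lemma HE_presentation:
  fixes lb :: "('k::field, 'b::{finite,linorder}) vec \<Rightarrow> ('k, 'b) vec \<Rightarrow> ('k, 'b) vec"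
    and P :: "('k, 'a) poisson_struct" and F :: "'a \<Rightarrow> ('k, 'b) cochain"
  assumes P: "poisson_algebra P"
    and sub: "even_coboundaries lb \<subseteq> even_cocycles lb"
    and cocycle: "\<And>x. x \<in> carrier P \<Longrightarrow> F x \<in> even_cocycles lb"
    and zero: "F (zero P) = 0"
    and add: "\<And>x y. x \<in> carrier P \<Longrightarrow> y \<in> carrier P \<Longrightarrow> F (add P x y) = F x + F y"
    and smult: "\<And>c x. x \<in> carrier P \<Longrightarrow> F (smult P c x) = c *s F x"
    and mult: "\<And>x y. x \<in> carrier P \<Longrightarrow> y \<in> carrier P \<Longrightarrow>
      F x \<or>\<^sub>C F y - F (mult P x y) \<in> even_coboundaries lb"
    and bracket: "\<And>x y. x \<in> carrier P \<Longrightarrow> y \<in> carrier P \<Longrightarrow>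
      contr_bracket (F x) (F y) - F (bracket P x y) \<in> even_coboundaries lb"
    and inj: "\<And>x y. x \<in> carrier P \<Longrightarrow> y \<in> carrier P \<Longrightarrow> F x - F y \<in> even_coboundaries lb \<Longrightarrow> x = y"
    and surj: "\<And>z. z \<in> even_cocycles lb \<Longrightarrow> \<exists>x\<in>carrier P. z - F x \<in> even_coboundaries lb"
  shows "poisson_algebra (HE lb)" and "poisson_isomorphic P (HE lb)"
proof -
  let ?f = "\<lambda>x. coset lb (F x)"
  have image: "carrier (HE lb) = ?f ` carrier P"
  proof
    show "carrier (HE lb) \<subseteq> ?f ` carrier P"
    proof
      fix X assume "X \<in> carrier (HE lb)"
      then obtain z where z: "z \<in> even_cocycles lb" "X = coset lb z" by (auto simp: HE_carrier)
      with surj obtain x where "x \<in> carrier P" "z - F x \<in> even_coboundaries lb" by blast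
      with z show "X \<in> ?f ` carrier P" by (auto simp: coset_eq_iff)
    qed
    show "?f ` carrier P \<subseteq> carrier (HE lb)" using cocycle by (auto simp: HE_carrier)
  qed
  have hom: "add (HE lb) (?f x) (?f y) = ?f (add P x y)" "smult (HE lb) c (?f x) = ?f (smult P c x)"
    "mult (HE lb) (?f x) (?f y) = ?f (mult P x y)" "bracket (HE lb) (?f x) (?f y) = ?f (bracket P x y)"
    if "x \<in> carrier P" "y \<in> carrier P" for c x y
    using that by (simp_all add: HE_add HE_smult HE_mult_bracket[OF sub] cocycle add smult coset_eq_iff
        mult bracket)
  show "poisson_algebra (HE lb)"
    by (rule poisson_algebra_transport[OF P image]) (simp_all add: hom HE_zero zero)
  have "inj_on ?f (carrier P)"
    using inj by (auto intro!: inj_onI simp: coset_eq_iff)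
  then show "poisson_isomorphic P (HE lb)"
    unfolding poisson_isomorphic_def using image hom
    by (intro exI[of _ ?f]) (simp add: bij_betw_def)
qed

section \<open>The Poisson algebra on the semidirect product\<close>

lemma matrix_diff_distrib:
  fixes A B C :: "('k::field, 'n::finite) sqmat"
  shows "A ** (B - C) = A ** B - A ** C" "(A - B) ** C = A ** C - B ** C"
  by (simp_all add: matrix_matrix_mult_def vec_eq_iff sum_subtractf algebra_simps)

lemma matrix_add_rdistrib: "(A + B) ** C = A ** C + B ** C" for A B :: "('k::field, 'n::finite) sqmat"
  by (simp add: matrix_matrix_mult_def vec_eq_iff sum.distrib algebra_simps)

lemma matrix_mul_mat_smult:
  "(c *\<^sub>m A) ** B = c *\<^sub>m (A ** B)" "A ** (c *\<^sub>m B) = c *\<^sub>m (A ** B)"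
  by (simp_all add: matrix_matrix_mult_def mat_smult_def vec_eq_iff sum_distrib_left mult_ac)

lemma matrix_mul_mat: "mat c ** A = c *\<^sub>m A" "A ** mat c = c *\<^sub>m A"
  for A :: "('k::field, 'n::finite) sqmat"
  by (simp_all add: matrix_matrix_mult_def mat_smult_def mat_def vec_eq_iff if_distrib if_distribR
      sum.delta mult.commute cong: if_cong)

lemma matrix_mul_zero: "0 ** A = 0" "A ** 0 = 0" for A :: "('k::field, 'n::finite) sqmat"
  by (simp_all add: matrix_matrix_mult_def vec_eq_iff)

lemmas matrix_mul_linear = matrix_add_ldistrib matrix_add_rdistrib matrix_diff_distrib
  matrix_mul_mat_smult matrix_mul_mat matrix_mul_zero

lemma mat_smult_linear:
  "c *\<^sub>m (X + Y) = c *\<^sub>m X + c *\<^sub>m Y" "c *\<^sub>m (X - Y) = c *\<^sub>m X - c *\<^sub>m Y"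
  "(c + d) *\<^sub>m X = c *\<^sub>m X + d *\<^sub>m X" "c *\<^sub>m d *\<^sub>m X = (c * d) *\<^sub>m X"
  "c *\<^sub>m 0 = 0" "0 *\<^sub>m X = 0" "1 *\<^sub>m X = X" "c *\<^sub>m mat d = mat (c * d)"
  by (simp_all add: mat_smult_def mat_def vec_eq_iff algebra_simps)

lemma trace_linear:
  "trace (A + B) = trace A + trace B" "trace (A - B) = trace A - trace B"
  "trace (c *\<^sub>m A) = c * trace A" "trace (0 :: ('k, 'n) sqmat) = 0"
  for A B :: "('k::field, 'n::finite) sqmat"
  by (simp_all add: trace_add trace_sub) (simp_all add: trace_def mat_smult_def sum_distrib_left)

lemma mat_additive: "mat (a + b) = mat a + mat b" "mat (a - b) = mat a - mat b" "mat 0 = 0"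
  for a b :: "'k::field"
  by (simp_all add: mat_def vec_eq_iff)

lemma scal_part_linear:
  fixes A B :: "('k::field_char_0, 'n::finite) sqmat"
  shows "scal_part (A + B) = scal_part A + scal_part B" "scal_part (A - B) = scal_part A - scal_part B"
    "scal_part (c *\<^sub>m A) = c * scal_part A" "scal_part (mat c :: ('k, 'n) sqmat) = c"
    "scal_part (0 :: ('k, 'n) sqmat) = 0"
  by (simp_all add: scal_part_def trace_linear trace_mat_scalar add_divide_distrib diff_divide_distrib)

lemma sl_part_linear:
  fixes A B :: "('k::field_char_0, 'n::finite) sqmat"
  shows "sl_part (A + B) = sl_part A + sl_part B" "sl_part (A - B) = sl_part A - sl_part B"
    "sl_part (c *\<^sub>m A) = c *\<^sub>m sl_part A" "sl_part (mat c :: ('k, 'n) sqmat) = 0"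
    "sl_part (0 :: ('k, 'n) sqmat) = 0"
  by (simp_all add: sl_part_def scal_part_linear mat_additive mat_smult_linear)

lemma trace_sl_part [simp]: "trace (sl_part A) = 0" for A :: "('k::field_char_0, 'n::finite) sqmat"
  by (simp add: sl_part_def trace_linear trace_mat_scalar scal_part_def)

lemma traceless_parts:
  fixes A :: "('k::field_char_0, 'n::finite) sqmat"
  assumes "trace A = 0"
  shows "scal_part A = 0" "sl_part A = A"
  using assms by (simp_all add: scal_part_def sl_part_def)

lemma mat_scal_part_add_sl_part: "mat (scal_part X) + sl_part X = X" for X :: "('k::field_char_0, 'n::finite) sqmat"
  by (simp add: sl_part_def)

lemma mat_eqI: "scal_part X = scal_part Y \<Longrightarrow> sl_part X = sl_part Y \<Longrightarrow> X = Y"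
  for X Y :: "('k::field_char_0, 'n::finite) sqmat"
  by (metis mat_scal_part_add_sl_part)

text \<open>
  The trace of \<open>AB + BA\<close> is \<open>2 tr(AB)\<close>, so the correction term is exactly the scalar part.
\<close>

lemma sl_plus_eq: "sl_plus A B = sl_part (A ** B + B ** A)" for A B :: "('k::field_char_0, 'n::finite) sqmat"
  by (simp add: sl_plus_def sl_part_def scal_part_def trace_linear trace_mul_sym[of B A])

lemma trace_sl_plus [simp]: "trace (sl_plus A B) = 0" for A B :: "('k::field_char_0, 'n::finite) sqmat"
  by (simp add: sl_plus_eq)

lemma trace_commutator [simp]: "trace (commutator A B) = 0" for A B :: "('k::field_char_0, 'n::finite) sqmat"
  by (simp add: commutator_def trace_linear trace_mul_sym[of B A])

lemma sl_plus_linear: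
  fixes A B C :: "('k::field_char_0, 'n::finite) sqmat"
  shows "sl_plus (A + B) C = sl_plus A C + sl_plus B C" "sl_plus A (B + C) = sl_plus A B + sl_plus A C"
    "sl_plus (c *\<^sub>m A) B = c *\<^sub>m sl_plus A B" "sl_plus A (c *\<^sub>m B) = c *\<^sub>m sl_plus A B"
    "sl_plus 0 A = 0" "sl_plus A 0 = 0"
  by (simp_all add: sl_plus_eq matrix_mul_linear sl_part_linear mat_smult_linear algebra_simps)

lemma commutator_linear:
  fixes A B C :: "('k::field_char_0, 'n::finite) sqmat"
  shows "commutator (A + B) C = commutator A C + commutator B C"
    "commutator A (B + C) = commutator A B + commutator A C"
    "commutator (A - B) C = commutator A C - commutator B C"
    "commutator A (B - C) = commutator A B - commutator A C"
    "commutator (c *\<^sub>m A) B = c *\<^sub>m commutator A B" "commutator A (c *\<^sub>m B) = c *\<^sub>m commutator A B"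
    "commutator 0 A = 0" "commutator A 0 = 0" "commutator A A = 0"
    "commutator (mat c) A = 0" "commutator A (mat c) = 0"
  by (simp_all add: commutator_def matrix_mul_linear mat_smult_linear algebra_simps)

lemma sl_part_commutator: "sl_part (commutator A B) = commutator (sl_part A) (sl_part B)"
  for A B :: "('k::field_char_0, 'n::finite) sqmat"
proof -
  have "commutator (mat (scal_part A) + sl_part A) (mat (scal_part B) + sl_part B) =
      commutator (sl_part A) (sl_part B)"
    by (simp only: commutator_linear add_0 add_0_right)
  then show ?thesis by (simp add: mat_scal_part_add_sl_part traceless_parts)
qed

lemma sl_plus_commute: "sl_plus A B = sl_plus B A" for A B :: "('k::field_char_0, 'n::finite) sqmat"
  by (simp add: sl_plus_eq add.commute)

text \<open>
  Bracketing with \<open>C\<close> is a derivation of the matrix product and annihilates scalar matrices.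
\<close>

lemma commutator_sl_plus:
  "commutator C (sl_plus A B) = sl_plus (commutator C A) B + sl_plus A (commutator C B)"
  for A B C :: "('k::field_char_0, 'n::finite) sqmat"
proof -
  have "commutator C (sl_plus A B) = commutator C (A ** B + B ** A)"
    by (simp add: sl_plus_def commutator_linear)
  also have "\<dots> = (commutator C A ** B + B ** commutator C A) + (A ** commutator C B + commutator C B ** A)"
    by (simp add: commutator_def matrix_mul_linear matrix_mul_assoc)
  finally have "sl_part (commutator C (sl_plus A B)) = sl_plus (commutator C A) B + sl_plus A (commutator C B)"
    by (simp only: sl_plus_eq sl_part_linear)
  then show ?thesis by (simp add: traceless_parts)
qed

text \<open>
  The scalar corrections in \<open>sl_plus\<close> are multiplied by the trace of \<open>C\<close> and of \<open>A\<close>, respectively. What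
  remains on both sides is \<open>tr(ABC) + tr(BAC)\<close>, a form symmetric in all three arguments.
\<close>

lemma trace_sl_plus_assoc:
  fixes A B C :: "('k::field_char_0, 'n::finite) sqmat"
  assumes "trace A = 0" "trace C = 0"
  shows "trace (sl_plus A B ** C) = trace (A ** sl_plus B C)"
  using assms trace_mul_sym[of "B ** A" C] trace_mul_sym[of B "A ** C"]
  by (simp add: sl_plus_def matrix_mul_linear matrix_mul_assoc trace_linear)

lemma trace_commutator_invariant: "trace (commutator C A ** B) = - trace (A ** commutator C B)"
  for A B C :: "('k::field_char_0, 'n::finite) sqmat"
  using trace_mul_sym[of "A ** B" C]
  by (simp add: commutator_def matrix_mul_linear matrix_mul_assoc trace_linear)

lemma gl_poisson_simps:
  "carrier (gl_poisson :: ('k, ('k::field_char_0, 'n::finite) sqmat \<times> ('k, 'n) sqmat) poisson_struct) = UNIV"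
  "zero (gl_poisson :: ('k, ('k, 'n) sqmat \<times> ('k, 'n) sqmat) poisson_struct) = 0"
  "add (gl_poisson :: ('k, ('k, 'n) sqmat \<times> ('k, 'n) sqmat) poisson_struct) = (+)"
  "mult (gl_poisson :: ('k, ('k, 'n) sqmat \<times> ('k, 'n) sqmat) poisson_struct) = gl_mult"
  "bracket (gl_poisson :: ('k, ('k, 'n) sqmat \<times> ('k, 'n) sqmat) poisson_struct) = gl_bracket"
  by (simp_all add: gl_poisson_def)

lemma pair_mat_eqI:
  fixes x y :: "('k::field_char_0, 'n::finite) sqmat \<times> ('k, 'n) sqmat"
  assumes "scal_part (fst x) = scal_part (fst y)" "sl_part (fst x) = sl_part (fst y)"
    "scal_part (snd x) = scal_part (snd y)" "sl_part (snd x) = sl_part (snd y)"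
  shows "x = y"
  by (rule prod_eqI; rule mat_eqI; rule assms)

text \<open>
  In terms of scalar and traceless parts the product involves only \<open>sl_plus\<close> and the trace form. The
  term \<open>-2/n tr(A\<^sub>0B\<^sub>0)\<close> of the definition is absorbed here: it cancels the scalar part of
  \<open>A\<^sub>0B\<^sub>0 + B\<^sub>0A\<^sub>0\<close>.
\<close>

lemma gl_parts:
  fixes x y :: "('k::field_char_0, 'n::finite) sqmat \<times> ('k, 'n) sqmat"
  shows "scal_part (fst (gl_mult x y)) = scal_part (fst x) * scal_part (fst y)"
    "sl_part (fst (gl_mult x y)) = scal_part (fst x) *\<^sub>m sl_part (fst y) + scal_part (fst y) *\<^sub>m sl_part (fst x)"
    "scal_part (snd (gl_mult x y)) = scal_part (fst x) * scal_part (snd y) + scal_part (snd x) * scal_part (fst y)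
      + trace (sl_part (fst x) ** sl_part (snd y)) + trace (sl_part (snd x) ** sl_part (fst y))"
    "sl_part (snd (gl_mult x y)) = scal_part (fst x) *\<^sub>m sl_part (snd y)
      + scal_part (fst y) *\<^sub>m sl_part (snd x) + sl_plus (sl_part (fst x)) (sl_part (fst y))"
    "scal_part (fst (gl_bracket x y)) = 0"
    "sl_part (fst (gl_bracket x y)) = commutator (sl_part (fst x)) (sl_part (fst y))"
    "scal_part (snd (gl_bracket x y)) = 0"
    "sl_part (snd (gl_bracket x y)) = commutator (sl_part (fst x)) (sl_part (snd y))
      - commutator (sl_part (fst y)) (sl_part (snd x))"
proof -
  have "scal_part (sl_part (fst x) ** sl_part (fst y) + sl_part (fst y) ** sl_part (fst x)) =
      2 / of_nat CARD('n) * trace (sl_part (fst x) ** sl_part (fst y))"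
    using trace_mul_sym[of "sl_part (fst x)" "sl_part (fst y)"] by (simp add: scal_part_def trace_linear)
  then show "scal_part (snd (gl_mult x y)) = scal_part (fst x) * scal_part (snd y) + scal_part (snd x) * scal_part (fst y)
      + trace (sl_part (fst x) ** sl_part (snd y)) + trace (sl_part (snd x) ** sl_part (fst y))"
    by (simp add: gl_mult_def Let_def scal_part_linear traceless_parts trace_linear add.assoc)
qed (simp_all add: gl_mult_def gl_bracket_def Let_def case_prod_beta scal_part_linear sl_part_linear
    traceless_parts sl_part_commutator sl_plus_eq add.assoc)

lemma gl_smult_eq:
  "smult (gl_poisson :: ('k, ('k::field_char_0, 'n::finite) sqmat \<times> ('k, 'n) sqmat) poisson_struct) c x = (c *\<^sub>m fst x, c *\<^sub>m snd x)"
  by (simp add: gl_poisson_def case_prod_beta)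

text \<open>
  Compared part by part, associativity is the symmetry of \<open>tr (sl_plus A B ** C)\<close>, and the Leibniz
  rule is the invariance of \<open>sl_plus\<close> and of the trace form under commutators.
\<close>

lemma poisson_algebra_gl:
  "poisson_algebra (gl_poisson :: ('k, ('k::field_char_0, 'n::finite) sqmat \<times> ('k, 'n) sqmat) poisson_struct)"
proof -
  note parts = gl_poisson_simps gl_smult_eq gl_parts scal_part_linear sl_part_linear
  note lin = matrix_mul_linear mat_smult_linear trace_linear sl_plus_linear commutator_linear
  have assoc: "gl_mult (gl_mult x y) z = gl_mult x (gl_mult y z)" for x y z :: "('k, 'n) sqmat \<times> ('k, 'n) sqmat"
    by (rule pair_mat_eqI)
       (simp_all add: parts lin trace_sl_plus_assoc sl_plus_commute algebra_simps)
  have leibniz: "gl_bracket z (gl_mult x y) = gl_mult (gl_bracket z x) y + gl_mult x (gl_bracket z y)"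
    for x y z :: "('k, 'n) sqmat \<times> ('k, 'n) sqmat"
  proof (rule pair_mat_eqI)
    let ?x0 = "sl_part (fst x)" and ?x1 = "sl_part (snd x)" and ?y0 = "sl_part (fst y)"
      and ?y1 = "sl_part (snd y)" and ?z0 = "sl_part (fst z)" and ?z1 = "sl_part (snd z)"
    have "commutator ?x0 ?z1 = - commutator ?z1 ?x0" "commutator ?y0 ?z1 = - commutator ?z1 ?y0"
      by (simp_all add: commutator_def)
    then show "scal_part (snd (gl_bracket z (gl_mult x y))) =
        scal_part (snd (gl_mult (gl_bracket z x) y + gl_mult x (gl_bracket z y)))"
      using trace_commutator_invariant[of ?z0 ?x0 ?y1] trace_commutator_invariant[of ?z0 ?x1 ?y0]
        trace_commutator_invariant[of ?z1 ?x0 ?y0]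
      by (simp add: parts lin algebra_simps)
    show "sl_part (snd (gl_bracket z (gl_mult x y))) =
        sl_part (snd (gl_mult (gl_bracket z x) y + gl_mult x (gl_bracket z y)))"
      by (simp add: parts lin commutator_sl_plus algebra_simps)
  qed (simp_all add: parts lin)
  have jacobi: "gl_bracket x (gl_bracket y z) + (gl_bracket y (gl_bracket z x) + gl_bracket z (gl_bracket x y)) = 0"
    for x y z :: "('k, 'n) sqmat \<times> ('k, 'n) sqmat"
    by (simp add: gl_bracket_def case_prod_beta prod_eq_iff commutator_def matrix_diff_distrib matrix_mul_assoc)
  have comm: "gl_mult x y = gl_mult y x" for x y :: "('k, 'n) sqmat \<times> ('k, 'n) sqmat"
    using trace_mul_sym[of "sl_part (fst x)" "sl_part (snd y)"] trace_mul_sym[of "sl_part (snd x)" "sl_part (fst y)"]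
    by (intro pair_mat_eqI) (simp_all add: parts sl_plus_commute algebra_simps)
  have inv: "\<exists>y. x + y = 0" for x :: "('k, 'n) sqmat \<times> ('k, 'n) sqmat"
    by (rule exI[of _ "- x"]) simp
  show ?thesis
  proof (unfold_locales, unfold gl_poisson_simps gl_smult_eq, goal_cases)
    case 7 then show ?case using inv by simp
  next
    case 13 then show ?case by (simp add: assoc)
  next
    case 14 show ?case by (rule comm)
  next
    case 23 show ?case by (rule jacobi)
  next
    case 24 show ?case by (rule leibniz)
  qed ((simp add: mat_smult_linear add_ac; fail) | (rule pair_mat_eqI; simp add: parts lin algebra_simps))+
qed

lemma conj_by_algebra_hom:
  fixes g A B :: "('k::field_char_0, 'n::finite) sqmat"
  assumes "invertible g"
  shows "conj_by g (A ** B) = conj_by g A ** conj_by g B" "trace (conj_by g A) = trace A"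
    "conj_by g (mat c) = mat c" "conj_by g 0 = 0"
    "conj_by g (A + B) = conj_by g A + conj_by g B" "conj_by g (A - B) = conj_by g A - conj_by g B"
    "conj_by g (c *\<^sub>m A) = c *\<^sub>m conj_by g A"
proof -
  have inv: "g ** matrix_inv g = mat 1" "matrix_inv g ** g = mat 1"
    using assms someI_ex[of "\<lambda>h. g ** h = mat 1 \<and> h ** g = mat 1"]
    unfolding invertible_def matrix_inv_def by blast+
  show "conj_by g (A ** B) = conj_by g A ** conj_by g B"
  proof -
    have "conj_by g A ** conj_by g B = g ** A ** (matrix_inv g ** g) ** B ** matrix_inv g"
      by (simp add: conj_by_def matrix_mul_assoc)
    then show ?thesis by (simp add: inv conj_by_def matrix_mul_assoc)
  qed
  show "trace (conj_by g A) = trace A"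
    unfolding conj_by_def trace_mul_sym[of "g ** A"] matrix_mul_assoc inv by simp
  show "conj_by g (mat c) = mat c"
    by (simp add: conj_by_def matrix_mul_linear inv mat_smult_linear)
qed (simp_all add: conj_by_def matrix_mul_linear)

lemma conj_by_parts:
  fixes g A B :: "('k::field_char_0, 'n::finite) sqmat"
  assumes "invertible g"
  shows "scal_part (conj_by g A) = scal_part A" "sl_part (conj_by g A) = conj_by g (sl_part A)"
    "sl_plus (conj_by g A) (conj_by g B) = conj_by g (sl_plus A B)"
    "commutator (conj_by g A) (conj_by g B) = conj_by g (commutator A B)"
  by (simp_all add: scal_part_def sl_part_def sl_plus_def commutator_def conj_by_algebra_hom[OF assms]
      flip: conj_by_algebra_hom(1)[OF assms])

lemma gl_act_summands:
  fixes g A :: "('k::field_char_0, 'n::finite) sqmat"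
  assumes "invertible g"
  shows "gl_act g (in_I_0 a) = in_I_0 a" "gl_act g (in_I_ab a) = in_I_ab a"
    "gl_act g (in_sl_0 A) = in_sl_0 (conj_by g A)" "gl_act g (in_sl_ab A) = in_sl_ab (conj_by g A)"
  by (simp_all add: gl_act_def in_I_0_def in_I_ab_def in_sl_0_def in_sl_ab_def conj_by_algebra_hom[OF assms])

lemma gl_act_equivariant:
  fixes g :: "('k::field_char_0, 'n::finite) sqmat" and x y :: "('k, 'n) sqmat \<times> ('k, 'n) sqmat"
  assumes "invertible g"
  shows "gl_act g (gl_mult x y) = gl_mult (gl_act g x) (gl_act g y)"
    and "gl_act g (gl_bracket x y) = gl_bracket (gl_act g x) (gl_act g y)"
proof -
  show "gl_act g (gl_mult x y) = gl_mult (gl_act g x) (gl_act g y)"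
    by (rule pair_mat_eqI)
       (simp_all add: gl_act_def conj_by_parts[OF assms] gl_parts conj_by_algebra_hom[OF assms]
          flip: conj_by_algebra_hom(1)[OF assms])
  show "gl_act g (gl_bracket x y) = gl_bracket (gl_act g x) (gl_act g y)"
    by (simp add: gl_act_def gl_bracket_def case_prod_beta conj_by_parts[OF assms] conj_by_algebra_hom[OF assms])
qed

lemma gl_decomposition:
  fixes z :: "('k::field_char_0, 'n::finite) sqmat \<times> ('k, 'n) sqmat"
  shows "\<exists>!t. case t of (a, A, b, B) \<Rightarrow>
       A \<in> sl \<and> B \<in> sl \<and> z = (in_I_0 a + in_sl_0 A) + (in_I_ab b + in_sl_ab B)"
proof (rule ex1I)
  show "case (scal_part (fst z), sl_part (fst z), scal_part (snd z), sl_part (snd z)) of (a, A, b, B) \<Rightarrow>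
       A \<in> sl \<and> B \<in> sl \<and> z = (in_I_0 a + in_sl_0 A) + (in_I_ab b + in_sl_ab B)"
    by (simp add: sl_def in_I_0_def in_sl_0_def in_I_ab_def in_sl_ab_def mat_scal_part_add_sl_part)
  show "t = (scal_part (fst z), sl_part (fst z), scal_part (snd z), sl_part (snd z))"
    if "case t of (a, A, b, B) \<Rightarrow>
       A \<in> sl \<and> B \<in> sl \<and> z = (in_I_0 a + in_sl_0 A) + (in_I_ab b + in_sl_ab B)" for t
    using that by (auto simp: sl_def in_I_0_def in_sl_0_def in_I_ab_def in_sl_ab_def scal_sl_part_decomp)
qed

lemma gl_mult_table:
  fixes A B :: "('k::field_char_0, 'n::finite) sqmat"
  assumes "trace A = 0" "trace B = 0"
  shows "gl_mult (in_I_0 a) (in_I_0 b) = (in_I_0 (a * b) :: ('k, 'n) sqmat \<times> ('k, 'n) sqmat)"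
    "gl_mult (in_I_0 a) (in_sl_0 B) = in_sl_0 (a *\<^sub>m B)"
    "gl_mult (in_I_0 a) (in_sl_ab B) = in_sl_ab (a *\<^sub>m B)"
    "gl_mult (in_I_0 a) (in_I_ab b) = (in_I_ab (a * b) :: ('k, 'n) sqmat \<times> ('k, 'n) sqmat)"
    "gl_mult (in_sl_0 A) (in_I_0 b) = in_sl_0 (b *\<^sub>m A)"
    "gl_mult (in_sl_0 A) (in_sl_0 B) = in_sl_ab (sl_plus A B)"
    "gl_mult (in_sl_0 A) (in_sl_ab B) = in_I_ab (trace (A ** B))"
    "gl_mult (in_sl_0 A) (in_I_ab b) = 0"
    "gl_mult (in_sl_ab A) (in_I_0 b) = in_sl_ab (b *\<^sub>m A)"
    "gl_mult (in_sl_ab A) (in_sl_0 B) = in_I_ab (trace (A ** B))"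
    "gl_mult (in_sl_ab A) (in_sl_ab B) = 0"
    "gl_mult (in_sl_ab A) (in_I_ab b) = 0"
    "gl_mult (in_I_ab a) (in_I_0 b) = (in_I_ab (a * b) :: ('k, 'n) sqmat \<times> ('k, 'n) sqmat)"
    "gl_mult (in_I_ab a) (in_sl_0 B) = 0"
    "gl_mult (in_I_ab a) (in_sl_ab B) = 0"
    "gl_mult (in_I_ab a) (in_I_ab b) = (0 :: ('k, 'n) sqmat \<times> ('k, 'n) sqmat)"
  by (rule pair_mat_eqI;
      simp add: gl_parts in_I_0_def in_sl_0_def in_I_ab_def in_sl_ab_def scal_part_linear sl_part_linear
        traceless_parts assms sl_plus_linear mat_smult_linear matrix_mul_linear trace_linear)+

lemma gl_bracket_table:
  fixes A B :: "('k::field_char_0, 'n::finite) sqmat"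
  shows "gl_bracket (in_I_0 a) (in_I_0 b) = (0 :: ('k, 'n) sqmat \<times> ('k, 'n) sqmat)"
    "gl_bracket (in_I_0 a) (in_sl_0 B) = 0"
    "gl_bracket (in_I_0 a) (in_sl_ab B) = 0"
    "gl_bracket (in_I_0 a) (in_I_ab b) = (0 :: ('k, 'n) sqmat \<times> ('k, 'n) sqmat)"
    "gl_bracket (in_sl_0 A) (in_I_0 b) = 0"
    "gl_bracket (in_sl_0 A) (in_sl_0 B) = in_sl_0 (commutator A B)"
    "gl_bracket (in_sl_0 A) (in_sl_ab B) = in_sl_ab (commutator A B)"
    "gl_bracket (in_sl_0 A) (in_I_ab b) = 0"
    "gl_bracket (in_sl_ab A) (in_I_0 b) = 0"
    "gl_bracket (in_sl_ab A) (in_sl_0 B) = in_sl_ab (commutator A B)"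
    "gl_bracket (in_sl_ab A) (in_sl_ab B) = 0"
    "gl_bracket (in_sl_ab A) (in_I_ab b) = 0"
    "gl_bracket (in_I_ab a) (in_I_0 b) = (0 :: ('k, 'n) sqmat \<times> ('k, 'n) sqmat)"
    "gl_bracket (in_I_ab a) (in_sl_0 B) = 0"
    "gl_bracket (in_I_ab a) (in_sl_ab B) = 0"
    "gl_bracket (in_I_ab a) (in_I_ab b) = (0 :: ('k, 'n) sqmat \<times> ('k, 'n) sqmat)"
  by (simp_all add: gl_bracket_def in_I_0_def in_sl_0_def in_I_ab_def in_sl_ab_def commutator_linear
      zero_prod_def commutator_def[of A B] commutator_def[of B A])

section \<open>Exterior monomials of the Heisenberg algebra\<close>

text \<open>
  Subsets of the six generators, which in their order are called \<open>a b c\<close> (the covectors dual to \<open>X1\<close>,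
  \<open>Xm1\<close>, \<open>H0\<close>) and \<open>x y h\<close> (the vectors \<open>X1\<close>, \<open>Xm1\<close>, \<open>H0\<close>) below. Membership is given by six truth
  values, so that comparing monomials and evaluating signs is mere rewriting.
\<close>

definition gset :: "bool \<Rightarrow> bool \<Rightarrow> bool \<Rightarrow> bool \<Rightarrow> bool \<Rightarrow> bool \<Rightarrow> (heis + heis) set" where
  "gset a b c x y h = {g. case g of
      Inl i \<Rightarrow> (case i of X1 \<Rightarrow> a | Xm1 \<Rightarrow> b | H0 \<Rightarrow> c)
    | Inr i \<Rightarrow> (case i of X1 \<Rightarrow> x | Xm1 \<Rightarrow> y | H0 \<Rightarrow> h)}"

lemma mem_gset [simp]:
  "Inl X1 \<in> gset a b c x y h \<longleftrightarrow> a" "Inl Xm1 \<in> gset a b c x y h \<longleftrightarrow> b" "Inl H0 \<in> gset a b c x y h \<longleftrightarrow> c"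
  "Inr X1 \<in> gset a b c x y h \<longleftrightarrow> x" "Inr Xm1 \<in> gset a b c x y h \<longleftrightarrow> y" "Inr H0 \<in> gset a b c x y h \<longleftrightarrow> h"
  by (simp_all add: gset_def)

lemma all_gens:
  "(\<forall>g. P g) \<longleftrightarrow> P (Inl X1) \<and> P (Inl Xm1) \<and> P (Inl H0) \<and> P (Inr X1) \<and> P (Inr Xm1) \<and> P (Inr H0)"
proof -
  have "(\<forall>i. Q i) \<longleftrightarrow> Q X1 \<and> Q Xm1 \<and> Q H0" for Q
    by (metis heis.exhaust)
  then show ?thesis by (simp add: split_sum_all)
qed

lemma gset_eq_iff:
  "gset a b c x y h = gset a' b' c' x' y' h' \<longleftrightarrow>
    a = a' \<and> b = b' \<and> c = c' \<and> x = x' \<and> y = y' \<and> h = h'"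
  unfolding set_eq_iff all_gens by simp

lemma gset_subset_iff:
  "gset a b c x y h \<subseteq> gset a' b' c' x' y' h' \<longleftrightarrow>
    (a \<longrightarrow> a') \<and> (b \<longrightarrow> b') \<and> (c \<longrightarrow> c') \<and> (x \<longrightarrow> x') \<and> (y \<longrightarrow> y') \<and> (h \<longrightarrow> h')"
  unfolding subset_iff all_gens by simp

lemma gset_Un: "gset a b c x y h \<union> gset a' b' c' x' y' h' =
    gset (a \<or> a') (b \<or> b') (c \<or> c') (x \<or> x') (y \<or> y') (h \<or> h')"
  and gset_Int: "gset a b c x y h \<inter> gset a' b' c' x' y' h' =
    gset (a \<and> a') (b \<and> b') (c \<and> c') (x \<and> x') (y \<and> y') (h \<and> h')"
  and gset_Diff: "gset a b c x y h - gset a' b' c' x' y' h' =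
    gset (a \<and> \<not> a') (b \<and> \<not> b') (c \<and> \<not> c') (x \<and> \<not> x') (y \<and> \<not> y') (h \<and> \<not> h')"
  unfolding set_eq_iff all_gens by simp_all

lemma gset_insert:
  "insert (Inl X1) (gset a b c x y h) = gset True b c x y h"
  "insert (Inl Xm1) (gset a b c x y h) = gset a True c x y h"
  "insert (Inl H0) (gset a b c x y h) = gset a b True x y h"
  "insert (Inr X1) (gset a b c x y h) = gset a b c True y h"
  "insert (Inr Xm1) (gset a b c x y h) = gset a b c x True h"
  "insert (Inr H0) (gset a b c x y h) = gset a b c x y True"
  unfolding set_eq_iff all_gens by simp_all

lemma gset_empty: "{} = gset False False False False False False"
  unfolding set_eq_iff all_gens by simp

lemma gset_exhaust: "\<exists>a b c x y h. U = gset a b c x y h"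
  by (rule exI[of _ "Inl X1 \<in> U"], rule exI[of _ "Inl Xm1 \<in> U"], rule exI[of _ "Inl H0 \<in> U"],
      rule exI[of _ "Inr X1 \<in> U"], rule exI[of _ "Inr Xm1 \<in> U"], rule exI[of _ "Inr H0 \<in> U"])
     (unfold set_eq_iff all_gens, simp)

lemma UNIV_gens: "(UNIV :: (heis + heis) set) = {Inl X1, Inl Xm1, Inl H0, Inr X1, Inr Xm1, Inr H0}"
  unfolding set_eq_iff all_gens by simp

lemma prod_gset:
  "(\<Prod>g\<in>gset a b c x y h. f g) = (if a then f (Inl X1) else 1) * (if b then f (Inl Xm1) else 1) *
    (if c then f (Inl H0) else 1) * (if x then f (Inr X1) else 1) * (if y then f (Inr Xm1) else 1) *
    (if h then f (Inr H0) else 1)"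
proof -
  have "(\<Prod>g\<in>gset a b c x y h. f g) = (\<Prod>g\<in>UNIV. if g \<in> gset a b c x y h then f g else 1)"
    by (simp flip: prod.inter_filter)
  then show ?thesis by (simp add: UNIV_gens mult.assoc)
qed

lemma reorder_sign_gset:
  "reorder_sign (gset a b c x y h) (gset a' b' c' x' y' h') =
    (if b \<and> a' then - 1 else 1) * (if c \<and> a' then - 1 else 1) * (if c \<and> b' then - 1 else 1) *
    (if x \<and> a' then - 1 else 1) * (if x \<and> b' then - 1 else 1) * (if x \<and> c' then - 1 else 1) *
    (if y \<and> a' then - 1 else 1) * (if y \<and> b' then - 1 else 1) * (if y \<and> c' then - 1 else 1) *
    (if y \<and> x' then - 1 else 1) * (if h \<and> a' then - 1 else 1) * (if h \<and> b' then - 1 else 1) *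
    (if h \<and> c' then - 1 else 1) * (if h \<and> x' then - 1 else 1) * (if h \<and> y' then - 1 else 1)"
proof -
  have "(if P then u * v else 1) = (if P then u else 1) * (if P then v else 1 :: 'a)" for P u v
    by simp
  moreover have "(if P then if Q then u else 1 else 1) = (if P \<and> Q then u else 1 :: 'a)" for P Q u
    by simp
  ultimately show ?thesis
    by (simp add: reorder_sign_def prod_gset less_heis_def mult.assoc split del: if_split cong del: if_weak_cong)
qed

lemma vee_gset:
  "basis (gset a b c x y h) \<or>\<^sub>C basis (gset a' b' c' x' y' h') =
    (if \<not> (a \<and> a' \<or> b \<and> b' \<or> c \<and> c' \<or> x \<and> x' \<or> y \<and> y' \<or> h \<and> h')
     then reorder_sign (gset a b c x y h) (gset a' b' c' x' y' h') *s
       basis (gset (a \<or> a') (b \<or> b') (c \<or> c') (x \<or> x') (y \<or> y') (h \<or> h')) else 0)"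
  by (auto simp: vee_basis gset_Un gset_Int gset_empty gset_eq_iff)

lemma basis_gset_nth:
  "basis (gset a b c x y h) $ index_of (gset a' b' c' x' y' h') =
    (if a = a' \<and> b = b' \<and> c = c' \<and> x = x' \<and> y = y' \<and> h = h' then 1 else 0)"
  by (auto simp: basis_nth gset_eq_iff)

lemma heis_cochain_eqI:
  assumes "\<And>a b c x y h. u $ index_of (gset a b c x y h) = v $ index_of (gset a b c x y h)"
  shows "u = v"
proof -
  have "u $ I = v $ I" for I
    using assms gset_exhaust[of "gens_of I"] by (metis index_of_gens_of)
  then show ?thesis by (simp add: vec_eq_iff)
qed

lemma sum_heis: "(\<Sum>i\<in>UNIV. f i) = f X1 + f Xm1 + f H0"
  by (simp add: UNIV_heis add.assoc)

section \<open>The differential of the Heisenberg algebra\<close>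

abbreviation heis_diff :: "('k::field, heis) cochain \<Rightarrow> ('k, heis) cochain" where
  "heis_diff \<equiv> ce_diff heis_bracket"

text \<open>
  The bracket of the Heisenberg algebra as a cochain. It is a volume element of the 3-dimensional
  space \<open>L\<close> spanned by \<open>a\<close>, \<open>b\<close> and \<open>h\<close>, which is isotropic for the pairing; \<open>x\<close>, \<open>y\<close> and \<open>c\<close> span its
  dual. All structure below is therefore invariant under \<open>SL(L)\<close>.
\<close>

abbreviation heis_volume :: "('k::field, heis) cochain" where
  "heis_volume \<equiv> basis {Inl X1, Inl Xm1, Inr H0}"

lemma lie_cochain_heis: "lie_cochain heis_bracket = (heis_volume :: ('k::field, heis) cochain)"
proof -
  have pairs: "{(i, j). i < j} = {(X1, Xm1), (X1, H0), (Xm1, H0)}"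
  proof -
    have "i < j \<longleftrightarrow> (i, j) \<in> {(X1, Xm1), (X1, H0), (Xm1, H0)}" for i j
      by (cases i; cases j) (simp_all add: less_heis_def)
    then show ?thesis by blast
  qed
  have "gens_of ({X1, Xm1}, {H0}) = {Inl X1, Inl Xm1, Inr H0}"
    by (auto simp: gens_of_def)
  then show ?thesis
    unfolding lie_cochain_def pairs
    by (simp add: sum_heis heis_bracket_def axis_basis) (simp add: axis_def)
qed

lemma heis_diff_eq:
  "heis_diff u = basis {Inl X1, Inl Xm1} \<or>\<^sub>C contract (Inl H0) u
    + basis {Inl Xm1, Inr H0} \<or>\<^sub>C contract (Inr X1) u - basis {Inl X1, Inr H0} \<or>\<^sub>C contract (Inr Xm1) u"
  by (simp add: ce_diff_eq lie_cochain_heis contr_bracket_def UNIV_gens contract_basis parity_inv_linear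
      parity_inv_basis insert_Diff_if insert_commute reorder_sign_def less_heis_def vee_minus)

lemma contract_gset_nth:
  "contract g u $ index_of U = (if g \<in> U then 0 else reorder_sign {g} U * u $ index_of (insert g U))"
  by (simp add: contract_def)

lemma basis_vee_nth:
  "(basis U \<or>\<^sub>C u) $ index_of W = (if U \<subseteq> W then reorder_sign U (W - U) * u $ index_of (W - U) else 0)"
proof (induction u rule: cochain_induct)
  case (basis V)
  have "U \<union> V = W \<and> U \<inter> V = {} \<longleftrightarrow> U \<subseteq> W \<and> V = W - U" by blast
  then show ?case by (auto simp: vee_basis basis_nth)
qed (simp_all add: vee_linear algebra_simps)

text \<open>
  The bracket of the volume element with itself vanishes since \<open>L\<close> is isotropic. The Jacobi identity
  then gives \<open>d\<^sup>2 = - d\<^sup>2\<close>.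
\<close>

lemma heis_diff_square: "heis_diff (heis_diff (u :: ('k::field_char_0, heis) cochain)) = 0"
proof -
  have par: "has_parity 1 (heis_volume :: ('k, heis) cochain)"
    by (rule has_parity_basis) simp
  have "heis_diff heis_volume = (0 :: ('k, heis) cochain)"
    by (simp add: heis_diff_eq contract_basis)
  then have "heis_diff (heis_diff u) = - heis_diff (heis_diff u)"
    using contr_bracket_jacobi[OF par par, of u] by (simp add: ce_diff_eq lie_cochain_heis)
  then have "2 *s heis_diff (heis_diff u) = 0"
    by (metis add.right_inverse one_add_one vector_sadd_rdistrib vector_smult_lid)
  then show ?thesis by simp
qed


section \<open>A copy of gl(3) among the cochains\<close>

text \<open>
  The basis \<open>a, b, h\<close> of \<open>L\<close>, indexed like the matrices.
\<close>

fun lag_gen :: "heis \<Rightarrow> heis + heis" where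
  "lag_gen X1 = Inl X1" | "lag_gen Xm1 = Inl Xm1" | "lag_gen H0 = Inr H0"

lemma lag_gen_simps [simp]: "lag_gen i = lag_gen j \<longleftrightarrow> i = j" "lag_gen i \<noteq> dual_gen (lag_gen j)" "dual_gen (lag_gen j) \<noteq> lag_gen i"
    "dual_gen (lag_gen i) = dual_gen (lag_gen j) \<longleftrightarrow> i = j"
  by (cases i; cases j; simp)+

definition unit_quad :: "heis \<Rightarrow> heis \<Rightarrow> ('k::field, heis) cochain" where
  "unit_quad i j = basis {lag_gen i} \<or>\<^sub>C basis {dual_gen (lag_gen j)}"

text \<open>
  The endomorphism \<open>A\<close> of \<open>L\<close> as an element of \<open>L \<otimes> L\<^sup>*\<close>, the products of a generator in \<open>L\<close> and one in \<open>L\<^sup>*\<close>.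
\<close>

definition quad :: "('k::field, heis) sqmat \<Rightarrow> ('k, heis) cochain" where
  "quad A = (\<Sum>i\<in>UNIV. \<Sum>j\<in>UNIV. A $ i $ j *s unit_quad i j)"

text \<open>
  The identity of \<open>L\<close>. Bracketing with it multiplies \<open>\<Lambda>\<^sup>iL \<otimes> \<Lambda>\<^sup>jL\<^sup>*\<close> by \<open>i - j\<close>; in particular it
  commutes with all \<open>quad A\<close>.
\<close>

abbreviation euler :: "('k::field, heis) cochain" where
  "euler \<equiv> quad (mat 1)"

lemma quad_linear:
  "quad (A + B) = quad A + quad B" "quad (A - B) = quad A - quad B" "quad (c *\<^sub>m A) = c *s quad A"
  "quad 0 = 0"
  by (simp_all add: quad_def vector_sadd_rdistrib vector_sub_rdistrib sum.distrib sum_subtractf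
      vector_scale_sum mat_smult_def vector_smult_assoc)

lemma parity_gen: "has_parity 1 (basis {g})"
  by (rule has_parity_basis) simp

lemma parity_unit_quad: "has_parity 0 (unit_quad i j)"
  unfolding unit_quad_def by (rule has_parity_cong[OF has_parity_vee[OF parity_gen parity_gen]]) simp

lemma parity_quad: "has_parity 0 (quad A)"
  unfolding quad_def by (intro has_parity_sum has_parity_linear parity_unit_quad)

lemma parity_even_vee: "has_parity 0 u \<Longrightarrow> has_parity 0 v \<Longrightarrow> has_parity 0 (u \<or>\<^sub>C v)"
  using has_parity_vee[of 0 u 0 v] by simp

lemma even_vee_commute: "has_parity 0 u \<Longrightarrow> has_parity 0 v \<Longrightarrow> u \<or>\<^sub>C v = v \<or>\<^sub>C u"
  using vee_supercommute[of 0 u 0 v] by simp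

text \<open>
  The bracket with a product of two generators is a first-order differential operator.
\<close>

lemma unit_quad_action:
  "contr_bracket (unit_quad i j) u =
    basis {lag_gen i} \<or>\<^sub>C contract (lag_gen j) u - basis {dual_gen (lag_gen j)} \<or>\<^sub>C contract (dual_gen (lag_gen i)) u"
  unfolding unit_quad_def
  by (subst contr_bracket_vee_left[OF parity_gen parity_gen]) (simp add: contr_bracket_gen)

lemma bracket_unit_quad:
  "contr_bracket (unit_quad i j) (unit_quad k m) =
    (if j = k then unit_quad i m else 0) - (if i = m then unit_quad k j else 0)"
proof -
  have c: "contract g (basis {h}) = (if g = h then basis {} else 0)" for g h :: "heis + heis"
    by (simp add: contract_basis)
  have "basis {dual_gen (lag_gen j)} \<or>\<^sub>C basis {lag_gen k} = - unit_quad k j"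
    unfolding unit_quad_def by (subst vee_supercommute[OF parity_gen parity_gen]) simp
  then show ?thesis
    by (auto simp: unit_quad_action unit_quad_def[of k m] contract_vee c parity_inv_basis vee_minus)
       (auto simp: unit_quad_def)
qed

lemma bracket_quad: "contr_bracket (quad A) (quad B) = quad (commutator A B)"
proof -
  have "contr_bracket (quad A) (quad B) = (\<Sum>i\<in>UNIV. \<Sum>j\<in>UNIV. \<Sum>k\<in>UNIV. \<Sum>m\<in>UNIV.
      (A $ i $ j * B $ k $ m) *s contr_bracket (unit_quad i j) (unit_quad k m))"
    by (simp only: quad_def contr_bracket_sum(1) contr_bracket_scale(1))
       (simp only: contr_bracket_sum(2) contr_bracket_scale(2) vector_scale_sum vector_smult_assoc)
  also have "\<dots> = quad (A ** B) - quad (B ** A)"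
    by (simp add: bracket_unit_quad quad_def matrix_matrix_mult_def sum_heis algebra_simps)
  finally show ?thesis by (simp add: commutator_def quad_linear)
qed

lemma bracket_even_vee_right:
  "has_parity 0 w \<Longrightarrow> has_parity 0 u \<Longrightarrow>
    contr_bracket w (u \<or>\<^sub>C v) = contr_bracket w u \<or>\<^sub>C v + u \<or>\<^sub>C contr_bracket w v"
  using contr_bracket_vee_right[of 0 w 0 u v] by simp

lemma bracket_even_vee_left:
  "has_parity 0 u \<Longrightarrow> has_parity 0 v \<Longrightarrow>
    contr_bracket (u \<or>\<^sub>C v) w = u \<or>\<^sub>C contr_bracket v w + v \<or>\<^sub>C contr_bracket u w"
  using contr_bracket_vee_left[of 0 u 0 v w] by simp

lemma bracket_even_skew:
  "has_parity 0 u \<Longrightarrow> has_parity 0 v \<Longrightarrow> contr_bracket u v = - contr_bracket v u"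
  using contr_bracket_skew[of 0 u 0 v] by simp

lemma quad_expansion:
  "quad A =
    A $ X1 $ X1 *s basis (gset True False False True False False) +
    A $ X1 $ Xm1 *s basis (gset True False False False True False) +
    A $ X1 $ H0 *s basis (gset True False True False False False) +
    A $ Xm1 $ X1 *s basis (gset False True False True False False) +
    A $ Xm1 $ Xm1 *s basis (gset False True False False True False) +
    A $ Xm1 $ H0 *s basis (gset False True True False False False) -
    A $ H0 $ X1 *s basis (gset False False False True False True) -
    A $ H0 $ Xm1 *s basis (gset False False False False True True) -
    A $ H0 $ H0 *s basis (gset False False True False False True)"
  by (simp add: quad_def unit_quad_def sum_heis gset_empty gset_insert vee_gset reorder_sign_gset algebra_simps)

lemma euler_expansion:
  "euler = basis (gset True False False True False False) + basis (gset False True False False True False)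
    - basis (gset False False True False False True)"
  by (simp add: quad_expansion mat_def)

lemma quad_vee_quad:
  "quad A \<or>\<^sub>C quad B =
    (A $ X1 $ X1 * B $ Xm1 $ H0 + A $ Xm1 $ H0 * B $ X1 $ X1 - A $ X1 $ H0 * B $ Xm1 $ X1 - A $ Xm1 $ X1 * B $ X1 $ H0)
      *s basis (gset True True True True False False) +
    (A $ X1 $ Xm1 * B $ Xm1 $ H0 + A $ Xm1 $ H0 * B $ X1 $ Xm1 - A $ X1 $ H0 * B $ Xm1 $ Xm1 - A $ Xm1 $ Xm1 * B $ X1 $ H0)
      *s basis (gset True True True False True False) +
    (A $ X1 $ Xm1 * B $ Xm1 $ X1 + A $ Xm1 $ X1 * B $ X1 $ Xm1 - A $ X1 $ X1 * B $ Xm1 $ Xm1 - A $ Xm1 $ Xm1 * B $ X1 $ X1)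
      *s basis (gset True True False True True False) +
    (A $ X1 $ X1 * B $ H0 $ H0 + A $ H0 $ H0 * B $ X1 $ X1 - A $ X1 $ H0 * B $ H0 $ X1 - A $ H0 $ X1 * B $ X1 $ H0)
      *s basis (gset True False True True False True) +
    (A $ X1 $ Xm1 * B $ H0 $ H0 + A $ H0 $ H0 * B $ X1 $ Xm1 - A $ X1 $ H0 * B $ H0 $ Xm1 - A $ H0 $ Xm1 * B $ X1 $ H0)
      *s basis (gset True False True False True True) +
    (A $ X1 $ Xm1 * B $ H0 $ X1 + A $ H0 $ X1 * B $ X1 $ Xm1 - A $ X1 $ X1 * B $ H0 $ Xm1 - A $ H0 $ Xm1 * B $ X1 $ X1)
      *s basis (gset True False False True True True) +
    (A $ Xm1 $ X1 * B $ H0 $ H0 + A $ H0 $ H0 * B $ Xm1 $ X1 - A $ Xm1 $ H0 * B $ H0 $ X1 - A $ H0 $ X1 * B $ Xm1 $ H0)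
      *s basis (gset False True True True False True) +
    (A $ Xm1 $ Xm1 * B $ H0 $ H0 + A $ H0 $ H0 * B $ Xm1 $ Xm1 - A $ Xm1 $ H0 * B $ H0 $ Xm1 - A $ H0 $ Xm1 * B $ Xm1 $ H0)
      *s basis (gset False True True False True True) +
    (A $ Xm1 $ Xm1 * B $ H0 $ X1 + A $ H0 $ X1 * B $ Xm1 $ Xm1 - A $ Xm1 $ X1 * B $ H0 $ Xm1 - A $ H0 $ Xm1 * B $ Xm1 $ X1)
      *s basis (gset False True False True True True)"
  unfolding quad_expansion
  by (simp add: vee_linear vee_diff vee_minus vee_gset reorder_sign_gset) (simp add: vec_eq_iff algebra_simps)

lemma quad_euler_expansion:
  "quad A \<or>\<^sub>C euler =
    - (A $ X1 $ X1 + A $ Xm1 $ Xm1) *s basis (gset True True False True True False) +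
    (A $ X1 $ X1 + A $ H0 $ H0) *s basis (gset True False True True False True) +
    (A $ Xm1 $ Xm1 + A $ H0 $ H0) *s basis (gset False True True False True True) +
    A $ X1 $ Xm1 *s basis (gset True False True False True True) -
    A $ X1 $ H0 *s basis (gset True True True False True False) +
    A $ Xm1 $ X1 *s basis (gset False True True True False True) +
    A $ Xm1 $ H0 *s basis (gset True True True True False False) +
    A $ H0 $ X1 *s basis (gset False True False True True True) -
    A $ H0 $ Xm1 *s basis (gset True False False True True True)"
  unfolding euler_expansion unfolding quad_expansion
  by (simp add: vee_linear vee_diff vee_minus vee_gset reorder_sign_gset)

lemma euler_square_expansion:
  "euler \<or>\<^sub>C euler = - 2 *s basis (gset True True False True True False)
    + 2 *s basis (gset True False True True False True) + 2 *s basis (gset False True True False True True)"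
  unfolding euler_expansion
  by (simp add: vee_linear vee_diff vee_minus vee_gset reorder_sign_gset) (simp add: vec_eq_iff algebra_simps)

lemma quad_euler_square:
  "quad A \<or>\<^sub>C (euler \<or>\<^sub>C euler) = (2 * trace A) *s basis (gset True True True True True True)"
  unfolding euler_square_expansion unfolding quad_expansion
  by (simp add: vee_linear vee_diff vee_minus vee_gset reorder_sign_gset)
     (simp add: vec_eq_iff trace_def sum_heis algebra_simps)

text \<open>
  The Cayley-Hamilton theorem in dimension 3, polarised. For a diagonal matrix with entries
  \<open>u, v, w\<close> of sum zero and commuting square-zero elements \<open>t\<^sub>1, t\<^sub>2, t\<^sub>3\<close> it is the identity
  \<open>2uv = - 2(u\<^sup>2 + v\<^sup>2) + (u\<^sup>2 + v\<^sup>2 + w\<^sup>2)\<close> for the coefficient of \<open>t\<^sub>1t\<^sub>2\<close>.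
\<close>

lemma quad_square:
  fixes A B :: "('k::field_char_0, heis) sqmat"
  assumes "trace A = 0" "trace B = 0"
  shows "quad A \<or>\<^sub>C quad B = - (quad (A ** B + B ** A) \<or>\<^sub>C euler) + (trace (A ** B) / 2) *s (euler \<or>\<^sub>C euler)"
proof -
  have A: "A $ H0 $ H0 = - A $ X1 $ X1 - A $ Xm1 $ Xm1" and B: "B $ H0 $ H0 = - B $ X1 $ X1 - B $ Xm1 $ Xm1"
    using assms by (simp_all add: trace_def sum_heis algebra_simps) (metis add.commute add_eq_0_iff add.left_commute)+
  show ?thesis
    unfolding euler_square_expansion unfolding quad_vee_quad[of A B] quad_euler_expansion
    by (simp add: vector_add_ldistrib vector_ssub_ldistrib vector_smult_assoc)
       (simp add: vec_eq_iff matrix_matrix_mult_def trace_def sum_heis A B algebra_simps)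
qed

lemma contract_gset:
  "contract (Inl H0) (basis (gset a b c x y h)) = (if c
    then reorder_sign (gset False False True False False False) (gset a b False x y h) *s basis (gset a b False x y h) else 0)"
  "contract (Inr X1) (basis (gset a b c x y h)) = (if x
    then reorder_sign (gset False False False True False False) (gset a b c False y h) *s basis (gset a b c False y h) else 0)"
  "contract (Inr Xm1) (basis (gset a b c x y h)) = (if y
    then reorder_sign (gset False False False False True False) (gset a b c x False h) *s basis (gset a b c x False h) else 0)"
  by (simp_all add: contract_basis gset_empty gset_insert gset_Diff)

lemma heis_diff_eq_gset:
  "heis_diff u = basis (gset True True False False False False) \<or>\<^sub>C contract (Inl H0) u
    + basis (gset False True False False False True) \<or>\<^sub>C contract (Inr X1) u
    - basis (gset True False False False False True) \<or>\<^sub>C contract (Inr Xm1) u"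
  by (simp add: heis_diff_eq gset_empty gset_insert)

lemmas heis_diff_simps = heis_diff_eq_gset contract_linear contract_gset vee_linear vee_diff vee_minus
  vee_gset reorder_sign_gset

lemma contract_diff: "contract g (a - b) = contract g a - contract g b"
  using contract_linear(1)[of g a "- b"] by (simp add: contract_linear)

lemma volume_gset: "heis_volume = basis (gset True True False False False True)"
  by (simp add: gset_empty gset_insert)

text \<open>
  A matrix acts on the volume element of \<open>L\<close> by its trace, so \<open>quad A\<close> is a cocycle exactly for
  traceless \<open>A\<close>.
\<close>

lemma heis_diff_quad: "heis_diff (quad A) = - trace A *s heis_volume"
  unfolding quad_expansion
  by (simp add: heis_diff_simps contract_diff volume_gset)
     (simp add: vec_eq_iff trace_def sum_heis algebra_simps)

text \<open>
  Each term of \<open>quad A\<close> has a factor in \<open>L\<close>, and four elements of \<open>L\<close> have product zero.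
\<close>

lemma quad_vee_volume: "quad A \<or>\<^sub>C heis_volume = 0"
  unfolding quad_expansion volume_gset by (simp add: vee_linear vee_diff vee_gset)

lemma UNIV_gset: "UNIV = gset True True True True True True"
  unfolding set_eq_iff all_gens by simp

lemma quad_euler_square_top: "quad A \<or>\<^sub>C (euler \<or>\<^sub>C euler) = (2 * trace A) *s basis UNIV"
  unfolding UNIV_gset by (rule quad_euler_square)

lemma trace_one_heis: "trace (mat 1 :: ('k::field, heis) sqmat) = 3"
  by (simp add: trace_I UNIV_heis)

lemma euler_cube: "euler \<or>\<^sub>C (euler \<or>\<^sub>C euler) = 6 *s basis UNIV"
  by (simp add: quad_euler_square_top trace_one_heis)

text \<open>
  The one exact class in \<open>\<Lambda>\<^sup>2L \<otimes> \<Lambda>\<^sup>2L\<^sup>*\<close>, the image of the volume element \<open>cxy\<close> of \<open>L\<^sup>*\<close>. Dividing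
  by it reduces the nine dimensions of this space to the eight of traceless matrices.
\<close>

lemma euler_square_exact:
  "euler \<or>\<^sub>C euler = heis_diff (- 2 *s basis (gset False False True True True False))"
  unfolding euler_square_expansion
  by (simp add: heis_diff_simps contract_diff)

section \<open>The embedding of the semidirect product\<close>

text \<open>
  Multiplying by \<open>euler\<close> commutes with the bracket by all \<open>quad A\<close>, so \<open>quad B \<or>\<^sub>C euler\<close> is a second copy
  of the adjoint representation; the minus sign is the one in \<open>quad_square\<close>. The unit and the top
  monomial account for the two copies of the scalar matrices.
\<close>

definition heis_embed :: "('k::field, heis) sqmat \<times> ('k, heis) sqmat \<Rightarrow> ('k, heis) cochain" where
  "heis_embed p = scal_part (fst p) *s basis {} + quad (sl_part (fst p))
    - quad (sl_part (snd p)) \<or>\<^sub>C euler + scal_part (snd p) *s basis UNIV"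

lemma heis_embed_linear:
  fixes p q :: "('k::field_char_0, heis) sqmat \<times> ('k, heis) sqmat"
  shows "heis_embed (p + q) = heis_embed p + heis_embed q"
    "heis_embed (p - q) = heis_embed p - heis_embed q"
    "heis_embed (c *\<^sub>m fst p, c *\<^sub>m snd p) = c *s heis_embed p"
    "heis_embed (0 :: ('k, heis) sqmat \<times> ('k, heis) sqmat) = 0"
  by (simp_all add: heis_embed_def scal_part_linear sl_part_linear quad_linear vee_linear vee_diff vec_eq_iff
      algebra_simps)

lemma even_elements:
  "has_parity 0 (quad A)" "has_parity 0 (quad A \<or>\<^sub>C euler)" "has_parity 0 (euler \<or>\<^sub>C euler)"
  "has_parity 0 (basis {})" "has_parity 0 (basis UNIV :: ('k::field, heis) cochain)"
proof -
  show "has_parity 0 (basis UNIV :: ('k::field, heis) cochain)"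
    by (rule has_parity_basis) (simp add: UNIV_gens)
qed (intro parity_even_vee parity_quad has_parity_basis, simp?)+

lemma heis_diff_even_vee:
  "has_parity 0 u \<Longrightarrow> heis_diff (u \<or>\<^sub>C v) = heis_diff u \<or>\<^sub>C v + u \<or>\<^sub>C heis_diff v"
  using ce_diff_vee[of 0 u heis_bracket v] by simp

lemma heis_embed_cocycle:
  fixes p :: "('k::field_char_0, heis) sqmat \<times> ('k, heis) sqmat"
  shows "heis_embed p \<in> even_cocycles heis_bracket"
proof -
  have "heis_diff (basis {} :: ('k, heis) cochain) = 0"
    by (simp add: heis_diff_eq contract_basis)
  moreover have "heis_diff (quad (sl_part (snd p)) \<or>\<^sub>C euler) = 0"
    by (simp add: heis_diff_even_vee[OF parity_quad] heis_diff_quad vee_linear vee_minus quad_vee_volume)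
  moreover have "heis_diff (basis UNIV :: ('k, heis) cochain) = 0"
    unfolding UNIV_gset by (simp add: heis_diff_simps)
  ultimately have "heis_diff (heis_embed p) = 0"
    by (simp add: heis_embed_def ce_diff_linear heis_diff_quad)
  moreover have "has_parity 0 (heis_embed p)"
    unfolding heis_embed_def diff_conv_add_uminus vector_sneg_minus1
    by (intro has_parity_linear even_elements)
  ultimately show ?thesis by (simp add: even_cocycles_def)
qed

text \<open>
  Passing from \<open>AB + BA\<close> to its traceless part changes the coefficient of the exact term from \<open>1/2\<close> to
  \<open>1/2 - 2/3\<close>.
\<close>

lemma quad_square_sl_plus:
  fixes A B :: "('k::field_char_0, heis) sqmat"
  assumes "trace A = 0" "trace B = 0"
  shows "quad A \<or>\<^sub>C quad B = - (quad (sl_plus A B) \<or>\<^sub>C euler) - (trace (A ** B) / 6) *s (euler \<or>\<^sub>C euler)"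
proof -
  have "CARD(heis) = 3" by (simp add: UNIV_heis)
  then have "sl_plus A B = A ** B + B ** A - (2 / 3 * trace (A ** B)) *\<^sub>m mat 1"
    by (simp add: sl_plus_def mat_smult_linear)
  then have eq: "quad (sl_plus A B) = quad (A ** B + B ** A) - (2 / 3 * trace (A ** B)) *s euler"
    by (simp only: quad_linear)
  show ?thesis
    unfolding quad_square[OF assms] eq by (simp add: vee_diff vee_linear vec_eq_iff field_simps)
qed

lemma quad_quad_euler:
  fixes A B :: "('k::field_char_0, heis) sqmat"
  assumes "trace A = 0" "trace B = 0"
  shows "quad A \<or>\<^sub>C (quad B \<or>\<^sub>C euler) = - trace (A ** B) *s basis UNIV"
proof -
  have "quad A \<or>\<^sub>C (quad B \<or>\<^sub>C euler) =
      (- (quad (sl_plus A B) \<or>\<^sub>C euler) - (trace (A ** B) / 6) *s (euler \<or>\<^sub>C euler)) \<or>\<^sub>C euler"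
    by (simp add: vee_assoc flip: quad_square_sl_plus[OF assms])
  also have "\<dots> = - (quad (sl_plus A B) \<or>\<^sub>C (euler \<or>\<^sub>C euler))
      - (trace (A ** B) / 6) *s (euler \<or>\<^sub>C (euler \<or>\<^sub>C euler))"
    by (simp only: vee_diff vee_minus vee_linear vee_assoc)
  also have "\<dots> = - trace (A ** B) *s basis UNIV"
    unfolding euler_cube by (simp add: quad_euler_square_top vector_smult_assoc)
  finally show ?thesis .
qed

lemma vee_top:
  "quad A \<or>\<^sub>C basis UNIV = 0" "basis UNIV \<or>\<^sub>C quad A = 0"
  "basis UNIV \<or>\<^sub>C basis UNIV = (0 :: ('k::field, heis) cochain)"
  by (simp_all add: quad_def unit_quad_def vee_sum vee_linear vee_basis)

text \<open>
  The only term that does not match is the exact one of \<open>quad_square_sl_plus\<close>. Products of two elements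
  \<open>quad B \<or>\<^sub>C euler\<close>, and all products with the top monomial that do not involve the unit, vanish for
  reasons of trace or degree.
\<close>

lemma heis_embed_mult:
  fixes p q :: "('k::field_char_0, heis) sqmat \<times> ('k, heis) sqmat"
  shows "heis_embed p \<or>\<^sub>C heis_embed q - heis_embed (gl_mult p q) =
    - (trace (sl_part (fst p) ** sl_part (fst q)) / 6) *s (euler \<or>\<^sub>C euler)"
proof -
  define Ap Bp Aq Bq where parts: "Ap = sl_part (fst p)" "Bp = sl_part (snd p)" "Aq = sl_part (fst q)" "Bq = sl_part (snd q)"
  let ?W = "(scal_part (fst p) * scal_part (fst q)) *s basis {}
      + (scal_part (fst p) *s quad Aq + scal_part (fst q) *s quad Ap)
      - (scal_part (fst p) *s (quad Bq \<or>\<^sub>C euler) + scal_part (fst q) *s (quad Bp \<or>\<^sub>C euler)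
         + quad (sl_plus Ap Aq) \<or>\<^sub>C euler)
      + (scal_part (fst p) * scal_part (snd q) + scal_part (snd p) * scal_part (fst q)
         + trace (Ap ** Bq) + trace (Bp ** Aq)) *s basis UNIV"
  have tr: "trace Ap = 0" "trace Bp = 0" "trace Aq = 0" "trace Bq = 0"
    by (simp_all add: parts)
  have "quad Bp \<or>\<^sub>C euler \<or>\<^sub>C quad Aq = - trace (Bp ** Aq) *s basis UNIV"
    by (subst even_vee_commute[OF even_elements(2,1)])
       (simp add: quad_quad_euler tr trace_mul_sym[of Aq Bp])
  moreover have "quad Bp \<or>\<^sub>C euler \<or>\<^sub>C (quad Bq \<or>\<^sub>C euler) = 0"
  proof -
    have "quad Bp \<or>\<^sub>C euler \<or>\<^sub>C (quad Bq \<or>\<^sub>C euler) = quad Bp \<or>\<^sub>C (quad Bq \<or>\<^sub>C (euler \<or>\<^sub>C euler))"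
      by (metis even_vee_commute parity_quad vee_assoc)
    then show ?thesis by (simp add: quad_euler_square_top tr)
  qed
  moreover have "quad C \<or>\<^sub>C euler \<or>\<^sub>C basis UNIV = 0" "basis UNIV \<or>\<^sub>C (quad C \<or>\<^sub>C euler) = 0" for C :: "('k, heis) sqmat"
    by (simp_all add: vee_assoc vee_top flip: vee_assoc[of "basis UNIV"])
  ultimately have "heis_embed p \<or>\<^sub>C heis_embed q = ?W - (trace (Ap ** Aq) / 6) *s (euler \<or>\<^sub>C euler)"
    unfolding heis_embed_def parts[symmetric]
    by (simp add: vee_linear vee_diff vee_top quad_square_sl_plus quad_quad_euler tr)
       (simp add: vec_eq_iff algebra_simps)
  moreover have "heis_embed (gl_mult p q) = ?W"
    unfolding heis_embed_def by (simp add: gl_parts parts quad_linear vee_linear)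
  ultimately show ?thesis unfolding parts by simp
qed

lemma contr_bracket_unit: "contr_bracket (basis {}) u = 0" "contr_bracket u (basis {}) = 0"
  by (simp_all add: contr_bracket_def contract_basis parity_inv_linear)

text \<open>
  The element \<open>euler\<close> commutes with \<open>quad A\<close>, and hence so do its powers.
\<close>

lemma bracket_quad_euler:
  "contr_bracket (quad A) euler = 0" "contr_bracket (quad A) (quad B \<or>\<^sub>C euler) = quad (commutator A B) \<or>\<^sub>C euler"
  "contr_bracket (quad A) (euler \<or>\<^sub>C euler) = 0" "contr_bracket (quad A) (euler \<or>\<^sub>C (euler \<or>\<^sub>C euler)) = 0"
proof -
  have "commutator A (mat 1) = 0" by (simp add: commutator_def)
  then show 1: "contr_bracket (quad A) euler = 0"
    by (simp add: bracket_quad quad_linear)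
  show "contr_bracket (quad A) (quad B \<or>\<^sub>C euler) = quad (commutator A B) \<or>\<^sub>C euler"
    by (simp add: bracket_even_vee_right parity_quad 1) (simp add: bracket_quad)
  show 2: "contr_bracket (quad A) (euler \<or>\<^sub>C euler) = 0"
    by (simp add: bracket_even_vee_right parity_quad 1)
  show "contr_bracket (quad A) (euler \<or>\<^sub>C (euler \<or>\<^sub>C euler)) = 0"
    by (simp add: bracket_even_vee_right parity_quad 1)
qed

text \<open>
  The top monomial is a multiple of the cube of \<open>euler\<close>.
\<close>

lemma bracket_top:
  fixes A :: "('k::field_char_0, heis) sqmat"
  shows "contr_bracket (quad A) (basis UNIV) = 0" "contr_bracket (basis UNIV) (quad A) = 0"
    "contr_bracket (quad A \<or>\<^sub>C euler) (basis UNIV) = 0" "contr_bracket (basis UNIV) (quad A \<or>\<^sub>C euler) = 0"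
    "contr_bracket (basis UNIV) (basis UNIV :: ('k, heis) cochain) = 0"
proof -
  have top: "basis UNIV = (1 / 6) *s (euler \<or>\<^sub>C (euler \<or>\<^sub>C euler) :: ('k, heis) cochain)"
    by (simp add: euler_cube vector_smult_assoc)
  show 1: "contr_bracket (quad A) (basis UNIV) = 0" for A :: "('k, heis) sqmat"
    by (simp add: top contr_bracket_scale bracket_quad_euler)
  show "contr_bracket (basis UNIV) (quad A) = 0"
    by (subst bracket_even_skew[OF even_elements(5,1)]) (simp add: 1)
  show 2: "contr_bracket (quad A \<or>\<^sub>C euler) (basis UNIV) = 0" for A :: "('k, heis) sqmat"
    by (simp add: bracket_even_vee_left parity_quad 1)
  show "contr_bracket (basis UNIV) (quad A \<or>\<^sub>C euler) = 0"
    by (subst bracket_even_skew[OF even_elements(5,2)]) (simp add: 2)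
  have "contr_bracket (euler \<or>\<^sub>C (euler \<or>\<^sub>C euler)) (basis UNIV :: ('k, heis) cochain) = 0"
    by (simp add: bracket_even_vee_left[OF parity_quad even_elements(3)] 1 2)
  then have "(1 / 6) *s contr_bracket (euler \<or>\<^sub>C (euler \<or>\<^sub>C euler)) (basis UNIV :: ('k, heis) cochain) = 0"
    by simp
  then show "contr_bracket (basis UNIV) (basis UNIV :: ('k, heis) cochain) = 0"
    by (simp only: top[symmetric] flip: contr_bracket_scale(1))
qed

text \<open>
  Between \<open>quad A\<close> and any other summand this is \<open>bracket_quad\<close> and the fact that \<open>euler\<close> commutes with
  \<open>quad A\<close>. The bracket of two elements of the abelian factor is
  \<open>quad C \<or>\<^sub>C euler \<or>\<^sub>C euler\<close> for a commutator \<open>C\<close>, and this is zero because \<open>C\<close> is traceless.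
\<close>

lemma heis_embed_bracket:
  fixes p q :: "('k::field_char_0, heis) sqmat \<times> ('k, heis) sqmat"
  shows "contr_bracket (heis_embed p) (heis_embed q) = heis_embed (gl_bracket p q)"
proof -
  define Ap Bp Aq Bq where parts: "Ap = sl_part (fst p)" "Bp = sl_part (snd p)" "Aq = sl_part (fst q)" "Bq = sl_part (snd q)"
  have left: "contr_bracket (quad Bp \<or>\<^sub>C euler) (quad Aq) = - (quad (commutator Aq Bp) \<or>\<^sub>C euler)"
    by (subst bracket_even_skew[OF even_elements(2,1)]) (simp add: bracket_quad_euler)
  have "contr_bracket (quad Bp \<or>\<^sub>C euler) (quad Bq \<or>\<^sub>C euler) = euler \<or>\<^sub>C (quad (commutator Bp Bq) \<or>\<^sub>C euler)"
    by (simp add: bracket_even_vee_left parity_quad bracket_quad_euler commutator_def quad_linear)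
  also have "\<dots> = quad (commutator Bp Bq) \<or>\<^sub>C (euler \<or>\<^sub>C euler)"
    by (metis even_vee_commute parity_quad vee_assoc)
  also have "\<dots> = 0" by (simp add: quad_euler_square_top)
  finally have both: "contr_bracket (quad Bp \<or>\<^sub>C euler) (quad Bq \<or>\<^sub>C euler) = 0" .
  have minus: "contr_bracket (u - v) w = contr_bracket u w - contr_bracket v w"
    "contr_bracket w (u - v) = contr_bracket w u - contr_bracket w v" for u v w :: "('k, heis) cochain"
    using contr_bracket_add(1)[of u "- v" w] contr_bracket_add(2)[of w u "- v"]
    by (simp_all add: contr_bracket_minus)
  have "contr_bracket (heis_embed p) (heis_embed q) =
      quad (commutator Ap Aq) - quad (commutator Ap Bq - commutator Aq Bp) \<or>\<^sub>C euler"
    unfolding heis_embed_def parts[symmetric]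
    by (simp add: contr_bracket_add contr_bracket_scale minus contr_bracket_unit bracket_quad
        bracket_quad_euler bracket_top left both quad_linear vee_diff)
  then show ?thesis
    by (simp add: heis_embed_def gl_parts parts)
qed

section \<open>Cocycles modulo coboundaries\<close>

lemma card_gset:
  "card (gset a b c x y h) = of_bool a + of_bool b + of_bool c + of_bool x + of_bool y + of_bool h"
proof -
  have "card (gset a b c x y h) = (\<Sum>g\<in>UNIV. if g \<in> gset a b c x y h then 1 else 0)"
    by (simp flip: sum.inter_filter)
  then show ?thesis by (simp add: UNIV_gens of_bool_def)
qed

lemma heis_diff_nth:
  "heis_diff u $ index_of (gset a b c x y h) =
    (if a \<and> b \<and> \<not> c then reorder_sign (gset True True False False False False) (gset False False False x y h)
       * reorder_sign (gset False False True False False False) (gset False False False x y h)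
       * u $ index_of (gset False False True x y h) else 0)
  + (if b \<and> h \<and> \<not> x then reorder_sign (gset False True False False False True) (gset a False c False y False)
       * reorder_sign (gset False False False True False False) (gset a False c False y False)
       * u $ index_of (gset a False c True y False) else 0)
  - (if a \<and> h \<and> \<not> y then reorder_sign (gset True False False False False True) (gset False b c x False False)
       * reorder_sign (gset False False False False True False) (gset False b c x False False)
       * u $ index_of (gset False b c x True False) else 0)"
  by (simp add: heis_diff_eq_gset basis_vee_nth contract_gset_nth gset_empty gset_insert gset_subset_iff gset_Diff)

text \<open>
  In \<open>\<Lambda>\<^sup>iL \<otimes> \<Lambda>\<^sup>jL\<^sup>*\<close> with \<open>i + j\<close> even: for \<open>(0,2)\<close> and \<open>(1,3)\<close> the differential is injective; on \<open>(1,1)\<close>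
  its kernel consists of the traceless matrices; for \<open>(2,0)\<close> and \<open>(3,1)\<close> everything is exact; on
  \<open>(2,2)\<close> the map \<open>M \<mapsto> quad M \<or>\<^sub>C euler\<close> is bijective; and \<open>(0,0)\<close> and \<open>(3,3)\<close> are spanned by the unit
  and the top monomial.
\<close>

lemma even_cocycle_normal_form:
  fixes z :: "('k::field_char_0, heis) cochain"
  assumes "z \<in> even_cocycles heis_bracket"
  obtains s t A M u where "trace A = 0" "has_parity 1 u"
    "z = s *s basis {} + quad A - quad M \<or>\<^sub>C euler + t *s basis UNIV + heis_diff u"
proof -
  from assms have par: "has_parity 0 z" and diff: "heis_diff z = 0" by (auto simp: even_cocycles_def)
  define Z where "Z a b c x y h = z $ index_of (gset a b c x y h)" for a b c x y h
  have odd: "Z a b c x y h = 0" if "odd (of_bool a + of_bool b + of_bool c + of_bool x + of_bool y + of_bool h :: nat)"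
    for a b c x y h
    using par that unfolding has_parity_def Z_def by (metis add_0_right card_gset gens_of_index_of)
  note nth = heis_diff_nth[of z, folded Z_def, unfolded diff]
  \<comment> \<open>Each of these components of \<open>dz\<close> receives a contribution from a single coefficient of \<open>z\<close>.\<close>
  have van: "Z False False True True False False = 0" "Z False False True False True False = 0"
    "Z False False False True True False = 0" "Z True False True True True False = 0"
    "Z False True True True True False = 0" "Z False False True True True True = 0"
    using nth[of False True True False False True] nth[of True False True False False True]
      nth[of False True False False True True] nth[of True True True False True True]
      nth[of True True True True False True] nth[of True True False True True True]
    by (simp_all add: reorder_sign_gset)
  have tr: "Z True False False True False False + Z False True False False True False - Z False False True False False True = 0"
    using nth[of True True False False False True] by (simp add: reorder_sign_gset algebra_simps)
  \<comment> \<open>The coefficients of \<open>z\<close> read off from \<open>quad_expansion\<close>.\<close>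
  define A :: "('k, heis) sqmat" where "A = (\<chi> i j. case i of
      X1 \<Rightarrow> (case j of X1 \<Rightarrow> Z True False False True False False | Xm1 \<Rightarrow> Z True False False False True False | H0 \<Rightarrow> Z True False True False False False)
    | Xm1 \<Rightarrow> (case j of X1 \<Rightarrow> Z False True False True False False | Xm1 \<Rightarrow> Z False True False False True False | H0 \<Rightarrow> Z False True True False False False)
    | H0 \<Rightarrow> (case j of X1 \<Rightarrow> - Z False False False True False True | Xm1 \<Rightarrow> - Z False False False False True True | H0 \<Rightarrow> - Z False False True False False True))"
  \<comment> \<open>The diagonal of \<open>M\<close> enters \<open>quad_euler_expansion\<close> only through the sums of two entries \<open>p\<close>, \<open>q\<close>, \<open>r\<close>.\<close>
  define p q r where "p = Z True True False True True False" "q = - Z True False True True False True" "r = - Z False True True False True True"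
  define M :: "('k, heis) sqmat" where "M = (\<chi> i j. case i of
      X1 \<Rightarrow> (case j of X1 \<Rightarrow> (p + q - r) / 2 | Xm1 \<Rightarrow> - Z True False True False True True | H0 \<Rightarrow> Z True True True False True False)
    | Xm1 \<Rightarrow> (case j of X1 \<Rightarrow> - Z False True True True False True | Xm1 \<Rightarrow> (p + r - q) / 2 | H0 \<Rightarrow> - Z True True True True False False)
    | H0 \<Rightarrow> (case j of X1 \<Rightarrow> - Z False True False True True True | Xm1 \<Rightarrow> Z True False False True True True | H0 \<Rightarrow> (q + r - p) / 2))"
  \<comment> \<open>A primitive of the components in \<open>(2,0)\<close> and \<open>(3,1)\<close>, from \<open>dc = ab\<close>, \<open>dx = bh\<close> and \<open>dy = -ah\<close>.\<close>
  define u where "u = Z True True False False False False *s basis (gset False False True False False False)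
    + Z False True False False False True *s basis (gset False False False True False False)
    - Z True False False False False True *s basis (gset False False False False True False)
    - Z True True True False False True *s basis (gset True False True True False False)
    + Z True True False False True True *s basis (gset True False False True True False)
    - Z True True False True False True *s basis (gset False True False True True False)"
  have "trace A = 0" using tr by (simp add: A_def trace_def sum_heis)
  moreover have "has_parity 1 u"
    unfolding u_def diff_conv_add_uminus vector_sneg_minus1
    by (intro has_parity_linear has_parity_basis) (simp_all add: card_gset)
  moreover have "z = Z False False False False False False *s basis {} + quad A - quad M \<or>\<^sub>C euler
      + Z True True True True True True *s basis UNIV + heis_diff u"
  proof -
    have du: "heis_diff u = Z True True False False False False *s basis (gset True True False False False False)
      + Z False True False False False True *s basis (gset False True False False False True)
      + Z True False False False False True *s basis (gset True False False False False True)
      + Z True True True False False True *s basis (gset True True True False False True)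
      + Z True True False False True True *s basis (gset True True False False True True)
      + Z True True False True False True *s basis (gset True True False True False True)"
      unfolding u_def by (simp add: heis_diff_simps contract_diff)
    have M: "M $ X1 $ X1 + M $ Xm1 $ Xm1 = p" "M $ X1 $ X1 + M $ H0 $ H0 = q" "M $ Xm1 $ Xm1 + M $ H0 $ H0 = r"
      by (simp_all add: M_def field_simps)
    show ?thesis
    proof (rule heis_cochain_eqI)
      fix a b c x y h
      show "z $ index_of (gset a b c x y h) = (Z False False False False False False *s basis {} + quad A
        - quad M \<or>\<^sub>C euler + Z True True True True True True *s basis UNIV + heis_diff u) $ index_of (gset a b c x y h)"
        unfolding du quad_euler_expansion quad_expansion[of A] M
        unfolding gset_empty UNIV_gset Z_def[symmetric]
        by (cases a; cases b; cases c; cases x; cases y; cases h;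
            simp add: basis_gset_nth odd van A_def M_def p_q_r_def)
    qed
  qed
  ultimately show thesis by (rule that)
qed

text \<open>
  The differential raises the degree in \<open>L\<close> by two and lowers the degree in \<open>L\<^sup>*\<close> by one. A coboundary
  therefore has no component in \<open>(0,0)\<close>, \<open>(1,1)\<close> and \<open>(3,3)\<close>, and in \<open>(2,2)\<close> it is a multiple of the
  square of \<open>euler\<close>, hence corresponds to a scalar matrix.
\<close>

lemma heis_embed_injective:
  fixes P :: "('k::field_char_0, heis) sqmat \<times> ('k, heis) sqmat"
  assumes "heis_embed P \<in> even_coboundaries heis_bracket"
  shows "P = 0"
proof -
  from assms obtain u where u: "heis_embed P = heis_diff u" by (auto simp: even_coboundaries_def)
  define A M where "A = sl_part (fst P)" and "M = sl_part (snd P)"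
  have tr: "trace A = 0" "trace M = 0" by (simp_all add: A_def M_def)
  have *: "(scal_part (fst P) *s basis (gset False False False False False False) + quad A - quad M \<or>\<^sub>C euler
     + scal_part (snd P) *s basis (gset True True True True True True)) $ index_of (gset a b c x y h) =
     heis_diff u $ index_of (gset a b c x y h)" for a b c x y h
    using u by (simp add: heis_embed_def A_def M_def gset_empty UNIV_gset)
  note nth = *[unfolded heis_diff_nth quad_euler_expansion quad_expansion[of A]]
  have s: "scal_part (fst P) = 0" "scal_part (snd P) = 0"
    using nth[of False False False False False False] nth[of True True True True True True]
    by (simp_all add: basis_gset_nth)
  have "A $ i $ j = 0" for i j
    using nth[of True False False True False False] nth[of True False False False True False]
      nth[of True False True False False False] nth[of False True False True False False]
      nth[of False True False False True False] nth[of False True True False False False]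
      nth[of False False False True False True] nth[of False False False False True True]
      nth[of False False True False False True]
    by (cases i; cases j; simp add: basis_gset_nth reorder_sign_gset)
  then have A: "A = 0" by (simp add: vec_eq_iff)
  \<comment> \<open>Of the monomials in \<open>(0,3)\<close> there is only \<open>cxy\<close>, so one coefficient of \<open>u\<close> governs all of \<open>(2,2)\<close>.\<close>
  have off: "M $ X1 $ Xm1 = 0" "M $ X1 $ H0 = 0" "M $ Xm1 $ X1 = 0" "M $ Xm1 $ H0 = 0" "M $ H0 $ X1 = 0" "M $ H0 $ Xm1 = 0"
    using nth[of True False True False True True] nth[of True True True False True False]
      nth[of False True True True False True] nth[of True True True True False False]
      nth[of False True False True True True] nth[of True False False True True True]
    by (simp_all add: basis_gset_nth reorder_sign_gset)
  define w where "w = u $ index_of (gset False False True True True False)"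
  have neg: "v + v' = v''" if "- v - v' = - v''" for v v' v'' :: 'k
    using that by (metis add.inverse_inverse minus_diff_eq diff_minus_eq_add add.commute)
  have d: "M $ X1 $ X1 + M $ Xm1 $ Xm1 = w" "M $ X1 $ X1 + M $ H0 $ H0 = w" "M $ Xm1 $ Xm1 + M $ H0 $ H0 = w"
  proof -
    show "M $ X1 $ X1 + M $ Xm1 $ Xm1 = w"
      using nth[of True True False True True False] by (simp add: w_def basis_gset_nth reorder_sign_gset add.commute)
    show "M $ X1 $ X1 + M $ H0 $ H0 = w" "M $ Xm1 $ Xm1 + M $ H0 $ H0 = w"
      by (rule neg; use nth[of True False True True False True] nth[of False True True False True True]
          in \<open>simp add: w_def basis_gset_nth reorder_sign_gset\<close>)+
  qed
  have "M $ X1 $ X1 + M $ Xm1 $ Xm1 + M $ H0 $ H0 = 0"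
    using tr by (simp add: trace_def sum_heis)
  then have m3: "M $ H0 $ H0 = - w" unfolding d(1) by (simp add: add_eq_0_iff)
  then have m12: "M $ X1 $ X1 = 2 * w" "M $ Xm1 $ Xm1 = 2 * w"
    using d(2,3) by (simp_all add: diff_eq_eq)
  have "3 * w = 0" using d(1) unfolding m12 by (simp add: algebra_simps)
  then have "M $ i $ j = 0" for i j
    using off m3 m12 by (cases i; cases j) simp_all
  then have "M = 0" by (simp add: vec_eq_iff)
  with s A show ?thesis
    by (intro pair_mat_eqI) (simp_all add: A_def M_def scal_part_linear sl_part_linear)
qed

lemma even_coboundaries_subset_cocycles:
  "even_coboundaries (heis_bracket :: ('k::field_char_0, heis) vec \<Rightarrow> _) \<subseteq> even_cocycles heis_bracket"
proof
  fix z :: "('k, heis) cochain"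
  assume "z \<in> even_coboundaries heis_bracket"
  then obtain u where u: "has_parity 1 u" "z = heis_diff u" by (auto simp: even_coboundaries_def)
  then have "has_parity 0 z" using has_parity_cong[OF ce_diff_parity[OF u(1)], of 0] by simp
  then show "z \<in> even_cocycles heis_bracket"
    using u by (simp add: even_cocycles_def heis_diff_square)
qed

lemma euler_square_coboundary:
  "c *s (euler \<or>\<^sub>C euler) \<in> even_coboundaries (heis_bracket :: ('k::field_char_0, heis) vec \<Rightarrow> _)"
proof (rule even_coboundaries_linear(3))
  have "has_parity 1 (- 2 *s basis (gset False False True True True False) :: ('k, heis) cochain)"
    by (intro has_parity_linear has_parity_basis) (simp add: card_gset)
  then show "euler \<or>\<^sub>C euler \<in> even_coboundaries (heis_bracket :: ('k, heis) vec \<Rightarrow> _)"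
    unfolding even_coboundaries_def euler_square_exact by blast
qed

text \<open>
  The normal form allows an arbitrary matrix in \<open>\<Lambda>\<^sup>2L \<otimes> \<Lambda>\<^sup>2L\<^sup>*\<close>; its scalar part contributes a multiple
  of the exact element \<open>euler \<or>\<^sub>C euler\<close>.
\<close>

lemma heis_embed_surjective:
  fixes z :: "('k::field_char_0, heis) cochain"
  assumes "z \<in> even_cocycles heis_bracket"
  shows "\<exists>P. z - heis_embed P \<in> even_coboundaries heis_bracket"
proof -
  obtain s t A M u where "trace A = 0" and u: "has_parity 1 u"
    and z: "z = s *s basis {} + quad A - quad M \<or>\<^sub>C euler + t *s basis UNIV + heis_diff u"
    using even_cocycle_normal_form[OF assms] .
  have "M = scal_part M *\<^sub>m mat 1 + sl_part M"
    using mat_scal_part_add_sl_part[of M] by (simp add: mat_smult_linear)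
  then have M: "quad M = scal_part M *s euler + quad (sl_part M)"
    by (metis quad_linear(1,3))
  have "heis_embed (mat s + A, mat t + sl_part M) =
      s *s basis {} + quad A - quad (sl_part M) \<or>\<^sub>C euler + t *s basis UNIV"
    using \<open>trace A = 0\<close> by (simp add: heis_embed_def scal_sl_part_decomp)
  then have "z - heis_embed (mat s + A, mat t + sl_part M) =
      heis_diff u - scal_part M *s (euler \<or>\<^sub>C euler)"
    unfolding z M by (simp add: vee_linear)
  moreover have "heis_diff u \<in> even_coboundaries heis_bracket"
    using u by (auto simp: even_coboundaries_def)
  ultimately show ?thesis
    using even_coboundaries_linear(4) euler_square_coboundary by metis
qed

section \<open>The isomorphism\<close>

text \<open>
  Matrices indexed by an arbitrary three-element type are carried over to matrices indexed by the basis
  of \<open>L\<close>.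
\<close>

definition reindex :: "('m \<Rightarrow> 'n) \<Rightarrow> ('k::field, 'n::finite) sqmat \<Rightarrow> ('k, 'm::finite) sqmat" where
  "reindex f A = (\<chi> i j. A $ f i $ f j)"

lemma reindex_linear:
  "reindex f (A + B) = reindex f A + reindex f B" "reindex f (A - B) = reindex f A - reindex f B"
  "reindex f (c *\<^sub>m A) = c *\<^sub>m reindex f A" "reindex f 0 = 0"
  by (simp_all add: reindex_def mat_smult_def vec_eq_iff)

lemma reindex_algebra:
  fixes f :: "'m::finite \<Rightarrow> 'n::finite" and A B :: "('k::field_char_0, 'n) sqmat"
  assumes "bij f"
  shows "reindex f (A ** B) = reindex f A ** reindex f B" "trace (reindex f A) = trace A"
    "reindex f (mat c :: ('k, 'n) sqmat) = mat c" "scal_part (reindex f A) = scal_part A"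
    "sl_part (reindex f A) = reindex f (sl_part A)"
    "sl_plus (reindex f A) (reindex f B) = reindex f (sl_plus A B)"
    "commutator (reindex f A) (reindex f B) = reindex f (commutator A B)"
proof -
  have sum: "(\<Sum>i\<in>UNIV. g (f i)) = (\<Sum>i\<in>UNIV. g i)" for g :: "'n \<Rightarrow> 'k"
    using assms by (rule sum.reindex_bij_betw)
  have card: "CARD('m) = CARD('n)" using assms by (rule bij_betw_same_card)
  show mult: "reindex f (A ** B) = reindex f A ** reindex f B" for A B :: "('k, 'n) sqmat"
    by (simp add: reindex_def matrix_matrix_mult_def vec_eq_iff sum[of "\<lambda>k. A $ _ $ k * B $ k $ _"])
  show tr: "trace (reindex f A) = trace A" for A :: "('k, 'n) sqmat"
    by (simp add: reindex_def trace_def sum[of "\<lambda>k. A $ k $ k"])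
  show mat: "reindex f (mat c :: ('k, 'n) sqmat) = mat c" for c :: 'k
    using bij_is_inj[OF assms] by (simp add: reindex_def mat_def vec_eq_iff inj_eq)
  show "scal_part (reindex f A) = scal_part A"
    by (simp add: scal_part_def tr card)
  then show "sl_part (reindex f A) = reindex f (sl_part A)"
    by (simp add: sl_part_def reindex_linear mat)
  show "sl_plus (reindex f A) (reindex f B) = reindex f (sl_plus A B)"
    by (simp add: sl_plus_def reindex_linear mult mat tr card flip: mult)
  show "commutator (reindex f A) (reindex f B) = reindex f (commutator A B)"
    by (simp add: commutator_def reindex_linear mult)
qed

lemma even_cohomology_heisenberg:
  fixes P :: "('k::field_char_0, ('k, 'n::finite) sqmat \<times> ('k, 'n) sqmat) poisson_struct"
  defines "P \<equiv> gl_poisson"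
  assumes "CARD('n) = 3"
  shows "poisson_algebra (HE (heis_bracket :: ('k, heis) vec \<Rightarrow> _))"
    and "poisson_isomorphic P (HE (heis_bracket :: ('k, heis) vec \<Rightarrow> _))"
proof -
  have "CARD(heis) = CARD('n)" using assms(2) by (simp add: UNIV_heis)
  then obtain f :: "heis \<Rightarrow> 'n" where f: "bij f"
    using finite_same_card_bij[of "UNIV :: heis set" "UNIV :: 'n set"] by auto
  define R where "R = (\<lambda>p :: ('k, 'n) sqmat \<times> ('k, 'n) sqmat. (reindex f (fst p), reindex f (snd p)))"
  have R_linear: "R (p + q) = R p + R q" "R (p - q) = R p - R q" "R 0 = 0"
    "R (c *\<^sub>m fst p, c *\<^sub>m snd p) = (c *\<^sub>m fst (R p), c *\<^sub>m snd (R p))" for p q c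
    by (simp_all add: R_def reindex_linear zero_prod_def)
  have R_mult: "R (gl_mult p q) = gl_mult (R p) (R q)" for p q
    by (rule pair_mat_eqI)
       (simp_all add: R_def gl_parts reindex_algebra[OF f] reindex_linear flip: reindex_algebra(1)[OF f])
  have R_bracket: "R (gl_bracket p q) = gl_bracket (R p) (R q)" for p q
    by (simp add: R_def gl_bracket_def case_prod_beta reindex_algebra[OF f] reindex_linear)
  have R_inj: "p = 0" if "R p = 0" for p
  proof -
    have "X = 0" if "reindex f X = 0" for X :: "('k, 'n) sqmat"
    proof -
      have "X $ f i $ f j = 0" for i j
        using that by (simp add: reindex_def vec_eq_iff)
      then have "X $ i $ j = 0" for i j
        using bij_is_surj[OF f] by (metis surjD)
      then show ?thesis by (simp add: vec_eq_iff)
    qed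
    with that show ?thesis by (auto simp: R_def prod_eq_iff)
  qed
  have R_surj: "\<exists>p. R p = q" for q
  proof (rule exI)
    show "R (reindex (inv f) (fst q), reindex (inv f) (snd q)) = q"
      using bij_is_inj[OF f] by (simp add: R_def reindex_def)
  qed
  let ?B = "even_coboundaries (heis_bracket :: ('k, heis) vec \<Rightarrow> _)"
  have mult: "heis_embed (R p) \<or>\<^sub>C heis_embed (R q) - heis_embed (R (gl_mult p q)) \<in> ?B" for p q
    unfolding R_mult heis_embed_mult by (rule euler_square_coboundary)
  have bracket: "contr_bracket (heis_embed (R p)) (heis_embed (R q)) - heis_embed (R (gl_bracket p q)) \<in> ?B" for p q
    unfolding R_bracket heis_embed_bracket by (simp add: even_coboundaries_linear)
  have inj: "p = q" if "heis_embed (R p) - heis_embed (R q) \<in> ?B" for p q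
  proof -
    from that have "heis_embed (R (p - q)) \<in> ?B" by (simp add: R_linear heis_embed_linear)
    then have "p - q = 0" by (intro R_inj heis_embed_injective)
    then show ?thesis by simp
  qed
  have surj: "\<exists>p\<in>UNIV. z - heis_embed (R p) \<in> ?B" if "z \<in> even_cocycles heis_bracket" for z
    using heis_embed_surjective[OF that] R_surj by (metis UNIV_I)
  have "poisson_algebra (HE (heis_bracket :: ('k, heis) vec \<Rightarrow> _)) \<and>
      poisson_isomorphic P (HE (heis_bracket :: ('k, heis) vec \<Rightarrow> _))"
    unfolding P_def
  proof (rule conjI; rule HE_presentation[OF poisson_algebra_gl even_coboundaries_subset_cocycles,
        where F = "\<lambda>p. heis_embed (R p)"]; unfold gl_poisson_simps gl_smult_eq)
  qed (rule mult | rule bracket | rule inj, assumption | rule surj, assumption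
      | simp add: R_linear heis_embed_linear heis_embed_cocycle; fail)+
  then show "poisson_algebra (HE (heis_bracket :: ('k, heis) vec \<Rightarrow> _))"
    and "poisson_isomorphic P (HE (heis_bracket :: ('k, heis) vec \<Rightarrow> _))" by blast+
qed

theorem theorem3p6:
  shows "poisson_algebra (gl_poisson :: ('k::field_char_0, ('k, 'n::finite) sqmat \<times> ('k, 'n) sqmat) poisson_struct) \<and>
    (CARD('n) = 3 \<longrightarrow>
      poisson_algebra (HE (heis_bracket :: 'k^heis \<Rightarrow> 'k^heis \<Rightarrow> 'k^heis)) \<and>
      poisson_isomorphic
        (gl_poisson :: ('k, ('k, 'n) sqmat \<times> ('k, 'n) sqmat) poisson_struct)
        (HE (heis_bracket :: 'k^heis \<Rightarrow> 'k^heis \<Rightarrow> 'k^heis))) \<and>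
    (\<comment> \<open>the decomposition, its stability under \<open>GL\<close>, and equivariance of the operations\<close>
     \<forall>z :: ('k, 'n) sqmat \<times> ('k, 'n) sqmat. \<exists>!t. case t of (a, A, b, B) \<Rightarrow>
       A \<in> sl \<and> B \<in> sl \<and> z = (in_I_0 a + in_sl_0 A) + (in_I_ab b + in_sl_ab B)) \<and>
    (\<forall>g :: ('k, 'n) sqmat. invertible g \<longrightarrow>
      (\<forall>a. gl_act g (in_I_0 a) = in_I_0 a \<and> gl_act g (in_I_ab a) = in_I_ab a) \<and>
      (\<forall>A \<in> sl. conj_by g A \<in> sl \<and> gl_act g (in_sl_0 A) = in_sl_0 (conj_by g A) \<and>
        gl_act g (in_sl_ab A) = in_sl_ab (conj_by g A)) \<and>
      (\<forall>x y. gl_act g (mult gl_poisson x y) = mult gl_poisson (gl_act g x) (gl_act g y)) \<and>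
      (\<forall>x y. gl_act g (bracket gl_poisson x y) = bracket gl_poisson (gl_act g x) (gl_act g y))) \<and>
    (\<comment> \<open>the two tables\<close>
     \<forall>(a :: 'k) (b :: 'k). \<forall>A \<in> (sl :: ('k, 'n) sqmat set). \<forall>B \<in> (sl :: ('k, 'n) sqmat set).
      sl_plus A B \<in> sl \<and> commutator A B \<in> sl \<and>
      mult gl_poisson (in_I_0 a) (in_I_0 b) = (in_I_0 (a * b) :: ('k, 'n) sqmat \<times> ('k, 'n) sqmat) \<and>
      mult gl_poisson (in_I_0 a) (in_sl_0 B) = in_sl_0 (a *\<^sub>m B) \<and>
      mult gl_poisson (in_I_0 a) (in_sl_ab B) = in_sl_ab (a *\<^sub>m B) \<and>
      mult gl_poisson (in_I_0 a) (in_I_ab b) = (in_I_ab (a * b) :: ('k, 'n) sqmat \<times> ('k, 'n) sqmat) \<and>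
      mult gl_poisson (in_sl_0 A) (in_I_0 b) = in_sl_0 (b *\<^sub>m A) \<and>
      mult gl_poisson (in_sl_0 A) (in_sl_0 B) = in_sl_ab (sl_plus A B) \<and>
      mult gl_poisson (in_sl_0 A) (in_sl_ab B) = in_I_ab (trace (A ** B)) \<and>
      mult gl_poisson (in_sl_0 A) (in_I_ab b) = 0 \<and>
      mult gl_poisson (in_sl_ab A) (in_I_0 b) = in_sl_ab (b *\<^sub>m A) \<and>
      mult gl_poisson (in_sl_ab A) (in_sl_0 B) = in_I_ab (trace (A ** B)) \<and>
      mult gl_poisson (in_sl_ab A) (in_sl_ab B) = 0 \<and>
      mult gl_poisson (in_sl_ab A) (in_I_ab b) = 0 \<and>
      mult gl_poisson (in_I_ab a) (in_I_0 b) = (in_I_ab (a * b) :: ('k, 'n) sqmat \<times> ('k, 'n) sqmat) \<and>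
      mult gl_poisson (in_I_ab a) (in_sl_0 B) = 0 \<and>
      mult gl_poisson (in_I_ab a) (in_sl_ab B) = 0 \<and>
      mult gl_poisson (in_I_ab a) (in_I_ab b) = (0 :: ('k, 'n) sqmat \<times> ('k, 'n) sqmat) \<and>
      bracket gl_poisson (in_I_0 a) (in_I_0 b) = (0 :: ('k, 'n) sqmat \<times> ('k, 'n) sqmat) \<and>
      bracket gl_poisson (in_I_0 a) (in_sl_0 B) = 0 \<and>
      bracket gl_poisson (in_I_0 a) (in_sl_ab B) = 0 \<and>
      bracket gl_poisson (in_I_0 a) (in_I_ab b) = (0 :: ('k, 'n) sqmat \<times> ('k, 'n) sqmat) \<and>
      bracket gl_poisson (in_sl_0 A) (in_I_0 b) = 0 \<and>
      bracket gl_poisson (in_sl_0 A) (in_sl_0 B) = in_sl_0 (commutator A B) \<and>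
      bracket gl_poisson (in_sl_0 A) (in_sl_ab B) = in_sl_ab (commutator A B) \<and>
      bracket gl_poisson (in_sl_0 A) (in_I_ab b) = 0 \<and>
      bracket gl_poisson (in_sl_ab A) (in_I_0 b) = 0 \<and>
      bracket gl_poisson (in_sl_ab A) (in_sl_0 B) = in_sl_ab (commutator A B) \<and>
      bracket gl_poisson (in_sl_ab A) (in_sl_ab B) = 0 \<and>
      bracket gl_poisson (in_sl_ab A) (in_I_ab b) = 0 \<and>
      bracket gl_poisson (in_I_ab a) (in_I_0 b) = (0 :: ('k, 'n) sqmat \<times> ('k, 'n) sqmat) \<and>
      bracket gl_poisson (in_I_ab a) (in_sl_0 B) = 0 \<and>
      bracket gl_poisson (in_I_ab a) (in_sl_ab B) = 0 \<and>
      bracket gl_poisson (in_I_ab a) (in_I_ab b) = (0 :: ('k, 'n) sqmat \<times> ('k, 'n) sqmat))"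
proof (intro conjI impI allI ballI)
  show "poisson_algebra (gl_poisson :: ('k, ('k, 'n) sqmat \<times> ('k, 'n) sqmat) poisson_struct)"
    by (rule poisson_algebra_gl)
next
  assume "CARD('n) = 3"
  then show "poisson_algebra (HE (heis_bracket :: 'k^heis \<Rightarrow> 'k^heis \<Rightarrow> 'k^heis))"
    "poisson_isomorphic (gl_poisson :: ('k, ('k, 'n) sqmat \<times> ('k, 'n) sqmat) poisson_struct)
      (HE (heis_bracket :: 'k^heis \<Rightarrow> 'k^heis \<Rightarrow> 'k^heis))"
    by (rule even_cohomology_heisenberg)+
qed (rule gl_decomposition, simp_all add: gl_poisson_simps gl_act_equivariant gl_mult_table gl_bracket_table
    gl_act_summands conj_by_algebra_hom sl_def)

end
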